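(* Let $G$ be a 2-connected graph on $n$ vertices with $\delta(G)\geq k$, and let $C$ be a longest cycle in $G$, of length $c\in[10,n-1]$. If $e(G)>\max\{f(n,k+1,c),f(n,\lfloor c/2\rfloor,c)\}$, then the $C$-closure $\overline{G}$ of $G$ is isomorphic to $W_{n,k,c}$ or to $Z_{n,k,c}$.
   Context: Graphs are simple and finite. The $m$-closure of a graph is obtained by recursively joining pairs of nonadjacent vertices whose degree sum (in the current graph) is at least $m$ until no such pair remains. For a cycle $C$ of length $c$ in $G$, the $C$-closure $\overline{G}$ is obtained from $G$ by replacing $G[V(C)]$ by its $(c+1)$-closure. $W_{n,k,c}$: a clique $K_{c-k+1}$ plus $n-(c-k+1)$ new vertices each joined exactly to the same $k$ vertices of the clique. $f(n,k,c)=\binom{c-k+1}{2}+k(n-c+k-1)$. $Z_{n,k,c}$: union of a clique $K_{c-k+1}$ and $\frac{n-(c-k+1)}{k-1}$ cliques $K_{k+1}$ such that any two of these cliques share exactly the same two vertices. *)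

theory Defs
  imports Complex_Main
begin

record 'a ugraph =
  verts :: "'a set"
  edges :: "'a set set"

definition all_pairs :: "'a set \<Rightarrow> 'a set set" where
  "all_pairs S = {e. e \<subseteq> S \<and> card e = 2}"

definition simple_graph :: "'a ugraph \<Rightarrow> bool" where
  "simple_graph G \<longleftrightarrow> finite (verts G) \<and> edges G \<subseteq> all_pairs (verts G)"

definition degree :: "'a ugraph \<Rightarrow> 'a \<Rightarrow> nat" where
  "degree G v = card {e \<in> edges G. v \<in> e}"

definition min_degree :: "'a ugraph \<Rightarrow> nat" where
  "min_degree G = Min (degree G ` verts G)"

definition induced :: "'a ugraph \<Rightarrow> 'a set \<Rightarrow> 'a ugraph" where
  "induced G S = \<lparr>verts = verts G \<inter> S, edges = {e \<in> edges G. e \<subseteq> S}\<rparr>"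

definition graph_connected :: "'a ugraph \<Rightarrow> bool" where
  "graph_connected G \<longleftrightarrow> verts G \<noteq> {} \<and>
     (\<forall>u \<in> verts G. \<forall>v \<in> verts G. (u, v) \<in> {(x, y). {x, y} \<in> edges G}\<^sup>*)"

definition two_connected :: "'a ugraph \<Rightarrow> bool" where
  "two_connected G \<longleftrightarrow> card (verts G) > 2 \<and>
     (\<forall>X \<subseteq> verts G. card X < 2 \<longrightarrow> graph_connected (induced G (verts G - X)))"

definition graph_iso :: "'a ugraph \<Rightarrow> 'b ugraph \<Rightarrow> bool" where
  "graph_iso G H \<longleftrightarrow> (\<exists>\<phi>. bij_betw \<phi> (verts G) (verts H) \<and>
     (\<forall>u \<in> verts G. \<forall>v \<in> verts G. {u, v} \<in> edges G \<longleftrightarrow> {\<phi> u, \<phi> v} \<in> edges H))"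

text \<open>A cycle is given by the list of its vertices in cyclic order, so its length is the length
  of the list and its vertex set is the set of the list.\<close>

definition is_cycle :: "'a ugraph \<Rightarrow> 'a list \<Rightarrow> bool" where
  "is_cycle G C \<longleftrightarrow> length C \<ge> 3 \<and> distinct C \<and> set C \<subseteq> verts G \<and>
     (\<forall>i < length C. {C ! i, C ! (Suc i mod length C)} \<in> edges G)"

definition longest_cycle :: "'a ugraph \<Rightarrow> 'a list \<Rightarrow> bool" where
  "longest_cycle G C \<longleftrightarrow> is_cycle G C \<and> (\<forall>D. is_cycle G D \<longrightarrow> length D \<le> length C)"

definition closure_step :: "nat \<Rightarrow> 'a ugraph \<Rightarrow> 'a ugraph \<Rightarrow> bool" where
  "closure_step m G H \<longleftrightarrow> (\<exists>u \<in> verts G. \<exists>v \<in> verts G. u \<noteq> v \<and> {u, v} \<notin> edges G \<and>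
     degree G u + degree G v \<ge> m \<and> H = G\<lparr>edges := insert {u, v} (edges G)\<rparr>)"

definition is_closure :: "nat \<Rightarrow> 'a ugraph \<Rightarrow> 'a ugraph \<Rightarrow> bool" where
  "is_closure m G H \<longleftrightarrow> (closure_step m)\<^sup>*\<^sup>* G H \<and> (\<nexists>K. closure_step m H K)"

text \<open>For simple graphs the description is justified by \<open>ex1_closure\<close> below: the process ends, and
  the result does not depend on the order in which the edges are added.\<close>

definition m_closure :: "nat \<Rightarrow> 'a ugraph \<Rightarrow> 'a ugraph" where
  "m_closure m G = (THE H. is_closure m G H)"

definition C_closure :: "'a ugraph \<Rightarrow> 'a list \<Rightarrow> 'a ugraph" where
  "C_closure G C = G\<lparr>edges := (edges G - edges (induced G (set C))) \<union>
     edges (m_closure (length C + 1) (induced G (set C)))\<rparr>"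

text \<open>In the definitions below subtraction is on \<open>nat\<close>; it truncates nothing when \<open>k \<le> c + 1\<close>
  and \<open>c < n\<close>, and the \<open>k\<close> special vertices of \<open>W_graph\<close> lie in the clique when \<open>2 * k \<le> c + 1\<close>.
  A 2-connected graph on \<open>n\<close> vertices with minimum degree at least \<open>k\<close> and circumference \<open>c < n\<close>
  satisfies \<open>2 * k \<le> c\<close> by Dirac's theorem.\<close>

definition f_edges :: "nat \<Rightarrow> nat \<Rightarrow> nat \<Rightarrow> nat" where
  "f_edges n k c = ((c + 1 - k) choose 2) + k * (n + k - (c + 1))"

definition W_graph :: "nat \<Rightarrow> nat \<Rightarrow> nat \<Rightarrow> nat ugraph" where
  "W_graph n k c = \<lparr>verts = {..<n},
     edges = all_pairs {..<c + 1 - k} \<union> {{u, v} | u v. u \<in> {..<k} \<and> v \<in> {c + 1 - k..<n}}\<rparr>"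

text \<open>The shared vertices are 0 and 1. If \<open>k - 1\<close> does not divide \<open>n - (c + 1 - k)\<close>, no graph
  \<open>Z\<close> on \<open>n\<close> vertices exists; the graph below then has fewer than \<open>n\<close> vertices and hence is not
  isomorphic to any graph on \<open>n\<close> vertices.\<close>

definition Z_cliques :: "nat \<Rightarrow> nat \<Rightarrow> nat \<Rightarrow> nat set set" where
  "Z_cliques n k c = insert {..<c + 1 - k}
     {{0, 1} \<union> {c + 1 - k + i * (k - 1)..<c + 1 - k + (i + 1) * (k - 1)} | i.
        i < (n - (c + 1 - k)) div (k - 1)}"

definition Z_graph :: "nat \<Rightarrow> nat \<Rightarrow> nat \<Rightarrow> nat ugraph" where
  "Z_graph n k c = \<lparr>verts = \<Union> (Z_cliques n k c), edges = \<Union> (all_pairs ` Z_cliques n k c)\<rparr>"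

lemma simple_graph_induced: "simple_graph G \<Longrightarrow> simple_graph (induced G S)"
  by (auto simp: simple_graph_def induced_def all_pairs_def)

lemma finite_edges: "simple_graph G \<Longrightarrow> finite (edges G)"
  unfolding simple_graph_def all_pairs_def
  by (rule finite_subset[of _ "Pow (verts G)"]) auto

lemma closure_step_simple:
  assumes "closure_step m G H" "simple_graph G"
  shows "simple_graph H \<and> verts H = verts G \<and> edges G \<subset> edges H"
proof -
  obtain u v where uv: "u \<in> verts G" "v \<in> verts G" "u \<noteq> v" "{u, v} \<notin> edges G"
    "H = G\<lparr>edges := insert {u, v} (edges G)\<rparr>"
    using assms(1) unfolding closure_step_def by blast
  then show ?thesis using assms(2) by (auto simp: simple_graph_def all_pairs_def)
qed

lemma closure_steps_simple:
  assumes "(closure_step m)\<^sup>*\<^sup>* G H" "simple_graph G"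
  shows "simple_graph H \<and> verts H = verts G"
  using assms by (induction rule: rtranclp_induct) (auto dest: closure_step_simple)

lemma closure_steps_below:
  assumes "(closure_step m)\<^sup>*\<^sup>* G K" "simple_graph H" "verts H = verts G"
    "edges G \<subseteq> edges H" "\<nexists>L. closure_step m H L"
  shows "verts K = verts G \<and> edges K \<subseteq> edges H"
  using assms(1)
proof (induction rule: rtranclp_induct)
  case base
  then show ?case using assms by simp
next
  case (step K L)
  then obtain u v where uv: "u \<in> verts K" "v \<in> verts K" "u \<noteq> v"
    "degree K u + degree K v \<ge> m" "L = K\<lparr>edges := insert {u, v} (edges K)\<rparr>"
    unfolding closure_step_def by blast
  have "degree K w \<le> degree H w" for w
    unfolding degree_def using step finite_edges[OF assms(2)] by (intro card_mono) auto
  then have "degree H u + degree H v \<ge> m"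
    using uv(4) by (meson add_mono le_trans)
  then have "{u, v} \<in> edges H"
    using assms(3,5) uv(1-3) step.IH unfolding closure_step_def by metis
  then show ?case using uv step.IH by simp
qed

lemma closure_steps_mono:
  "(closure_step m)\<^sup>*\<^sup>* G H \<Longrightarrow> edges G \<subseteq> edges H"
  by (induction rule: rtranclp_induct) (auto simp: closure_step_def)

lemma ex_closure:
  assumes "simple_graph G"
  shows "\<exists>H. is_closure m G H"
  using assms
proof (induction "card (all_pairs (verts G) - edges G)" arbitrary: G rule: less_induct)
  case less
  show ?case
  proof (cases "\<exists>K. closure_step m G K")
    case False
    then show ?thesis unfolding is_closure_def by blast
  next
    case True
    then obtain K where K: "closure_step m G K" by blast
    note s = closure_step_simple[OF K less.prems]
    have "finite (all_pairs (verts G))"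
      using less.prems unfolding simple_graph_def all_pairs_def
      by (auto intro: finite_subset[of _ "Pow (verts G)"])
    moreover have "all_pairs (verts K) - edges K \<subset> all_pairs (verts G) - edges G"
    proof -
      obtain e where "e \<in> edges K" "e \<notin> edges G" using s by blast
      moreover have "e \<in> all_pairs (verts G)"
        using s calculation unfolding simple_graph_def by auto
      ultimately show ?thesis using s by auto
    qed
    ultimately have "card (all_pairs (verts K) - edges K) < card (all_pairs (verts G) - edges G)"
      by (meson finite_Diff psubset_card_mono)
    then obtain H where "is_closure m K H" using less.hyps s by blast
    then have "is_closure m G H"
      using K unfolding is_closure_def by (meson converse_rtranclp_into_rtranclp)
    then show ?thesis by blast
  qed
qed

lemma ex1_closure:
  assumes "simple_graph G"
  shows "\<exists>!H. is_closure m G H"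
proof (rule ex_ex1I[OF ex_closure[OF assms]])
  fix H K :: "'a ugraph"
  assume H: "is_closure m G H" and K: "is_closure m G K"
  have sH: "simple_graph H \<and> verts H = verts G" "simple_graph K \<and> verts K = verts G"
    using H K assms closure_steps_simple unfolding is_closure_def by blast+
  have HK: "(closure_step m)\<^sup>*\<^sup>* G H" "(closure_step m)\<^sup>*\<^sup>* G K"
    "\<nexists>L. closure_step m H L" "\<nexists>L. closure_step m K L"
    using H K unfolding is_closure_def by auto
  have "edges K \<subseteq> edges H"
    using closure_steps_below[OF HK(2) _ _ closure_steps_mono[OF HK(1)] HK(3)] sH by simp
  moreover have "edges H \<subseteq> edges K"
    using closure_steps_below[OF HK(1) _ _ closure_steps_mono[OF HK(2)] HK(4)] sH by simp
  ultimately show "H = K" using sH by (intro ugraph.equality) auto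
qed

lemma is_closure_m_closure: "simple_graph G \<Longrightarrow> is_closure m G (m_closure m G)"
  unfolding m_closure_def by (rule theI') (rule ex1_closure)

end

theory Submission
  imports Defs
begin

text \<open>Enlarge G to an edge-maximal graph F of circumference c. Then nonadjacent vertices are
  joined by a path on more than c vertices, and Kopylov's argument applies: a path on more than
  c vertices in a 2-connected graph gives a cycle that is longer than c or at least as long as the
  sum of the degrees of its ends on the path, so deleting vertices of degree at most \<open>c div 2\<close> repeatedly leaves a clique, on
  \<open>c + 1 - s\<close> vertices say, and deleting vertices of degree at most s repeatedly leaves the same
  clique H. Hence F has at most \<open>f(n, s, c)\<close> edges, and convexity of f together with the minimum
  degree forces \<open>s = k\<close>.

  A path outside H joining two vertices of H has at most \<open>k - 1\<close> inner vertices. Let p be the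
  number of vertices of a longest path outside H. Adding \<open>k - p\<close> further outside vertices to such a
  path and to H must not give a spanning cycle, and an Ore-type degree sum argument then leaves only
  two possibilities: \<open>p = 1\<close> and all outside vertices have the same k neighbours, or \<open>p = k - 1\<close> and
  the outside vertices form cliques on \<open>k - 1\<close> vertices, all joined to the same two vertices of H.

  The minimum degree of G forces G and F to agree on all edges that meet the outside. So few
  edges of H are missing in G that the closure restores all of them, whence the C-closure of
  G is F.\<close>

section \<open>Paths, cycles and the two-paths lemma\<close>

text \<open>Most constants come from \<open>card H + k = c + 1\<close>: a cycle through
  \<open>H\<close> and \<open>k\<close> further vertices would be too long, which is why
  \<open>k - p\<close> outside vertices are added to a path on p of them. The obstacle in the
  Ore-type argument is that it sees only neighbours in \<open>H\<close> and among the added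
  vertices, while the minimum degree counts all neighbours. The added vertices are therefore chosen
  one at a time as ends of longest paths in what is left of the outside; such an end has at most
  \<open>p - 1\<close> outside neighbours not chosen so far. This is exactly the loss that can be
  afforded: every estimate becomes an equality, and the structure of the outside is read off from
  equality.

  Kopylov's cycle rests on two disjoint paths that connect the two ends of a given path. The same
  construction also bounds the paths outside \<open>H\<close>, with a path that runs through all of
  \<open>H\<close> at its end.\<close>

definition nbrs :: "'a set set \<Rightarrow> 'a \<Rightarrow> 'a set" where
  "nbrs E v = {w. {v, w} \<in> E}"

definition pth :: "'a set set \<Rightarrow> 'a list \<Rightarrow> bool" where
  "pth E xs \<longleftrightarrow> distinct xs \<and> successively (\<lambda>u v. {u, v} \<in> E) xs"

definition cyc :: "'a set set \<Rightarrow> 'a list \<Rightarrow> bool" where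
  "cyc E xs \<longleftrightarrow> pth E xs \<and> 3 \<le> length xs \<and> {last xs, hd xs} \<in> E"

lemma nbrs_iff: "w \<in> nbrs E v \<longleftrightarrow> {v, w} \<in> E" "w \<in> nbrs E v \<longleftrightarrow> {w, v} \<in> E"
  by (auto simp: nbrs_def insert_commute)

lemma pth_append:
  "pth E (xs @ ys) \<longleftrightarrow> pth E xs \<and> pth E ys \<and> set xs \<inter> set ys = {} \<and>
     (xs = [] \<or> ys = [] \<or> {last xs, hd ys} \<in> E)"
  by (auto simp: pth_def successively_append_iff)

lemma pth_rev [simp]: "pth E (rev xs) = pth E xs"
  by (simp add: pth_def insert_commute)

lemma pth_Nil [simp]: "pth E []" and pth_single [simp]: "pth E [x]"
  by (auto simp: pth_def)

lemma pth_Cons: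
  "pth E (x # xs) \<longleftrightarrow> pth E xs \<and> x \<notin> set xs \<and> (xs = [] \<or> {x, hd xs} \<in> E)"
  using pth_append[of E "[x]" xs] by auto

lemma pth_distinct: "pth E xs \<Longrightarrow> distinct xs"
  by (simp add: pth_def)

lemma pth_mono: "pth E xs \<Longrightarrow> E \<subseteq> F \<Longrightarrow> pth F xs"
  unfolding pth_def
  using successively_mono[of "\<lambda>u v. {u, v} \<in> E" xs "\<lambda>u v. {u, v} \<in> F"] by blast

lemma cyc_mono: "cyc E xs \<Longrightarrow> E \<subseteq> F \<Longrightarrow> cyc F xs"
  unfolding cyc_def using pth_mono by blast

lemma pth_join:
  assumes "pth E xs" "pth E ys" "xs \<noteq> []" "ys \<noteq> []" "last xs = hd ys"
    "set xs \<inter> set ys \<subseteq> {hd ys}"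
  shows "pth E (xs @ tl ys)" "hd (xs @ tl ys) = hd xs" "last (xs @ tl ys) = last ys"
    "set (xs @ tl ys) = set xs \<union> set ys"
proof -
  obtain y zs where ys: "ys = y # zs" using assms(4) by (cases ys) auto
  have "y \<in> set xs" using assms ys last_in_set by fastforce
  then show "pth E (xs @ tl ys)" "hd (xs @ tl ys) = hd xs" "last (xs @ tl ys) = last ys"
    "set (xs @ tl ys) = set xs \<union> set ys"
    using assms ys by (auto simp: pth_append pth_Cons)
qed

text \<open>The inner vertices \<open>I\<close> of \<open>B\<close> are appended to \<open>M\<close>
  in reverse. \<open>B\<close> may be a single edge; then \<open>I\<close> is empty and that edge
  closes \<open>M\<close>.\<close>

lemma cyc_close:
  assumes M: "pth E M" "length M \<ge> 3" and B: "pth E B" "length B \<ge> 2"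
    and "hd B = hd M" "last B = last M" "set M \<inter> set B \<subseteq> {hd M, last M}"
  shows "\<exists>D. cyc E D \<and> set M \<subseteq> set D"
proof -
  obtain b B' where "B = b # B'" using B(2) by (cases B) auto
  moreover have "B' \<noteq> []" using B(2) calculation by auto
  ultimately obtain I d where I: "B = b # I @ [d]" by (metis append_butlast_last_id)
  have M0: "M \<noteq> []" using M(2) by auto
  have e: "hd M = b" "last M = d" using assms I by auto
  have dj: "set M \<inter> set I = {}"
    using assms(7) B(1) I e by (auto simp: pth_Cons pth_append)
  have "pth E (M @ rev I)"
    using M(1) B(1) I dj e by (auto simp: pth_append pth_Cons hd_rev insert_commute)
  moreover have "{last (M @ rev I), hd (M @ rev I)} \<in> E"
    using I B(1) e M0 by (cases I) (auto simp: pth_Cons insert_commute)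
  ultimately show ?thesis using M(2) by (intro exI[of _ "M @ rev I"]) (auto simp: cyc_def)
qed

text \<open>Walk back from \<open>w\<close> to \<open>hd P\<close>, jump to the first neighbour of
  \<open>hd P\<close> after \<open>w\<close>, and go on to the end. The skipped vertices lie
  strictly between \<open>w\<close> and this neighbour, so none of them is adjacent to
  \<open>hd P\<close>. The chord to \<open>last P\<close> guarantees that the jump is
  possible.\<close>

lemma end_detour:
  assumes P: "pth E P" and "{hd P, last P} \<in> E" "w \<in> set (butlast P)"
  shows "\<exists>Q. pth E Q \<and> Q \<noteq> [] \<and> hd Q = w \<and> last Q = last P \<and> set Q \<subseteq> set P \<and> hd P \<in> set Q \<and>
    nbrs E (hd P) \<inter> set P \<subseteq> set Q"
proof -
  have P0: "P \<noteq> []" using assms(3) by auto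
  define x p where "x = hd P" and "p = last P"
  obtain us vs where uv: "butlast P = us @ w # vs" using assms(3) by (meson split_list)
  have P1: "P = us @ w # vs @ [p]" using uv P0 unfolding p_def
    by (metis append_Cons append_assoc append_butlast_last_id)
  have "\<exists>s\<in>set (vs @ [p]). {x, s} \<in> E" using assms(2) by (simp add: x_def p_def)
  then obtain v1 s v2 where s: "vs @ [p] = v1 @ s # v2" "{x, s} \<in> E" "\<forall>y\<in>set v1. {x, y} \<notin> E"
    using split_list_first_prop[of "vs @ [p]" "\<lambda>s. {x, s} \<in> E"] by blast
  let ?Q = "rev (us @ [w]) @ s # v2"
  have P2: "P = (us @ [w]) @ v1 @ s # v2" using P1 s by simp
  have x: "x = hd (us @ [w])" unfolding x_def P1 by (cases us) auto
  have "pth E ?Q" using P s(2) x unfolding P2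
    by (auto simp: pth_append pth_Cons last_rev hd_rev hd_append insert_commute)
  moreover have "last ?Q = p" using s(1) by (metis append_is_Nil_conv last_ConsR last_append last_snoc list.distinct(1))
  moreover have "x \<in> set ?Q" using x by (cases us) auto
  moreover have "nbrs E x \<inter> set P \<subseteq> set ?Q" using s(3) unfolding P2 by (auto simp: nbrs_def)
  moreover have "set ?Q \<subseteq> set P" unfolding P2 by auto
  ultimately show ?thesis unfolding x_def[symmetric] p_def[symmetric]
    by (intro exI[of _ ?Q]) auto
qed

text \<open>Connectedness of every \<open>V - {z}\<close> is stated by cuts: each proper nonempty
  part sends an edge to the rest. In this form it passes at once to larger edge sets and yields
  paths by growing the set of reachable vertices.\<close>

definition conn2 :: "'a set \<Rightarrow> 'a set set \<Rightarrow> bool" where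
  "conn2 V E \<longleftrightarrow> 3 \<le> card V \<and> (\<forall>z\<in>V. \<forall>S. S \<subseteq> V - {z} \<and> S \<noteq> {} \<and> S \<noteq> V - {z} \<longrightarrow>
     (\<exists>u\<in>S. \<exists>w\<in>V - {z} - S. {u, w} \<in> E))"

lemma conn2_mono: "conn2 V E \<Longrightarrow> E \<subseteq> F \<Longrightarrow> conn2 V F"
  unfolding conn2_def by (meson subsetD)

lemma conn2_path:
  assumes "conn2 V E" "z \<in> V" "u \<in> V - {z}" "v \<in> V - {z}"
  shows "\<exists>xs. pth E xs \<and> xs \<noteq> [] \<and> hd xs = u \<and> last xs = v \<and> set xs \<subseteq> V - {z}"
proof -
  define S where "S = {w. \<exists>xs. pth E xs \<and> xs \<noteq> [] \<and> hd xs = u \<and> last xs = w \<and> set xs \<subseteq> V - {z}}"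
  have SV: "S \<subseteq> V - {z}" unfolding S_def using last_in_set by blast
  have "u \<in> S" unfolding S_def using assms(3) by (auto intro!: exI[of _ "[u]"])
  have "S = V - {z}"
  proof (rule ccontr)
    assume "S \<noteq> V - {z}"
    then obtain a b where ab: "a \<in> S" "b \<in> V - {z} - S" "{a, b} \<in> E"
      using assms(1,2) SV \<open>u \<in> S\<close> unfolding conn2_def by blast
    then obtain xs where xs: "pth E xs" "xs \<noteq> []" "hd xs = u" "last xs = a" "set xs \<subseteq> V - {z}"
      unfolding S_def by blast
    have "b \<notin> set xs"
    proof
      assume "b \<in> set xs"
      then obtain ys zs where "xs = ys @ b # zs" by (meson split_list)
      then have "xs = (ys @ [b]) @ zs" by simp
      moreover have "hd (ys @ [b]) = u" using xs \<open>xs = ys @ b # zs\<close> by (cases ys) auto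
      ultimately have "b \<in> S" using xs unfolding S_def
        by (intro CollectI exI[of _ "ys @ [b]"]) (auto simp: pth_append)
      then show False using ab by blast
    qed
    then have "b \<in> S" unfolding S_def using xs ab
      by (intro CollectI exI[of _ "xs @ [b]"]) (auto simp: pth_append)
    then show False using ab by blast
  qed
  then show ?thesis using assms(4) unfolding S_def by blast
qed

text \<open>A path in \<open>V - {z}\<close> from \<open>U\<close> to \<open>T\<close> is cut at its
  last vertex in \<open>U\<close> and then at the first vertex of \<open>T\<close> after
  that.\<close>

lemma conn2_jump:
  assumes "conn2 V E" "z \<in> V" "U \<subseteq> V - {z}" "T \<subseteq> V - {z}" "U \<noteq> {}" "T \<noteq> {}" "U \<inter> T = {}"
  shows "\<exists>J. pth E J \<and> length J \<ge> 2 \<and> set J \<subseteq> V - {z} \<and> hd J \<in> U \<and> last J \<in> T \<and>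
     set (tl J) \<inter> U = {} \<and> set (butlast J) \<inter> T = {}"
proof -
  obtain u t where ut: "u \<in> U" "t \<in> T" using assms by blast
  obtain xs where xs: "pth E xs" "xs \<noteq> []" "hd xs = u" "last xs = t" "set xs \<subseteq> V - {z}"
    using conn2_path[OF assms(1,2), of u t] ut assms(3,4) by blast
  have "\<exists>x\<in>set xs. x \<in> U" using xs ut by (meson hd_in_set)
  then obtain ys u' zs where a: "xs = ys @ u' # zs" "u' \<in> U" "\<forall>x\<in>set zs. x \<notin> U"
    using split_list_last_prop[of xs "\<lambda>x. x \<in> U"] by blast
  have "zs \<noteq> []" using a xs ut assms(7) by auto
  then have "last zs = t" using a xs by simp
  then have "\<exists>x\<in>set zs. x \<in> T" using ut(2) last_in_set[OF \<open>zs \<noteq> []\<close>] by blast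
  then obtain ms t' ws where b: "zs = ms @ t' # ws" "t' \<in> T" "\<forall>x\<in>set ms. x \<notin> T"
    using split_list_first_prop[of zs "\<lambda>x. x \<in> T"] by blast
  have "xs = ys @ (u' # ms @ [t']) @ ws" using a b by simp
  then have "pth E (u' # ms @ [t'])" "set (u' # ms @ [t']) \<subseteq> V - {z}"
    using xs(1,5) by (metis pth_append, auto)
  moreover have "u' \<notin> T" using a(2) assms(7) by auto
  ultimately show ?thesis using a b by (intro exI[of _ "u' # ms @ [t']"]) auto
qed

section \<open>Two disjoint paths between the ends of a given path\<close>

text \<open>The two paths are named by their last vertices, since moving \<open>q\<close> along a given path to the
  next vertex may interchange the roles of their first vertices.\<close>

definition link :: "'a set \<Rightarrow> 'a set set \<Rightarrow> 'a set \<Rightarrow> 'a \<Rightarrow> 'a \<Rightarrow> 'a set \<Rightarrow> 'a list \<Rightarrow> 'a list \<Rightarrow> bool"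
  where "link V E X p q T A B \<longleftrightarrow> pth E A \<and> pth E B \<and> A \<noteq> [] \<and> B \<noteq> [] \<and>
     set A \<union> set B \<subseteq> V \<and> set A \<inter> set B = {} \<and>
     (hd A = p \<and> hd B \<in> X \<or> hd A \<in> X \<and> hd B = p) \<and> last A = q \<and> last B \<in> T \<and>
     set (tl A) \<inter> insert p X = {} \<and> set (tl B) \<inter> insert p X = {} \<and>
     set (butlast A) \<inter> insert q T = {} \<and> set (butlast B) \<inter> insert q T = {}"

lemma set_hd_tl: "xs \<noteq> [] \<Longrightarrow> set xs = insert (hd xs) (set (tl xs))"
  by (cases xs) auto

lemma set_last_butlast: "xs \<noteq> [] \<Longrightarrow> set xs = insert (last xs) (set (butlast xs))"
  by (induction xs) auto

lemma pth_reroute: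
  assumes A: "pth E A" "z \<in> set A" and J: "pth E J" "J \<noteq> []" "hd J = z" "set (tl J) \<inter> set A = {}"
  shows "\<exists>A'. pth E A' \<and> A' \<noteq> [] \<and> hd A' = hd A \<and> last A' = last J \<and>
    set A' \<subseteq> set (butlast A) \<union> set J \<and> set (tl A') \<subseteq> set (tl A) \<union> set (tl J) \<and>
    set (butlast A') \<subseteq> set (butlast A) \<union> set (butlast J)"
proof -
  obtain A1 A2 where A12: "A = A1 @ z # A2" using A(2) by (meson split_list)
  obtain J' where J': "J = z # J'" using J by (cases J) auto
  have "pth E (A1 @ J)" using A(1) J J' A12 by (auto simp: pth_append)
  moreover have "hd (A1 @ J) = hd A" using A12 J' by (cases A1) auto
  moreover have "set A1 \<subseteq> set (butlast A)" using A12 by (simp add: butlast_append)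
  moreover have "set (tl (A1 @ J)) \<subseteq> set (tl A) \<union> set (tl J)"
    using A12 J' by (cases A1) auto
  ultimately show ?thesis using J(2) by (intro exI[of _ "A1 @ J"]) (auto simp: butlast_append)
qed

text \<open>An augmentation step as in Menger's theorem, moving the target from \<open>q\<close> to
  its successor \<open>q'\<close>. If \<open>B\<close> does not end in \<open>q'\<close>, it misses
  \<open>q'\<close>, and \<open>A\<close> is extended by the edge. If \<open>B\<close> ends in
  \<open>q'\<close>, a path \<open>J\<close> that avoids \<open>q'\<close> leads from the vertices
  in use to \<open>T\<close> and repairs the pair; the repair depends on where \<open>J\<close>
  starts.\<close>

lemma link_step:
  assumes conn: "conn2 V E" and L: "link V E X p q (insert q' T) A B"
    and V: "insert p X \<subseteq> V" "insert q' T \<subseteq> V" and dj: "insert p X \<inter> insert q' T = {}"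
    and q: "q \<notin> insert q' T" "q' \<notin> T" "{q, q'} \<in> E" and T: "T \<noteq> {}"
  shows "\<exists>A B. link V E X p q' T A B"
proof -
  have LA: "pth E A" "A \<noteq> []" "set A \<subseteq> V" "last A = q" "set (tl A) \<inter> insert p X = {}"
    "set (butlast A) \<inter> insert q (insert q' T) = {}" using L unfolding link_def by auto
  have LB: "pth E B" "B \<noteq> []" "set B \<subseteq> V" "last B \<in> insert q' T" "set (tl B) \<inter> insert p X = {}"
    "set (butlast B) \<inter> insert q (insert q' T) = {}" using L unfolding link_def by auto
  have AB: "set A \<inter> set B = {}" "hd A = p \<and> hd B \<in> X \<or> hd A \<in> X \<and> hd B = p"
    using L unfolding link_def by auto
  have setA: "set A = insert q (set (butlast A))"
    using set_last_butlast[OF LA(2)] LA(4) by simp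
  note setB = set_last_butlast[OF LB(2)]
  have q'A: "q' \<notin> set A" and TA: "set A \<inter> T = {}" using LA(6) setA q by auto
  have extA: "pth E (A @ [q'])" "hd (A @ [q']) = hd A" "set (tl (A @ [q'])) \<inter> insert p X = {}"
    "set (butlast (A @ [q'])) \<inter> insert q' T = {}" "set (A @ [q']) \<subseteq> V"
    using LA q q'A TA dj V by (auto simp: pth_append)
  show ?thesis
  proof (cases "last B = q'")
    case False
    then have "link V E X p q' T (A @ [q']) B"
      unfolding link_def using extA LA LB AB setB by auto
    then show ?thesis by blast
  next
    case True
    have TB: "set B \<inter> T = {}" using setB True LB(6) q by auto
    \<comment> \<open>\<open>X\<close> is included because \<open>J\<close> may also be an entirely
      new path from \<open>X\<close>; \<open>q'\<close> is excluded because it is to be the end of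
      one of the two paths.\<close>
    let ?U = "(set A \<union> set B \<union> X) - {q'}"
    have U: "?U \<subseteq> V - {q'}" "T \<subseteq> V - {q'}" "q \<in> ?U" "?U \<inter> T = {}" "q' \<in> V"
      using V LA(3) LB(3) q setA TA TB dj by auto
    have pU: "p \<in> ?U" using AB(2) LA(2) LB(2) dj hd_in_set by fastforce
    have XU: "X \<subseteq> ?U" using dj by auto
    obtain J where J: "pth E J" "length J \<ge> 2" "set J \<subseteq> V - {q'}" "hd J \<in> ?U" "last J \<in> T"
      "set (tl J) \<inter> ?U = {}" "set (butlast J) \<inter> T = {}"
      using conn2_jump[OF conn U(5,1,2) _ T U(4)] U(3) by auto
    have J0: "J \<noteq> []" using J(2) by auto
    note setJ = set_hd_tl[OF J0]
    have qJ: "q' \<notin> set J" using J(3) by auto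
    have tlJU: "set (tl J) \<inter> (set A \<union> set B) = {}" using J(6) qJ setJ q'A by auto
    have tlJ: "set (tl J) \<inter> insert p X = {}" using J(6) pU XU by blast
    have bJ: "set (butlast J) \<inter> insert q' T = {}" using J(3,7) in_set_butlastD by fastforce
    consider "hd J \<in> set A" | "hd J \<in> set B" | "hd J \<in> X" "hd J \<notin> set A \<union> set B"
      using J(4) by blast
    then show ?thesis
    proof cases
      \<comment> \<open>The path to \<open>T\<close> is now the rerouted \<open>A\<close>, while
        \<open>B\<close> already ends in \<open>q'\<close>, so the two paths exchange their
        names.\<close>
      case 1
      have "set (tl J) \<inter> set A = {}" using tlJU by blast
      then obtain A' where A': "pth E A'" "A' \<noteq> []" "hd A' = hd A" "last A' = last J"
        "set A' \<subseteq> set (butlast A) \<union> set J" "set (tl A') \<subseteq> set (tl A) \<union> set (tl J)"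
        "set (butlast A') \<subseteq> set (butlast A) \<union> set (butlast J)"
        using pth_reroute[OF LA(1) 1 J(1) J0 refl] by blast
      have "set B \<inter> set J = {}"
        using 1 AB(1) tlJU by (auto simp: setJ)
      then have "set B \<inter> set A' = {}" using A'(5) AB(1) by (auto dest: in_set_butlastD)
      moreover have "set A' \<subseteq> V" using A'(5) LA(3) J(3) by (auto dest: in_set_butlastD)
      ultimately have "link V E X p q' T B A'"
        unfolding link_def using A' AB(2) LA(5,6) LB True J(5) tlJ bJ by auto
      then show ?thesis by blast
    next
      case 2
      have "set (tl J) \<inter> set B = {}" using tlJU by blast
      then obtain B' where B': "pth E B'" "B' \<noteq> []" "hd B' = hd B" "last B' = last J"
        "set B' \<subseteq> set (butlast B) \<union> set J" "set (tl B') \<subseteq> set (tl B) \<union> set (tl J)"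
        "set (butlast B') \<subseteq> set (butlast B) \<union> set (butlast J)"
        using pth_reroute[OF LB(1) 2 J(1) J0 refl] by blast
      have "set A \<inter> set J = {}"
        using 2 AB(1) tlJU by (auto simp: setJ)
      then have "set A \<inter> set B' = {}" using B'(5) AB(1) by (auto dest: in_set_butlastD)
      moreover have "q' \<notin> set B'" using B'(5) LB(6) qJ by blast
      moreover have "set B' \<subseteq> V" using B'(5) LB(3) J(3) by (auto dest: in_set_butlastD)
      ultimately have "link V E X p q' T (A @ [q']) B'"
        unfolding link_def using extA B' AB(2) LB(5,6) J(5) tlJ bJ by auto
      then show ?thesis by blast
    next
      case 3
      have "set J \<inter> (set A \<union> set B) = {}" using 3 tlJU by (auto simp: setJ)
      \<comment> \<open>If \<open>A\<close> starts in \<open>p\<close>, it is extended by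
        \<open>q'\<close> and \<open>J\<close> replaces \<open>B\<close>. Otherwise \<open>B\<close>
        leads from \<open>p\<close> to \<open>q'\<close>, and \<open>J\<close> replaces
        \<open>A\<close>.\<close>
      then have "link V E X p q' T (A @ [q']) J \<or> link V E X p q' T B J"
        using AB(2) 3(1) extA J(1,3,5) J0 tlJ bJ LB True qJ unfolding link_def by auto
      then show ?thesis by blast
    qed
  qed
qed

text \<open>Induction on the position of \<open>q\<close> on the path. It starts at
  \<open>q = p\<close>, where one path is the single vertex \<open>p\<close> and the other one jumps
  over \<open>p\<close>.\<close>

lemma link_along:
  assumes conn: "conn2 V E" and "pth E (xs @ p # ys)" "set (xs @ p # ys) \<subseteq> V" "xs \<noteq> []"
    and "p # ys = us @ q # ws" "ws \<noteq> []"
  shows "\<exists>A B. link V E (set xs) p q (set ws) A B"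
  using assms(5,6)
proof (induction us arbitrary: q ws rule: rev_induct)
  case Nil
  then have [simp]: "q = p" "ws = ys" by auto
  have d: "set xs \<inter> set ys = {}" "p \<notin> set xs" "p \<notin> set ys"
    using assms(2) by (auto simp: pth_append pth_Cons)
  obtain J where J: "pth E J" "length J \<ge> 2" "set J \<subseteq> V - {p}" "hd J \<in> set xs" "last J \<in> set ys"
    "set (tl J) \<inter> set xs = {}" "set (butlast J) \<inter> set ys = {}"
    using conn2_jump[OF conn, of p "set xs" "set ys"] assms(3,4) d Nil(2) by auto
  have "p \<notin> set J" using J(3) by auto
  then have "p \<notin> set (tl J)" "p \<notin> set (butlast J)"
    by (cases J; auto dest: in_set_butlastD split: if_splits)+
  then have "link V E (set xs) p p (set ys) [p] J"
    unfolding link_def using J assms(3) \<open>p \<notin> set J\<close> by auto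
  then show ?case by auto
next
  case (snoc a us)
  then have eq: "p # ys = us @ a # (q # ws)" by simp
  obtain A B where L: "link V E (set xs) p a (insert q (set ws)) A B"
    using snoc.IH[OF eq] by auto
  have P: "pth E (xs @ us @ a # q # ws)" "set (xs @ us @ a # q # ws) \<subseteq> V"
    using assms(2,3) eq by simp_all
  have "p \<in> set (us @ [a])" using eq by (cases us) auto
  then have "insert p (set xs) \<inter> insert q (set ws) = {}" "insert p (set xs) \<subseteq> V"
    using P by (auto simp: pth_append pth_Cons)
  moreover have "a \<notin> insert q (set ws)" "q \<notin> set ws" "{a, q} \<in> E"
    using P by (auto simp: pth_append pth_Cons)
  ultimately show ?case using link_step[OF conn L] P(2) snoc.prems(2) by auto
qed

text \<open>Some of the four pieces may be single vertices. The vertex \<open>z\<close> guarantees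
  that the path composed of \<open>Q1\<close>, \<open>S\<close> and \<open>Q2\<close> still has
  three vertices, as closing it to a cycle requires.\<close>

lemma cyc_four:
  assumes "pth E Q1" "pth E S" "pth E Q2" "pth E B" "Q1 \<noteq> []" "S \<noteq> []" "Q2 \<noteq> []" "B \<noteq> []"
    and "last Q1 = hd S" "last S = hd Q2" "hd B = hd Q1" "last B = last Q2"
    and "set Q1 \<inter> set S \<subseteq> {hd S}" "(set Q1 \<union> set S) \<inter> set Q2 \<subseteq> {hd Q2}"
    and "(set Q1 \<union> set S \<union> set Q2) \<inter> set B \<subseteq> {hd B, last B}" "hd B \<noteq> last B"
    and z: "z \<in> set Q1 \<union> set S \<union> set Q2" "z \<noteq> hd B" "z \<noteq> last B"
  shows "\<exists>D. cyc E D \<and> set Q1 \<union> set S \<union> set Q2 \<subseteq> set D"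
proof -
  note j = pth_join[OF assms(1,2,5,6,9,13)]
  let ?N = "Q1 @ tl S"
  have "?N \<noteq> []" using assms(5) by simp
  note k = pth_join[OF j(1) assms(3) this assms(7)]
  let ?M = "?N @ tl Q2"
  have M: "pth E ?M" "hd ?M = hd Q1" "last ?M = last Q2" "set ?M = set Q1 \<union> set S \<union> set Q2"
    using k j assms(10,14) by simp_all
  have "hd Q1 \<in> set Q1" "last Q2 \<in> set Q2" using assms(5,7) by auto
  then have "{hd B, last B, z} \<subseteq> set ?M" using M(4) assms(11,12) z(1) by auto
  moreover have "card {hd B, last B, z} = 3" using assms(16) z by auto
  ultimately have "3 \<le> card (set ?M)" by (metis List.finite_set card_mono)
  then have "3 \<le> length ?M" by (metis card_length le_trans)
  moreover have "2 \<le> length B" using assms(8,16) by (cases B) (auto simp: Suc_le_eq)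
  ultimately obtain D where "cyc E D" "set ?M \<subseteq> set D"
    using cyc_close[OF M(1) _ assms(4)] M assms(11,12,15) by metis
  then show ?thesis unfolding M(4)[symmetric] by blast
qed

text \<open>Two disjoint paths join the initial part of \<open>F\<close> up to
  \<open>\<alpha>\<close> to the final part from \<open>\<beta>\<close> on. One end on each side is
  \<open>F ! \<alpha>\<close> or \<open>F ! \<beta>\<close>, the other is arbitrary. The chords
  provide detours inside both parts which connect these ends and collect all the neighbours of
  \<open>hd F\<close> and \<open>last F\<close> there.\<close>

lemma noncrossing_cycle:
  assumes conn: "conn2 V E" and F: "pth E F" "set F \<subseteq> V"
    and ab: "0 < \<alpha>" "\<alpha> \<le> \<beta>" "Suc \<beta> < length F"
    and ch: "{hd F, F ! \<alpha>} \<in> E" "{last F, F ! \<beta>} \<in> E"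
  shows "\<exists>D. cyc E D \<and> hd F \<in> set D \<and> last F \<in> set D \<and>
    nbrs E (hd F) \<inter> set (take (Suc \<alpha>) F) \<subseteq> set D \<and> nbrs E (last F) \<inter> set (drop \<beta> F) \<subseteq> set D"
proof -
  define xs p ys q ws where "xs = take \<alpha> F" and "p = F ! \<alpha>" and "ys = drop (Suc \<alpha>) F"
    and "q = F ! \<beta>" and "ws = drop (Suc \<beta>) F"
  have Fp: "F = xs @ p # ys" unfolding xs_def p_def ys_def using ab by (simp add: id_take_nth_drop)
  have tk: "take (Suc \<alpha>) F = xs @ [p]" unfolding xs_def p_def using ab by (simp add: take_Suc_conv_app_nth)
  have dr: "drop \<beta> F = q # ws" unfolding q_def ws_def using ab by (simp add: Cons_nth_drop_Suc)
  have "p # ys = drop \<alpha> F" unfolding p_def ys_def using ab by (simp add: Cons_nth_drop_Suc)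
  also have "\<dots> = take (\<beta> - \<alpha>) (drop \<alpha> F) @ drop \<beta> F"
    using ab by (metis append_take_drop_id drop_drop le_add_diff_inverse2)
  finally have eq: "p # ys = take (\<beta> - \<alpha>) (drop \<alpha> F) @ q # ws" by (simp add: dr)
  have xs0: "xs \<noteq> []" and ws0: "ws \<noteq> []" unfolding xs_def ws_def using ab by auto
  obtain A B where L: "link V E (set xs) p q (set ws) A B"
    using link_along[OF conn _ _ xs0 eq ws0] F Fp by auto
  have dF: "distinct F" using F(1) by (rule pth_distinct)
  have pq: "p \<notin> set xs" "p \<notin> set ws" "q \<notin> set ws" "q \<notin> set xs" "set xs \<inter> set ws = {}"
  proof -
    have "F = xs @ (take (\<beta> - \<alpha>) (drop \<alpha> F) @ q # ws)" using Fp eq by simp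
    then have d: "distinct (xs @ (take (\<beta> - \<alpha>) (drop \<alpha> F) @ q # ws))" using dF by simp
    then show "q \<notin> set ws" "q \<notin> set xs" "set xs \<inter> set ws = {}" by auto
    show "p \<notin> set xs" using dF Fp by simp
    have "p \<in> set (take (\<beta> - \<alpha>) (drop \<alpha> F) @ [q])" using eq
      by (cases "take (\<beta> - \<alpha>) (drop \<alpha> F)") auto
    then show "p \<notin> set ws" using d by auto
  qed
  define x y where "x = hd F" and "y = last F"
  have P1: "pth E (xs @ [p])" "hd (xs @ [p]) = x" "last (xs @ [p]) = p" "butlast (xs @ [p]) = xs"
    using F(1) xs0 unfolding Fp x_def by (auto simp: pth_append)
  have "F = take \<beta> F @ q # ws" using dr by (metis append_take_drop_id)
  then have P2: "pth E (rev (q # ws))" "hd (rev (q # ws)) = y" "last (rev (q # ws)) = q"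
    "butlast (rev (q # ws)) = rev ws"
    using F(1) ws0 unfolding y_def by (metis pth_append pth_rev, metis hd_rev last_appendR list.distinct(1), auto)
  have LA: "pth E A" "A \<noteq> []" "last A = q" "set (tl A) \<inter> insert p (set xs) = {}"
    "set (butlast A) \<inter> insert q (set ws) = {}" using L unfolding link_def by auto
  have LB: "pth E B" "B \<noteq> []" "last B \<in> set ws" "set (tl B) \<inter> insert p (set xs) = {}"
    "set (butlast B) \<inter> insert q (set ws) = {}" using L unfolding link_def by auto
  have AB: "set A \<inter> set B = {}" "hd A = p \<and> hd B \<in> set xs \<or> hd A \<in> set xs \<and> hd B = p"
    using L unfolding link_def by auto
  have A1: "set A \<inter> insert p (set xs) \<subseteq> {hd A}" using LA(4) set_hd_tl[OF LA(2)] by auto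
  have A2: "set A \<inter> insert q (set ws) \<subseteq> {q}" using LA(3,5) set_last_butlast[OF LA(2)] by auto
  have B1: "set B \<inter> insert p (set xs) \<subseteq> {hd B}" using LB(4) set_hd_tl[OF LB(2)] by auto
  have B2: "set B \<inter> insert q (set ws) \<subseteq> {last B}" using LB(3,5) set_last_butlast[OF LB(2)] by auto
  have "\<exists>w. w \<in> set xs \<and> (hd A = p \<and> hd B = w \<or> hd A = w \<and> hd B = p)" using AB(2) by blast
  then obtain w where w: "w \<in> set xs" "hd A = p \<and> hd B = w \<or> hd A = w \<and> hd B = p" by blast
  obtain Q1 where Q1: "pth E Q1" "Q1 \<noteq> []" "hd Q1 = w" "last Q1 = p" "set Q1 \<subseteq> insert p (set xs)"
    "x \<in> set Q1" "nbrs E x \<inter> set (xs @ [p]) \<subseteq> set Q1"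
    using end_detour[OF P1(1), of w] w(1) ch(1) P1 unfolding x_def p_def by auto
  obtain Q2 where Q2: "pth E Q2" "Q2 \<noteq> []" "hd Q2 = last B" "last Q2 = q" "set Q2 \<subseteq> insert q (set ws)"
    "y \<in> set Q2" "nbrs E y \<inter> set (q # ws) \<subseteq> set Q2"
    using end_detour[OF P2(1), of "last B"] LB(3) ch(2) P2 unfolding y_def q_def by auto
  have Q12: "set Q1 \<inter> set Q2 \<subseteq> {p} \<inter> {q}" using Q1(5) Q2(5) pq by auto
  have pQ: "p \<in> set Q1" "w \<in> set Q1" using Q1 by (metis last_in_set, metis hd_in_set)
  have "\<exists>D. cyc E D \<and> set Q1 \<union> set Q2 \<subseteq> set D"
  proof (cases "hd A = p \<and> hd B = w")
    case True
    \<comment> \<open>In this case \<open>p = q\<close> is possible, and \<open>A\<close> may then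
      be a single vertex.\<close>
    have "\<exists>D. cyc E D \<and> set Q1 \<union> set A \<union> set (rev Q2) \<subseteq> set D"
    proof (rule cyc_four[where B = B and z = p])
      show "set Q1 \<inter> set A \<subseteq> {hd A}" using A1 Q1(5) by auto
      show "(set Q1 \<union> set A) \<inter> set (rev Q2) \<subseteq> {hd (rev Q2)}"
        using A2 Q12 Q2(4,5) by (auto simp: hd_rev)
      show "(set Q1 \<union> set A \<union> set (rev Q2)) \<inter> set B \<subseteq> {hd B, last B}"
        using AB(1) B1 B2 Q1(5) Q2(5) by auto
    qed (use True LA LB Q1 Q2 pQ pq w(1) in \<open>auto simp: hd_rev last_rev\<close>)
    then show ?thesis by auto
  next
    case False
    then have c: "hd A = w" "hd B = p" using w(2) by auto
    have "\<exists>D. cyc E D \<and> set Q1 \<union> set B \<union> set Q2 \<subseteq> set D"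
    proof (rule cyc_four[where B = A and z = "last B"])
      show "set Q1 \<inter> set B \<subseteq> {hd B}" using B1 Q1(5) by auto
      show "(set Q1 \<union> set B) \<inter> set Q2 \<subseteq> {hd Q2}"
      proof -
        \<comment> \<open>\<open>q\<close> lies on \<open>A\<close> and \<open>p\<close> on
          \<open>B\<close>, which are disjoint; hence the two detours do not meet here.\<close>
        have "p \<noteq> q" using AB(1) c LA(2,3) LB(2) by (metis disjoint_iff hd_in_set last_in_set)
        then show ?thesis using B2 Q12 Q2(3,5) by auto
      qed
      show "(set Q1 \<union> set B \<union> set Q2) \<inter> set A \<subseteq> {hd A, last A}"
        using AB(1) A1 A2 Q1(5) Q2(5) LA(3) by auto
      show "hd A \<noteq> last A" using c LA(3) w(1) pq by auto
      show "last B \<noteq> hd A" using c LB(3) w(1) pq by auto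
      show "last B \<noteq> last A" using LA(3) LB(3) pq by auto
    qed (use c LA LB Q1 Q2 in auto)
    then show ?thesis by auto
  qed
  then obtain D where "cyc E D" "set Q1 \<union> set Q2 \<subseteq> set D" by blast
  then show ?thesis using Q1(6,7) Q2(6,7) unfolding x_def[symmetric] y_def[symmetric] tk dr by blast
qed

section \<open>Kopylov's bound on the length of a cycle\<close>

lemma length_cyc: "cyc E D \<Longrightarrow> length D = card (set D)"
  by (simp add: cyc_def pth_def distinct_card)

lemma card_nbrs_indices:
  assumes "distinct P"
  shows "card (nbrs E x \<inter> set P) = card {i. i < length P \<and> {x, P ! i} \<in> E}"
proof -
  have "(!) P ` {i. i < length P \<and> {x, P ! i} \<in> E} = nbrs E x \<inter> set P"
    by (auto simp: nbrs_def in_set_conv_nth)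
  moreover have "inj_on ((!) P) {i. i < length P \<and> {x, P ! i} \<in> E}"
    using assms by (auto simp: inj_on_def nth_eq_iff_index_eq)
  from card_image[OF this] have "card ((!) P ` {i. i < length P \<and> {x, P ! i} \<in> E}) =
    card {i. i < length P \<and> {x, P ! i} \<in> E}" .
  ultimately show ?thesis by simp
qed

text \<open>Neighbours of the ends are recorded by their positions on \<open>P\<close>. If no
  neighbour of \<open>last P\<close> comes before a neighbour of \<open>hd P\<close>,
  \<open>noncrossing_cycle\<close> gives a cycle through both ends and all these neighbours, of
  which at most one is counted twice. Otherwise there are crossing chords, from
  \<open>last P\<close> to position \<open>i\<close> and from \<open>hd P\<close> to a later
  position \<open>j\<close>. They give a cycle that omits just the vertices strictly between, and a
  pair with smallest gap is taken.\<close>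

lemma kopylov_cycle:
  assumes conn: "conn2 V E" and loop: "\<And>v. {v} \<notin> E" and P: "pth E P" "set P \<subseteq> V" "3 \<le> length P"
    and d: "2 \<le> card (nbrs E (hd P) \<inter> set P)" "2 \<le> card (nbrs E (last P) \<inter> set P)"
  shows "\<exists>D. cyc E D \<and>
    min (length P) (card (nbrs E (hd P) \<inter> set P) + card (nbrs E (last P) \<inter> set P)) \<le> length D"
proof -
  define m where "m = length P"
  define Ix Iy where "Ix = {i. i < m \<and> {hd P, P ! i} \<in> E}" and "Iy = {i. i < m \<and> {last P, P ! i} \<in> E}"
  have dP: "distinct P" and P0: "P \<noteq> []" using P by (auto simp: pth_def)
  have c: "card (nbrs E (hd P) \<inter> set P) = card Ix" "card (nbrs E (last P) \<inter> set P) = card Iy"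
    unfolding Ix_def Iy_def m_def using card_nbrs_indices[OF dP] by auto
  have fin: "finite Ix" "finite Iy" unfolding Ix_def Iy_def by auto
  have ne: "Ix \<noteq> {}" "Iy \<noteq> {}" using d c by auto
  have hl: "hd P = P ! 0" "last P = P ! (m - 1)" using P0 by (auto simp: hd_conv_nth last_conv_nth m_def)
  have x0: "0 \<notin> Ix" and ym: "m - 1 \<notin> Iy" using loop unfolding Ix_def Iy_def by (auto simp: hl)
  show ?thesis
  proof (cases "\<exists>i\<in>Iy. \<exists>j\<in>Ix. i < j")
    case False
    define \<alpha> \<beta> where "\<alpha> = Max Ix" and "\<beta> = Min Iy"
    have a: "\<alpha> \<in> Ix" "\<beta> \<in> Iy" unfolding \<alpha>_def \<beta>_def using fin ne by auto
    have "\<alpha> \<le> \<beta>" using a False not_less by blast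
    moreover have "0 < \<alpha>" using a(1) x0 by (metis not_gr_zero)
    moreover have "\<beta> \<noteq> m - 1" "\<beta> < m" using a(2) ym by (metis, simp add: Iy_def)
    ultimately have ab: "0 < \<alpha>" "\<alpha> \<le> \<beta>" "Suc \<beta> < length P" by (auto simp: m_def)
    let ?I = "insert 0 (insert (m - 1) (Ix \<union> Iy))"
    obtain D where D: "cyc E D" "hd P \<in> set D" "last P \<in> set D"
      "nbrs E (hd P) \<inter> set (take (Suc \<alpha>) P) \<subseteq> set D" "nbrs E (last P) \<inter> set (drop \<beta> P) \<subseteq> set D"
      using noncrossing_cycle[OF conn P(1,2) ab] a unfolding Ix_def Iy_def by blast
    have "P ! i \<in> set D" if "i \<in> Ix" for i
    proof -
      have "i \<le> \<alpha>" unfolding \<alpha>_def using that fin by auto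
      then have "P ! i \<in> set (take (Suc \<alpha>) P)" using ab that
        by (auto simp: in_set_conv_nth Ix_def m_def intro!: exI[of _ i])
      then show ?thesis using D(4) that unfolding Ix_def by (auto simp: nbrs_def)
    qed
    moreover have "P ! i \<in> set D" if "i \<in> Iy" for i
    proof -
      have b: "\<beta> \<le> i" unfolding \<beta>_def using that fin by auto
      have "i - \<beta> < length (drop \<beta> P)" "drop \<beta> P ! (i - \<beta>) = P ! i"
        using b that ab unfolding Iy_def m_def by auto
      then have "P ! i \<in> set (drop \<beta> P)" by (metis nth_mem)
      then show ?thesis using D(5) that unfolding Iy_def by (auto simp: nbrs_def)
    qed
    ultimately have sub: "(!) P ` ?I \<subseteq> set D"
      using D(2,3) hl by auto
    have "inj_on ((!) P) {..<m}" using dP by (auto simp: inj_on_def m_def nth_eq_iff_index_eq)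
    moreover have "?I \<subseteq> {..<m}"
      using P(3) by (auto simp: Ix_def Iy_def m_def)
    ultimately have "card ?I = card ((!) P ` ?I)"
      by (metis card_image inj_on_subset)
    also have "\<dots> \<le> card (set D)" using sub by (intro card_mono) auto
    finally have le: "card ?I \<le> length D" using D(1) by (simp add: length_cyc)
    have "0 \<notin> Iy" using False a(1) ab(1) by auto
    moreover have "\<beta> < m - 1" using ab(3) by (auto simp: m_def)
    then have "m - 1 \<notin> Ix" using False a(2) by blast
    ultimately have "card ?I = Suc (Suc (card (Ix \<union> Iy)))"
      using x0 ym fin P(3) by (auto simp: m_def)
    moreover have "card Ix + card Iy = card (Ix \<union> Iy) + card (Ix \<inter> Iy)" using fin by (rule card_Un_Int)
    moreover have "Ix \<inter> Iy \<subseteq> {\<alpha>}"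
    proof
      fix i assume i: "i \<in> Ix \<inter> Iy"
      then have "i \<le> \<alpha>" unfolding \<alpha>_def using fin by auto
      moreover have "\<not> i < \<alpha>" using i a(1) False by auto
      ultimately show "i \<in> {\<alpha>}" by auto
    qed
    then have "card (Ix \<inter> Iy) \<le> 1" using card_mono[of "{\<alpha>}" "Ix \<inter> Iy"] by auto
    ultimately have "card Ix + card Iy \<le> length D" using le by linarith
    then show ?thesis using D(1) c by auto
  next
    case True
    define K where "K = {d. \<exists>i\<in>Iy. \<exists>j\<in>Ix. i < j \<and> d = j - i}"
    have "K \<noteq> {}" using True unfolding K_def by blast
    then have "(LEAST d. d \<in> K) \<in> K" by (meson LeastI ex_in_conv)
    then obtain i j where ij: "i \<in> Iy" "j \<in> Ix" "i < j" "(LEAST d. d \<in> K) = j - i" unfolding K_def by blast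
    have min: "j - i \<le> j' - i'" if "i' \<in> Iy" "j' \<in> Ix" "i' < j'" for i' j'
      using that ij(4) Least_le[of "\<lambda>d. d \<in> K" "j' - i'"] unfolding K_def by auto
    have im: "i < m" "j < m" using ij by (auto simp: Ix_def Iy_def)
    let ?D = "take (Suc i) P @ rev (drop j P)"
    have lD: "length ?D = Suc i + (m - j)" using im by (simp add: m_def)
    have tk: "last (take (Suc i) P) = P ! i" "take (Suc i) P \<noteq> []"
      using im P0 by (simp_all add: m_def take_Suc_conv_app_nth)
    have pthD: "pth E ?D"
    proof -
      have "pth E (take (Suc i) P)" by (metis P(1) append_take_drop_id pth_append)
      moreover have "pth E (drop j P)" by (metis P(1) append_take_drop_id pth_append)
      moreover have "set (take (Suc i) P) \<inter> set (drop j P) = {}"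
        using dP ij(3) by (simp add: set_take_disj_set_drop_if_distinct)
      moreover have "{P ! i, last P} \<in> E" using ij(1) by (simp add: Iy_def insert_commute)
      ultimately show ?thesis using tk im by (simp add: pth_append hd_rev m_def)
    qed
    have lc: "{last ?D, hd ?D} \<in> E"
    proof -
      have "last ?D = P ! j" using im by (simp add: last_rev m_def hd_drop_conv_nth)
      moreover have "hd ?D = hd P" using P0 by (cases P) auto
      ultimately show ?thesis using ij(2) by (simp add: Ix_def insert_commute)
    qed
    have "min m (card Ix + card Iy) \<le> length ?D"
    proof (cases "j = Suc i")
      case True then show ?thesis using lD im by simp
    next
      case False
      \<comment> \<open>Positions just before a neighbour of \<open>hd P\<close>. A common element
        with \<open>Iy\<close> would be a gap of length 1, and minimality leaves no element of
        \<open>Ix\<close> or \<open>Iy\<close> strictly inside the gap. Thus of these predecessors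
        only \<open>j - 1\<close> is off the cycle, and the end position \<open>m - 1\<close> makes
        up for it.\<close>
      define I where "I = (\<lambda>l. l - 1) ` Ix"
      have inj: "inj_on (\<lambda>l. l - 1) Ix" using x0 by (auto simp: inj_on_def) (metis Suc_pred not_gr_zero)
      have cI: "card I = card Ix" unfolding I_def using inj by (rule card_image)
      have "I \<inter> Iy = {}"
      proof (rule ccontr)
        assume "I \<inter> Iy \<noteq> {}"
        then obtain l where "l \<in> Ix" "l - 1 \<in> Iy" unfolding I_def by auto
        moreover have "0 < l" using \<open>l \<in> Ix\<close> x0 by (cases l) auto
        ultimately have "j - i \<le> l - (l - 1)" using min[of "l - 1" l] by auto
        then show False using False ij(3) \<open>0 < l\<close> by auto
      qed
      moreover have "m - 1 \<notin> I"
      proof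
        assume "m - 1 \<in> I"
        then obtain l where "l \<in> Ix" "m - 1 = l - 1" unfolding I_def by auto
        moreover have "0 < l" "l < m" using \<open>l \<in> Ix\<close> x0 by (auto simp: Ix_def intro!: Nat.gr0I)
        ultimately show False by auto
      qed
      moreover have finI: "finite I" unfolding I_def using fin by simp
      moreover have "card ((I - {j - 1}) \<union> Iy) = card (I - {j - 1}) + card Iy"
        using finI fin(2) \<open>I \<inter> Iy = {}\<close> by (intro card_Un_disjoint) auto
      ultimately have "card (insert (m - 1) ((I - {j - 1}) \<union> Iy)) = Suc (card (I - {j - 1}) + card Iy)"
        using ym fin by (subst card_insert_disjoint) auto
      moreover have "card (I - {j - 1}) \<ge> card I - 1" using finI by (simp add: card_Diff_singleton_if)
      moreover have "insert (m - 1) ((I - {j - 1}) \<union> Iy) \<subseteq> {..i} \<union> {j..<m}"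
      proof -
        have "l \<le> i \<or> j \<le> l" if "l \<in> Ix" for l
        proof (rule ccontr)
          assume "\<not> ?thesis" then show False using min[OF ij(1) that] ij(3) by auto
        qed
        moreover have "l \<le> i \<or> j \<le> l" if "l \<in> Iy" for l
        proof (rule ccontr)
          assume "\<not> ?thesis" then show False using min[OF that ij(2)] ij(3) by auto
        qed
        moreover have "Iy \<subseteq> {..<m}" "Ix \<subseteq> {..<m}" by (auto simp: Ix_def Iy_def)
        ultimately show ?thesis using im unfolding I_def by fastforce
      qed
      then have "card (insert (m - 1) ((I - {j - 1}) \<union> Iy)) \<le> card ({..i} \<union> {j..<m})"
        by (intro card_mono) auto
      moreover have "card ({..i} \<union> {j..<m}) = Suc i + (m - j)"
        using ij(3) by (subst card_Un_disjoint) auto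
      ultimately show ?thesis using lD cI by linarith
    qed
    moreover from this have "3 \<le> length ?D" using P(3) d c by (simp add: m_def)
    ultimately show ?thesis using pthD lc c unfolding cyc_def m_def by (intro exI[of _ ?D]) metis
  qed
qed

section \<open>Edge-maximal graphs\<close>

lemma all_pairs_iff: "{u, v} \<in> all_pairs S \<longleftrightarrow> u \<in> S \<and> v \<in> S \<and> u \<noteq> v"
  by (auto simp: all_pairs_def card_insert_if)

lemma finite_all_pairs: "finite S \<Longrightarrow> finite (all_pairs S)"
  unfolding all_pairs_def by (rule finite_subset[of _ "Pow S"]) auto

lemma card_all_pairs: "finite S \<Longrightarrow> card (all_pairs S) = card S choose 2"
  unfolding all_pairs_def by (rule n_subsets)

lemma pth_avoid_edge:
  assumes "pth (insert {u, v} E) xs" "u \<notin> set xs \<or> v \<notin> set xs"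
  shows "pth E xs"
proof -
  have "{x, y} \<in> E" if "x \<in> set xs" "y \<in> set xs" "{x, y} \<in> insert {u, v} E" for x y
    using that assms(2) by (auto simp: doubleton_eq_iff)
  then show ?thesis using assms(1)
      successively_mono[of "\<lambda>a b. {a, b} \<in> insert {u, v} E" xs "\<lambda>a b. {a, b} \<in> E"]
    unfolding pth_def by blast
qed

text \<open>On a path with at least three vertices the two ends are not consecutive, so the path
  does not use the edge between them.\<close>

lemma pth_remove_end_edge:
  assumes "pth (insert {u, v} E) xs" "3 \<le> length xs" "hd xs = u" "last xs = v"
  shows "pth E xs"
proof -
  obtain a ys where 1: "xs = a # ys" using assms(2) by (cases xs) auto
  obtain b zs where 2: "ys = b # zs" using 1 assms(2) by (cases ys) auto
  have "zs \<noteq> []" using assms(2) 1 2 by auto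
  then have "last zs = v" "last zs \<in> set zs" using assms(4) 1 2 by auto
  then have "v \<in> set zs" by simp
  have a: "a = u" using assms(3) 1 by simp
  have "u \<notin> set ys" "v \<noteq> b" using assms(1) 1 2 a \<open>v \<in> set zs\<close> by (auto simp: pth_Cons)
  then have "pth E ys" using assms(1) 1 pth_avoid_edge by (metis pth_Cons)
  moreover have "{u, b} \<in> E" using assms(1) a \<open>v \<noteq> b\<close> unfolding 1 2 by (auto simp: pth_Cons doubleton_eq_iff)
  ultimately show ?thesis using assms(1) a unfolding 1 2 by (auto simp: pth_Cons)
qed

text \<open>The cycle has to use the new edge and is cut open there. In the list the edge either
  joins the last entry to the first one, or joins consecutive entries; in the second case the list
  is rotated to start behind the edge.\<close>

lemma cyc_new_edge:
  assumes "cyc (insert {u, v} E) ys" "\<not> cyc E ys"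
  shows "\<exists>xs. pth E xs \<and> length xs = length ys \<and> hd xs = u \<and> last xs = v"
proof -
  have ex: ?thesis if "pth (insert {u, v} E) zs" "length zs = length ys" "{hd zs, last zs} = {u, v}" for zs
  proof (cases "hd zs = u")
    case True
    have z: "zs \<noteq> []" "3 \<le> length zs" using assms(1) that(2) by (auto simp: cyc_def)
    have "last zs = v" using that(3) True by (auto simp: doubleton_eq_iff)
    then show ?thesis using pth_remove_end_edge[OF that(1)] True that(2) z by blast
  next
    case False
    have z: "zs \<noteq> []" "3 \<le> length (rev zs)" using assms(1) that(2) by (auto simp: cyc_def)
    have "hd (rev zs) = u" "last (rev zs) = v" using that(3) False z by (auto simp: doubleton_eq_iff hd_rev last_rev)
    then show ?thesis using pth_remove_end_edge[of u v E "rev zs"] that(1,2) z by (metis length_rev pth_rev)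
  qed
  show ?thesis
  proof (cases "{last ys, hd ys} \<in> E")
    case False
    then have "{hd ys, last ys} = {u, v}" using assms(1) by (auto simp: cyc_def insert_commute)
    then show ?thesis using ex assms(1) by (auto simp: cyc_def)
  next
    case True
    have "\<not> successively (\<lambda>a b. {a, b} \<in> E) ys" using assms True by (auto simp: cyc_def pth_def)
    then obtain i where i: "Suc i < length ys" "{ys ! i, ys ! Suc i} \<notin> E" by (auto simp: successively_conv_nth)
    have "{ys ! i, ys ! Suc i} \<in> insert {u, v} E" using assms(1) i(1)
      unfolding cyc_def pth_def by (auto dest: successively_nth)
    then have uv: "{ys ! Suc i, ys ! i} = {u, v}" using i(2) by (auto simp: insert_commute)
    let ?zs = "drop (Suc i) ys @ take (Suc i) ys"
    have ne: "drop (Suc i) ys \<noteq> []" "take (Suc i) ys \<noteq> []" using i by (auto simp: take_eq_Nil)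
    have "pth (insert {u, v} E) (take (Suc i) ys @ drop (Suc i) ys)"
      using assms(1) by (simp add: cyc_def)
    then have "pth (insert {u, v} E) (take (Suc i) ys)" "pth (insert {u, v} E) (drop (Suc i) ys)"
      "set (take (Suc i) ys) \<inter> set (drop (Suc i) ys) = {}" unfolding pth_append by auto
    moreover have "{last (drop (Suc i) ys), hd (take (Suc i) ys)} \<in> insert {u, v} E"
      using True i by (simp add: hd_take)
    ultimately have "pth (insert {u, v} E) ?zs" unfolding pth_append by auto
    moreover have "hd ?zs = ys ! Suc i" using ne i by (simp add: hd_drop_conv_nth)
    moreover have "last ?zs = ys ! i" using ne i by (simp add: take_Suc_conv_app_nth)
    ultimately show ?thesis using ex[of ?zs] uv i by simp
  qed
qed

lemma pth_subset:
  assumes "E \<subseteq> all_pairs V" "pth E xs" "hd xs \<in> V"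
  shows "set xs \<subseteq> V"
  using assms(2,3)
proof (induction xs)
  case (Cons x xs)
  show ?case
  proof (cases xs)
    case (Cons y ys)
    then have "{x, y} \<in> E" using Cons.prems by (simp add: pth_Cons)
    then have "{x, y} \<in> all_pairs V" using assms(1) by (rule rev_subsetD)
    then have "y \<in> V" by (simp add: all_pairs_iff)
    then show ?thesis using Cons.IH Cons.prems Cons by (simp add: pth_Cons)
  qed (use Cons.prems in simp)
qed simp

locale circ =
  fixes V :: "'a set" and E :: "'a set set" and c :: nat
  assumes finV: "finite V" and EV: "E \<subseteq> all_pairs V" and conn: "conn2 V E" and c3: "3 \<le> c"
    and no_long: "cyc E D \<Longrightarrow> length D \<le> c"
begin

lemma loopfree: "{v} \<notin> E"
  using EV all_pairs_iff[of v v] by auto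

lemma adj_V: "{u, v} \<in> E \<Longrightarrow> u \<in> V \<and> v \<in> V \<and> u \<noteq> v"
  using subsetD[OF EV] all_pairs_iff[of u v V] by simp

lemma nbrs_V: "nbrs E v \<subseteq> V - {v}"
  by (auto simp: nbrs_def dest: adj_V)

lemma fin_nbrs: "finite (nbrs E v)"
  using nbrs_V finV by (meson finite_Diff finite_subset)

lemma longest_list:
  assumes "Q xs0" "\<And>xs. Q xs \<Longrightarrow> distinct xs \<and> set xs \<subseteq> V"
  shows "\<exists>xs. Q xs \<and> (\<forall>ys. Q ys \<longrightarrow> length ys \<le> length xs)"
proof -
  have "length xs \<le> card V" if "Q xs" for xs
    using assms(2)[OF that] finV by (metis card_mono distinct_card)
  then show ?thesis using Lattices_Big.ex_has_greatest_nat[of Q xs0 length "Suc (card V)"] assms(1)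
    by (simp add: less_Suc_eq_le)
qed

text \<open>If there is at most one neighbour, some vertex \<open>z\<close> other than
  \<open>v\<close> contains it in \<open>{z}\<close>, and deleting \<open>z\<close> cuts
  \<open>v\<close> off from the remaining vertices.\<close>

lemma two_nbrs:
  assumes "v \<in> V" shows "2 \<le> card (nbrs E v)"
proof (rule ccontr)
  assume "\<not> ?thesis"
  then have c1: "card (nbrs E v) \<le> 1" by simp
  have V3: "3 \<le> card V" using conn by (simp add: conn2_def)
  then have "card (V - {v}) \<ge> 2" using assms finV by simp
  have "\<exists>z\<in>V - {v}. nbrs E v \<subseteq> {z}"
  proof (cases "nbrs E v = {}")
    case True
    have "V - {v} \<noteq> {}" using \<open>card (V - {v}) \<ge> 2\<close> by (metis card.empty not_numeral_le_zero)
    then show ?thesis using True by blast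
  next
    case False
    then have "card (nbrs E v) = 1" using c1 fin_nbrs by (metis card_0_eq le_antisym less_one not_le)
    then show ?thesis using nbrs_V[of v] by (metis card_1_singletonE insert_subset subset_refl)
  qed
  then obtain z where z: "z \<in> V - {v}" "nbrs E v \<subseteq> {z}" by blast
  have "{v} \<noteq> V - {z}"
  proof
    assume "{v} = V - {z}"
    then have "V = {v, z}" using z assms by blast
    then have "card V \<le> 2" by (simp add: card_insert_if)
    then show False using V3 by simp
  qed
  then have "\<exists>u\<in>{v}. \<exists>w\<in>V - {z} - {v}. {u, w} \<in> E"
    using conn z assms unfolding conn2_def by blast
  then show False using z by (auto simp: nbrs_def)
qed

end

text \<open>Maximality enters through its consequence: a missing edge would create a cycle longer
  than \<open>c\<close>, and this cycle without the edge is the path.\<close>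

locale max_circ = circ +
  assumes maximal: "\<lbrakk>u \<in> V; v \<in> V; u \<noteq> v; {u, v} \<notin> E\<rbrakk> \<Longrightarrow>
    \<exists>xs. pth E xs \<and> c < length xs \<and> hd xs = u \<and> last xs = v"
begin

text \<open>Consider the paths on more than \<open>c\<close> vertices with nonadjacent ends, one in
  \<open>A1\<close> and one in \<open>A2\<close>. A longest one contains all neighbours in
  \<open>S1\<close> of its first vertex and all neighbours in \<open>S2\<close> of its last vertex:
  a further neighbour would either close a cycle longer than \<open>c\<close> or be an admissible
  end of a longer path. So \<open>kopylov_cycle\<close> gives a cycle longer than \<open>c\<close>.
  The sets for the ends and for counting are kept apart because \<open>core_stable\<close> takes
  ends outside a clique but counts their neighbours in the clique as well.\<close>

lemma dense_adjacent:
  assumes A: "A1 \<subseteq> V" "A2 \<subseteq> V"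
    and S1: "\<And>w v. \<lbrakk>w \<in> S1; v \<in> A2; w \<noteq> v\<rbrakk> \<Longrightarrow> w \<in> A1 \<or> {w, v} \<in> E"
    and S2: "\<And>w u. \<lbrakk>w \<in> S2; u \<in> A1; w \<noteq> u\<rbrakk> \<Longrightarrow> w \<in> A2 \<or> {w, u} \<in> E"
    and d1: "\<And>u. u \<in> A1 \<Longrightarrow> d1 \<le> card (nbrs E u \<inter> S1)"
    and d2: "\<And>v. v \<in> A2 \<Longrightarrow> d2 \<le> card (nbrs E v \<inter> S2)"
    and d: "c < d1 + d2" "2 \<le> d1" "2 \<le> d2"
    and uv: "u \<in> A1" "v \<in> A2" "u \<noteq> v"
  shows "{u, v} \<in> E"
proof (rule ccontr)
  assume nE: "{u, v} \<notin> E"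
  define Q where "Q xs \<longleftrightarrow> pth E xs \<and> c < length xs \<and> hd xs \<in> A1 \<and> last xs \<in> A2 \<and> hd xs \<noteq> last xs \<and>
    {hd xs, last xs} \<notin> E" for xs
  have "\<exists>xs. Q xs" using maximal[of u v] nE uv A unfolding Q_def by blast
  moreover have "distinct xs \<and> set xs \<subseteq> V" if "Q xs" for xs
    using that pth_subset[OF EV] A unfolding Q_def by (auto simp: pth_def)
  ultimately obtain P where P: "Q P" and max: "\<And>xs. Q xs \<Longrightarrow> length xs \<le> length P"
    using longest_list[of Q] by blast
  have PP: "pth E P" "c < length P" "hd P \<in> A1" "last P \<in> A2" "hd P \<noteq> last P" "{hd P, last P} \<notin> E"
    using P unfolding Q_def by auto
  have P0: "P \<noteq> []" using PP(2) by auto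
  have PV: "set P \<subseteq> V" using pth_subset[OF EV PP(1)] PP(3) A by auto
  have sub1: "nbrs E (hd P) \<inter> S1 \<subseteq> set P"
  proof (rule ccontr)
    assume "\<not> ?thesis"
    then obtain w where w: "{hd P, w} \<in> E" "w \<in> S1" "w \<notin> set P" by (auto simp: nbrs_def)
    have pw: "pth E (w # P)" using PP(1) w by (auto simp: pth_Cons insert_commute)
    have "w \<noteq> last P" using w(3) P0 by auto
    then consider "{w, last P} \<in> E" | "w \<in> A1" "{w, last P} \<notin> E" using S1 w(2) PP(4) by blast
    then show False
    proof cases
      case 1
      then have "cyc E (w # P)" using pw PP(2) c3 P0 by (auto simp: cyc_def insert_commute)
      then show False using no_long PP(2) by fastforce
    next
      case 2
      then have "Q (w # P)" unfolding Q_def using pw PP P0 \<open>w \<noteq> last P\<close> by auto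
      then show False using max by fastforce
    qed
  qed
  have sub2: "nbrs E (last P) \<inter> S2 \<subseteq> set P"
  proof (rule ccontr)
    assume "\<not> ?thesis"
    then obtain w where w: "{last P, w} \<in> E" "w \<in> S2" "w \<notin> set P" by (auto simp: nbrs_def)
    have pw: "pth E (P @ [w])" using PP(1) w by (auto simp: pth_append)
    have "w \<noteq> hd P" using w(3) P0 by auto
    then consider "{w, hd P} \<in> E" | "w \<in> A2" "{w, hd P} \<notin> E" using S2 w(2) PP(3) by blast
    then show False
    proof cases
      case 1
      then have "cyc E (P @ [w])" using pw PP(2) c3 P0 by (auto simp: cyc_def)
      then show False using no_long PP(2) by fastforce
    next
      case 2
      then have "Q (P @ [w])" unfolding Q_def using pw PP P0 \<open>w \<noteq> hd P\<close> by (auto simp: insert_commute)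
      then show False using max by fastforce
    qed
  qed
  have "card (nbrs E (hd P) \<inter> S1) \<le> card (nbrs E (hd P) \<inter> set P)"
    using sub1 by (intro card_mono) auto
  then have e1: "d1 \<le> card (nbrs E (hd P) \<inter> set P)" using d1[OF PP(3)] by linarith
  have "card (nbrs E (last P) \<inter> S2) \<le> card (nbrs E (last P) \<inter> set P)"
    using sub2 by (intro card_mono) auto
  then have e2: "d2 \<le> card (nbrs E (last P) \<inter> set P)" using d2[OF PP(4)] by linarith
  obtain D where "cyc E D" "min (length P) (card (nbrs E (hd P) \<inter> set P) + card (nbrs E (last P) \<inter> set P)) \<le> length D"
    using kopylov_cycle[OF conn loopfree PP(1) PV] order.trans[OF d(2) e1] order.trans[OF d(3) e2] PP(2) c3
    by auto
  then show False using no_long[of D] PP(2) e1 e2 d by linarith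
qed

end

section \<open>Disintegration and edge counting\<close>

lemma (in circ) ex_maximal: "\<exists>F. E \<subseteq> F \<and> max_circ V F c"
proof -
  define \<F> where "\<F> = {F. E \<subseteq> F \<and> F \<subseteq> all_pairs V \<and> (\<forall>D. cyc F D \<longrightarrow> length D \<le> c)}"
  have "\<F> \<subseteq> Pow (all_pairs V)" unfolding \<F>_def by auto
  then have fin: "finite \<F>" using finite_all_pairs[OF finV] by (meson finite_Pow_iff finite_subset)
  have EF: "E \<in> \<F>" unfolding \<F>_def using EV no_long by auto
  obtain F where F: "F \<in> \<F>" and max: "\<forall>F'\<in>\<F>. F \<subseteq> F' \<longrightarrow> F = F'"
    using finite_has_maximal2[OF fin EF] by metis
  have F1: "E \<subseteq> F" "F \<subseteq> all_pairs V" "\<And>D. cyc F D \<Longrightarrow> length D \<le> c" using F unfolding \<F>_def by auto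
  have "max_circ V F c"
  proof
    show "conn2 V F" using conn F1(1) by (rule conn2_mono)
    fix u v assume uv: "u \<in> V" "v \<in> V" "u \<noteq> v" "{u, v} \<notin> F"
    have "insert {u, v} F \<notin> \<F>" using max uv(4) by blast
    moreover have "{u, v} \<in> all_pairs V" using uv by (simp add: all_pairs_iff)
    ultimately obtain D where D: "cyc (insert {u, v} F) D" "c < length D"
      unfolding \<F>_def using F1 by (auto simp: not_le)
    then have "\<not> cyc F D" using F1(3) by fastforce
    then show "\<exists>xs. pth F xs \<and> c < length xs \<and> hd xs = u \<and> last xs = v"
      using cyc_new_edge[OF D(1)] D(2) by metis
  qed (use finV c3 F1 in auto)
  then show ?thesis using F1(1) by blast
qed

lemma clique_pth:
  assumes "distinct xs" "\<And>u v. \<lbrakk>u \<in> set xs; v \<in> set xs; u \<noteq> v\<rbrakk> \<Longrightarrow> {u, v} \<in> E"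
  shows "pth E xs"
  using assms
proof (induction xs)
  case (Cons x xs)
  show ?case
  proof (cases xs)
    case (Cons y ys)
    then have "{x, y} \<in> E" using Cons.prems(1) by (intro Cons.prems(2)) auto
    then show ?thesis using Cons.IH Cons.prems Cons by (simp add: pth_Cons)
  qed simp
qed simp

lemma clique_cyc:
  assumes "distinct xs" "3 \<le> length xs" "\<And>u v. \<lbrakk>u \<in> set xs; v \<in> set xs; u \<noteq> v\<rbrakk> \<Longrightarrow> {u, v} \<in> E"
  shows "cyc E xs"
proof -
  have x0: "xs \<noteq> []" using assms(2) by auto
  have "hd xs \<noteq> last xs" using assms(1,2) by (cases xs) auto
  then have "{last xs, hd xs} \<in> E" using x0 by (intro assms(3)) auto
  then show ?thesis using clique_pth[OF assms(1,3)] assms(2) by (simp add: cyc_def)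
qed

section \<open>Counting edges by deleting vertices of small degree\<close>

context circ begin

definition edges_in :: "'a set \<Rightarrow> 'a set set" where
  "edges_in S = {e \<in> E. e \<subseteq> S}"

lemma fin_edges_in: "finite (edges_in S)"
  unfolding edges_in_def using finite_all_pairs[OF finV] EV by (auto intro: finite_subset)

lemma edges_in_V: "edges_in V = E"
  unfolding edges_in_def using EV by (auto simp: all_pairs_def)

lemma edges_in_remove:
  assumes "v \<in> S"
  shows "card (edges_in S) \<le> card (edges_in (S - {v})) + card (nbrs E v \<inter> S)"
proof -
  have sub: "edges_in S \<subseteq> edges_in (S - {v}) \<union> (\<lambda>w. {v, w}) ` (nbrs E v \<inter> S)"
  proof
    fix e assume e: "e \<in> edges_in S"
    show "e \<in> edges_in (S - {v}) \<union> (\<lambda>w. {v, w}) ` (nbrs E v \<inter> S)"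
    proof (cases "v \<in> e")
      case True
      have "card e = 2" using e EV unfolding edges_in_def all_pairs_def by auto
      then obtain w where "e = {v, w}" using True by (auto simp: card_2_iff)
      then show ?thesis using e unfolding edges_in_def by (auto simp: nbrs_def)
    qed (use e in \<open>auto simp: edges_in_def\<close>)
  qed
  have "finite (nbrs E v \<inter> S)" using fin_nbrs by simp
  then have "card (edges_in S) \<le> card (edges_in (S - {v}) \<union> (\<lambda>w. {v, w}) ` (nbrs E v \<inter> S))"
    using sub fin_edges_in by (intro card_mono) auto
  also have "\<dots> \<le> card (edges_in (S - {v})) + card ((\<lambda>w. {v, w}) ` (nbrs E v \<inter> S))"
    by (rule card_Un_le)
  also have "card ((\<lambda>w. {v, w}) ` (nbrs E v \<inter> S)) \<le> card (nbrs E v \<inter> S)"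
    using \<open>finite (nbrs E v \<inter> S)\<close> by (rule card_image_le)
  finally show ?thesis by simp
qed

lemma edges_in_choose: "finite S \<Longrightarrow> card (edges_in S) \<le> card S choose 2"
proof -
  assume S: "finite S"
  have "edges_in S \<subseteq> all_pairs S" unfolding edges_in_def using EV by (auto simp: all_pairs_def)
  then show ?thesis using card_mono[OF finite_all_pairs[OF S]] card_all_pairs[OF S] by simp
qed

lemma edges_in_eliminate:
  assumes "T \<subseteq> S" "S \<subseteq> V"
    and "\<And>U. \<lbrakk>T \<subset> U; U \<subseteq> S\<rbrakk> \<Longrightarrow> \<exists>v\<in>U - T. card (nbrs E v \<inter> U) \<le> d"
  shows "card (edges_in S) \<le> card (edges_in T) + d * (card S - card T)"
  using assms
proof (induction "card (S - T)" arbitrary: S)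
  case 0
  have "finite S" using "0.prems"(2) finV finite_subset by blast
  then have "S = T" using 0 by (auto simp: card_eq_0_iff)
  then show ?case by simp
next
  case (Suc m)
  have fS: "finite S" using Suc.prems(2) finV finite_subset by blast
  have "T \<subset> S" using Suc.hyps(2) Suc.prems(1) by (cases "S = T") auto
  then obtain v where v: "v \<in> S - T" "card (nbrs E v \<inter> S) \<le> d" using Suc.prems(3)[of S] by blast
  let ?S = "S - {v}"
  have "m = card (?S - T)" using Suc.hyps(2) v(1) fS
    by (metis Diff_insert Diff_insert2 card_Diff_singleton diff_Suc_1)
  moreover have "\<exists>v\<in>U - T. card (nbrs E v \<inter> U) \<le> d" if "T \<subset> U" "U \<subseteq> ?S" for U
    using Suc.prems(3)[of U] that by blast
  ultimately have IH: "card (edges_in ?S) \<le> card (edges_in T) + d * (card ?S - card T)"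
    using Suc.hyps(1)[of ?S] Suc.prems(1,2) v(1) by blast
  have "card T \<le> card ?S" using Suc.prems(1) v(1) fS by (intro card_mono) auto
  moreover have "card S = Suc (card ?S)" using v(1) fS by (metis Diff_iff card_Suc_Diff1)
  ultimately have "card S - card T = Suc (card ?S - card T)" by simp
  then show ?case using IH v(2) edges_in_remove[of v S] v(1) by auto
qed

text \<open>Vertices with at most \<open>t\<close> remaining neighbours are deleted until
  \<open>t\<close> vertices are left. Those span at most \<open>t choose 2\<close> edges, which is
  better than charging \<open>t\<close> edges to each of them.\<close>

lemma edges_in_degenerate:
  assumes "S \<subseteq> V" "t \<le> card S"
    and "\<And>U. \<lbrakk>U \<noteq> {}; U \<subseteq> V\<rbrakk> \<Longrightarrow> \<exists>v\<in>U. card (nbrs E v \<inter> U) \<le> t"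
  shows "card (edges_in S) \<le> (t choose 2) + t * (card S - t)"
  using assms(1,2)
proof (induction "card S - t" arbitrary: S)
  case 0
  have "finite S" using "0.prems"(1) finV finite_subset by blast
  then show ?case using 0 edges_in_choose[of S] by simp
next
  case (Suc m)
  have fS: "finite S" using Suc.prems(1) finV finite_subset by blast
  have "S \<noteq> {}" using Suc.hyps(2) by auto
  then obtain v where v: "v \<in> S" "card (nbrs E v \<inter> S) \<le> t" using assms(3) Suc.prems(1) by blast
  let ?S = "S - {v}"
  have cS: "card S = Suc (card ?S)" using v(1) fS by (metis card_Suc_Diff1)
  have "m = card ?S - t" "?S \<subseteq> V" "t \<le> card ?S" using cS Suc.hyps(2) Suc.prems(1) by auto
  then have "card (edges_in ?S) \<le> (t choose 2) + t * (card ?S - t)" by (rule Suc.hyps(1))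
  moreover have "card S - t = Suc (card ?S - t)" using cS Suc.hyps(2) by simp
  ultimately show ?case using v edges_in_remove[of v S] by auto
qed

text \<open>This is what Kopylov's disintegration, the repeated deletion of vertices of degree at most
  \<open>d\<close>, leaves of the graph.\<close>

definition core :: "nat \<Rightarrow> 'a set" where
  "core d = \<Union> {U. U \<subseteq> V \<and> (\<forall>v\<in>U. d < card (nbrs E v \<inter> U))}"

lemma core_V: "core d \<subseteq> V"
  unfolding core_def by auto

lemma core_greatest: "\<lbrakk>U \<subseteq> V; \<And>v. v \<in> U \<Longrightarrow> d < card (nbrs E v \<inter> U)\<rbrakk> \<Longrightarrow> U \<subseteq> core d"
  unfolding core_def by blast

lemma core_degree:
  assumes "v \<in> core d" shows "d < card (nbrs E v \<inter> core d)"
proof -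
  obtain U where U: "v \<in> U" "U \<subseteq> V" "\<forall>v\<in>U. d < card (nbrs E v \<inter> U)" using assms unfolding core_def by blast
  have "U \<subseteq> core d" using U by (intro core_greatest) auto
  then have "card (nbrs E v \<inter> U) \<le> card (nbrs E v \<inter> core d)" using fin_nbrs by (intro card_mono) auto
  then show ?thesis using U by fastforce
qed

lemma core_eliminate:
  assumes "core d \<subset> U" "U \<subseteq> V"
  shows "\<exists>v\<in>U - core d. card (nbrs E v \<inter> U) \<le> d"
proof (rule ccontr)
  assume neg: "\<not> ?thesis"
  have "U \<subseteq> core d"
  proof (rule core_greatest[OF assms(2)])
    fix v assume "v \<in> U"
    show "d < card (nbrs E v \<inter> U)"
    proof (cases "v \<in> core d")
      case True
      have "card (nbrs E v \<inter> core d) \<le> card (nbrs E v \<inter> U)" using fin_nbrs assms(1) by (intro card_mono) auto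
      then show ?thesis using core_degree[OF True] by linarith
    qed (use neg \<open>v \<in> U\<close> in force)
  qed
  then show False using assms(1) by auto
qed

end

section \<open>Estimates for the function f\<close>

lemma two_choose_two: "2 * int (m choose 2) = int m * (int m - 1)"
  by (induction m) (auto simp: numeral_2_eq_2 algebra_simps)

lemma f_edges_int:
  assumes "a \<le> c" "c < n"
  shows "2 * int (f_edges n a c) = (int c + 1 - int a) * (int c - int a) + 2 * int a * (int n + int a - int c - 1)"
proof -
  have "int (c + 1 - a) = int c + 1 - int a" "int (n + a - (c + 1)) = int n + int a - int c - 1" using assms by auto
  moreover have "2 * int (f_edges n a c) = 2 * int ((c + 1 - a) choose 2) + 2 * int a * int (n + a - (c + 1))"
    unfolding f_edges_def by simp
  ultimately show ?thesis using two_choose_two[of "c + 1 - a"] by simp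
qed

text \<open>As a function of its middle argument, \<open>f_edges\<close> is quadratic with leading
  coefficient 3/2. The difference \<open>F x - F y\<close> has the factor
  \<open>3 * (x + y) + B\<close>; a value at \<open>s\<close> above both end values would make this
  factor positive at \<open>s + a\<close> and negative at the larger sum
  \<open>s + b\<close>.\<close>

lemma f_edges_convex:
  assumes "a \<le> s" "s \<le> b" "b \<le> c" "c < n"
  shows "f_edges n s c \<le> max (f_edges n a c) (f_edges n b c)"
proof (rule ccontr)
  assume "\<not> ?thesis"
  then have l: "f_edges n a c < f_edges n s c" "f_edges n b c < f_edges n s c" by auto
  define F :: "int \<Rightarrow> int" where "F x = (int c + 1 - x) * (int c - x) + 2 * x * (int n + x - int c - 1)" for x
  define B where "B = 2 * int n - 4 * int c - 3"
  have F: "2 * int (f_edges n x c) = F (int x)" if "x \<le> c" for x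
    unfolding F_def by (rule f_edges_int[OF that assms(4)])
  have dF: "F x - F y = (x - y) * (3 * (x + y) + B)" for x y
    unfolding F_def B_def by (simp add: algebra_simps)
  have p: "0 < F (int s) - F (int a)" "0 < F (int s) - F (int b)"
    using l F[of a] F[of s] F[of b] assms by auto
  have "a \<noteq> s" "s \<noteq> b" using l by auto
  then have "int a < int s" "int s < int b" using assms by auto
  then have "0 < 3 * (int s + int a) + B" "3 * (int s + int b) + B < 0"
    using p unfolding dF by (auto simp: zero_less_mult_iff)
  then show False using \<open>int a < int s\<close> \<open>int s < int b\<close> by (smt (verit))
qed

text \<open>The left side is the bound of \<open>edges_in_degenerate\<close> for
  \<open>t = c div 2\<close>. The two sides agree for even \<open>c\<close> and differ by 1 for odd
  \<open>c\<close>.\<close>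

lemma degenerate_le_f_edges:
  assumes "c < n"
  shows "((c div 2) choose 2) + (c div 2) * (n - c div 2) \<le> f_edges n (c div 2) c"
proof -
  define t where "t = c div 2"
  have t: "t \<le> c" "t \<le> n" "c = 2 * t \<or> c = 2 * t + 1" unfolding t_def using assms by auto
  have "2 * (int (t choose 2) + int t * (int n - int t)) \<le> 2 * int (f_edges n t c)"
    using two_choose_two[of t] f_edges_int[OF t(1) assms] t(3) by (auto simp: algebra_simps)
  then have "int ((t choose 2) + t * (n - t)) \<le> int (f_edges n t c)" using t(2) by (simp add: of_nat_diff)
  then show ?thesis unfolding t_def by linarith
qed

section \<open>The clique that disintegration leaves\<close>

context max_circ begin

text \<open>Vertices of this core have at least \<open>c div 2 + 1\<close> neighbours in it, so two
  of these degrees add up to more than \<open>c\<close> for either parity of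
  \<open>c\<close>.\<close>

lemma core_clique:
  assumes "u \<in> core (c div 2)" "v \<in> core (c div 2)" "u \<noteq> v"
  shows "{u, v} \<in> E"
proof -
  define t where "t = c div 2"
  have "c < (t + 1) + (t + 1)" "2 \<le> t + 1" unfolding t_def using c3 by auto
  moreover have "t + 1 \<le> card (nbrs E w \<inter> core t)" if "w \<in> core t" for w
    using core_degree[OF that] by simp
  ultimately show ?thesis
    using dense_adjacent[of "core t" "core t" "core t" "core t" "t + 1" "t + 1" u v] core_V assms
    unfolding t_def by auto
qed

lemma core_clique_degree:
  assumes "v \<in> core (c div 2)"
  shows "card (nbrs E v \<inter> core (c div 2)) = card (core (c div 2)) - 1"
proof -
  have "nbrs E v \<inter> core (c div 2) = core (c div 2) - {v}"
    using core_clique[of v] assms nbrs_V[of v] by (auto simp: nbrs_def)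
  then show ?thesis using assms by simp
qed

lemma clique_le:
  assumes "H \<subseteq> V" "3 \<le> card H" "\<And>u v. \<lbrakk>u \<in> H; v \<in> H; u \<noteq> v\<rbrakk> \<Longrightarrow> {u, v} \<in> E"
  shows "card H \<le> c"
proof -
  have "finite H" using assms(1) finV finite_subset by blast
  then obtain xs where xs: "set xs = H" "distinct xs" using finite_distinct_list by blast
  then have "cyc E xs" using clique_cyc[of xs E] assms(2,3) distinct_card by metis
  then show ?thesis using no_long xs distinct_card by metis
qed

text \<open>Vertices of the clique \<open>H\<close> on \<open>r\<close> vertices have degree
  \<open>r - 1\<close> in it, and vertices of \<open>core s\<close> have degree at least
  \<open>s + 1\<close>; the threshold \<open>s = c + 1 - r\<close> is chosen to make these add up to
  \<open>c + 1\<close>. A vertex of \<open>core s\<close> outside \<open>H\<close> is then adjacent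
  to all of \<open>H\<close> by \<open>dense_adjacent\<close>, and could be added to
  \<open>core (c div 2)\<close>.\<close>

lemma core_stable:
  assumes ne: "core (c div 2) \<noteq> {}"
  shows "core (c + 1 - card (core (c div 2))) = core (c div 2)"
proof -
  define t where "t = c div 2"
  define H where "H = core t"
  define r where "r = card H"
  define s where "s = c + 1 - r"
  have HV: "H \<subseteq> V" unfolding H_def by (rule core_V)
  have deg: "card (nbrs E v \<inter> H) = r - 1" if "v \<in> H" for v
    using core_clique_degree that unfolding H_def t_def r_def by simp
  obtain v0 where v0: "v0 \<in> H" using ne unfolding H_def t_def by blast
  have r: "t + 2 \<le> r" using core_degree[of v0 t] v0 deg[OF v0] unfolding H_def by simp
  have "3 \<le> r" using r c3 unfolding t_def by simp
  then have rc: "r \<le> c" unfolding r_def using clique_le[OF HV] core_clique unfolding H_def t_def by blast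
  have s: "1 \<le> s" "s \<le> t" unfolding s_def using rc r unfolding t_def by auto
  have sub: "H \<subseteq> core s" using deg r s by (intro core_greatest[OF HV]) auto
  have "core s \<subseteq> H"
  proof (rule ccontr)
    assume "\<not> ?thesis"
    then obtain u where u: "u \<in> core s" "u \<notin> H" by blast
    have "{u, v} \<in> E" if v: "v \<in> H" for v
    proof (rule dense_adjacent[of "core s - H" H "core s" H "s + 1" "r - 1"])
      show "w \<in> core s - H \<or> {w, v} \<in> E" if "w \<in> core s" "v \<in> H" "w \<noteq> v" for w v
        using that core_clique unfolding H_def t_def by blast
      show "s + 1 \<le> card (nbrs E u \<inter> core s)" if "u \<in> core s - H" for u
        using core_degree[of u s] that by simp
      show "r - 1 \<le> card (nbrs E v \<inter> H)" if "v \<in> H" for v using deg that by simp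
      show "c < s + 1 + (r - 1)" "2 \<le> s + 1" "2 \<le> r - 1" using s r rc \<open>3 \<le> r\<close> unfolding s_def by auto
    qed (use u v HV core_V in auto)
    then have nu: "H \<subseteq> nbrs E u" by (auto simp: nbrs_def)
    have "insert u H \<subseteq> core t"
    proof (rule core_greatest)
      show "insert u H \<subseteq> V" using u HV core_V by blast
      fix v assume v: "v \<in> insert u H"
      have "t + 1 \<le> card (nbrs E v \<inter> H)"
      proof (cases "v = u")
        case True
        then have "nbrs E v \<inter> H = H" using nu by auto
        then show ?thesis using r unfolding r_def by simp
      qed (use v deg r in auto)
      moreover have "card (nbrs E v \<inter> H) \<le> card (nbrs E v \<inter> insert u H)"
        using fin_nbrs by (intro card_mono) auto
      ultimately show "t < card (nbrs E v \<inter> insert u H)" by linarith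
    qed
    then show False using u unfolding H_def by blast
  qed
  then show ?thesis using sub unfolding s_def r_def H_def t_def by auto
qed

lemma clique_of_many_edges:
  assumes n: "card V = n" "c < n" and deg: "\<And>v. v \<in> V \<Longrightarrow> k \<le> card (nbrs E v)"
    and e: "max (f_edges n (k + 1) c) (f_edges n (c div 2) c) < card E"
  shows "\<exists>H \<subseteq> V. card H = c + 1 - k \<and> (\<forall>u\<in>H. \<forall>v\<in>H. u \<noteq> v \<longrightarrow> {u, v} \<in> E) \<and>
    2 \<le> k \<and> k < c div 2 \<and> card E \<le> f_edges n k c"
proof -
  define t where "t = c div 2"
  define H where "H = core t"
  have "H \<noteq> {}"
  proof
    assume H0: "H = {}"
    have "card (edges_in V) \<le> (t choose 2) + t * (card V - t)"
    proof (rule edges_in_degenerate)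
      show "t \<le> card V" using n unfolding t_def by simp
      fix U assume U: "U \<noteq> {}" "U \<subseteq> V"
      have "core t \<subset> U" using U H0 unfolding H_def by auto
      then show "\<exists>v\<in>U. card (nbrs E v \<inter> U) \<le> t" using core_eliminate[of t U] U by blast
    qed simp
    then have "card E \<le> f_edges n t c" using degenerate_le_f_edges[OF n(2)] n(1) unfolding edges_in_V t_def by simp
    then show False using e unfolding t_def by simp
  qed
  define s where "s = c + 1 - card H"
  have core_s: "core s = H" using core_stable \<open>H \<noteq> {}\<close> unfolding s_def H_def t_def by blast
  have HV: "H \<subseteq> V" unfolding H_def by (rule core_V)
  have finH: "finite H" using HV finV finite_subset by blast
  have cl: "{u, v} \<in> E" if "u \<in> H" "v \<in> H" "u \<noteq> v" for u v
    using core_clique that unfolding H_def t_def by blast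
  obtain v0 where "v0 \<in> H" using \<open>H \<noteq> {}\<close> by blast
  then have r: "t + 2 \<le> card H"
    using core_degree[of v0 t] core_clique_degree[of v0] unfolding H_def t_def by simp
  then have rc: "card H \<le> c" using clique_le[OF HV] cl c3 unfolding t_def by auto
  have s: "1 \<le> s" "s \<le> t" "s \<le> c" "card H = c + 1 - s" unfolding s_def using rc r unfolding t_def by auto
  have "card (edges_in V) \<le> card (edges_in H) + s * (card V - card H)"
    using HV core_eliminate[of s] unfolding core_s by (intro edges_in_eliminate) auto
  then have "card E \<le> (card H choose 2) + s * (n - card H)"
    using edges_in_choose[OF finH] n(1) unfolding edges_in_V by simp
  also have "n - card H = n + s - (c + 1)" using s n(2) by simp
  finally have es: "card E \<le> f_edges n s c" unfolding f_edges_def using s(4) by simp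
  have "s \<le> k"
  proof (rule ccontr)
    assume "\<not> ?thesis"
    then have "f_edges n s c \<le> max (f_edges n (k + 1) c) (f_edges n t c)"
      using s n(2) unfolding t_def by (intro f_edges_convex) auto
    then show False using es e unfolding t_def by linarith
  qed
  \<comment> \<open>A minimum degree above \<open>s\<close> would put all of \<open>V\<close> into
    \<open>core s = H\<close>, which has at most \<open>c < n\<close> vertices. This is applied to
    the degree bound \<open>k\<close> and to the bound 2 that follows from 2-connectedness.\<close>
  have low: "s \<ge> m" if "\<And>v. v \<in> V \<Longrightarrow> m \<le> card (nbrs E v)" for m
  proof (rule ccontr)
    assume neg: "\<not> m \<le> s"
    then have "V \<subseteq> core s"
    proof (intro core_greatest)
      fix v assume "v \<in> V"
      moreover have "nbrs E v \<inter> V = nbrs E v" using nbrs_V by blast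
      ultimately show "s < card (nbrs E v \<inter> V)" using that neg by fastforce
    qed simp
    then have "V = H" using HV unfolding core_s by blast
    then show False using rc n by simp
  qed
  have "s = k" using low[OF deg] \<open>s \<le> k\<close> by simp
  moreover have "2 \<le> s" using low two_nbrs by blast
  moreover have "s \<noteq> t" using es e unfolding t_def by auto
  ultimately show ?thesis using HV cl s es unfolding t_def by (intro exI[of _ H]) auto
qed

end

section \<open>Paths outside the clique\<close>

text \<open>Ore's exchange for spanning paths with prescribed ends. If \<open>u\<close> is adjacent
  to position \<open>l\<close> and \<open>w\<close> to position \<open>l + 1\<close>, reversing the
  segment between the pair \<open>u\<close>, \<open>w\<close> and the pair \<open>l\<close>,
  \<open>l + 1\<close> replaces the missing edge by these two edges and keeps the ends. So
  \<open>L\<close> and \<open>L'\<close> are disjoint; both avoid \<open>i\<close>, which leaves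
  \<open>m - 2\<close> positions. The degree of \<open>u\<close> exceeds \<open>card L\<close> by at
  most one, for the last vertex, and that of \<open>w\<close> exceeds \<open>card L'\<close> by at
  most one, for the first vertex.\<close>

lemma hamilton_path_degree_sum_ordered:
  assumes loop: "\<And>v. {v} \<notin> F" and dist: "distinct xs"
    and i: "Suc i < length xs" "xs ! i = u" "xs ! Suc i = w"
    and parts: "pth F (take (Suc i) xs)" "pth F (drop (Suc i) xs)"
    and nF: "nbrs F u \<subseteq> set xs" "nbrs F w \<subseteq> set xs"
    and none: "\<nexists>ys. pth F ys \<and> set ys = set xs \<and> hd ys = hd xs \<and> last ys = last xs"
  shows "card (nbrs F u) + card (nbrs F w) \<le> length xs"
proof -
  define m where "m = length xs"
  define L where "L = {l. Suc l < m \<and> {u, xs ! l} \<in> F}"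
  define L' where "L' = {l. Suc l < m \<and> {w, xs ! Suc l} \<in> F}"
  let ?A = "take (Suc i) xs" and ?B = "drop (Suc i) xs"
  have A: "last ?A = u" "hd ?B = w" "?A \<noteq> []" "?B \<noteq> []"
    using i by (simp_all add: take_Suc_conv_app_nth hd_drop_conv_nth take_eq_Nil)
  have dj: "set ?A \<inter> set ?B = {}" using dist by (simp add: set_take_disj_set_drop_if_distinct)
  have iL: "i \<notin> L" "i \<notin> L'" using loop i unfolding L_def L'_def by auto
  have cross: False if l: "l \<in> L" "l \<in> L'" for l
  proof -
    have lm: "Suc l < length xs" "{u, xs ! l} \<in> F" "{w, xs ! Suc l} \<in> F" using l unfolding L_def L'_def m_def by auto
    consider "l < i" | "i < l" using l iL by (metis nat_neq_iff)
    then show False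
    proof cases
      case 1
      let ?X = "take (Suc l) xs" and ?M = "drop (Suc l) ?A"
      have "take (Suc l) ?A = ?X" using 1 by (simp add: min_def)
      then have XM: "?A = ?X @ ?M" by (metis append_take_drop_id)
      have M: "?M \<noteq> []" using 1 i by auto
      have X: "?X \<noteq> []" "last ?X = xs ! l" using lm by (simp_all add: take_Suc_conv_app_nth take_eq_Nil)
      have lM: "last ?M = u" using A XM M by (metis last_appendR)
      have hM: "hd ?M = xs ! Suc l" using 1 i M by (simp add: hd_drop_conv_nth)
      have pX: "pth F ?X" "pth F ?M" "set ?X \<inter> set ?M = {}" using parts(1) XM pth_append by metis+
      have sA: "set ?A = set ?X \<union> set ?M" using XM by (metis set_append)
      have "pth F (rev ?M @ ?B)" using pX parts(2) dj sA M A lm hM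
        by (auto simp: pth_append last_rev insert_commute)
      then have "pth F (?X @ rev ?M @ ?B)" using pX dj sA M X lM lm
        unfolding pth_append[of F ?X] by (auto simp: hd_rev insert_commute)
      moreover have "set (?X @ rev ?M @ ?B) = set xs" using sA
        by (metis append_take_drop_id set_append set_rev sup_assoc)
      moreover have "hd (?X @ rev ?M @ ?B) = hd xs" using X by simp
      moreover have "last (?X @ rev ?M @ ?B) = last xs" using A i by simp
      ultimately show False using none by blast
    next
      case 2
      let ?M = "take (l - i) ?B" and ?Z = "drop (Suc l) xs"
      have "drop (l - i) ?B = ?Z" using 2 by (simp add: drop_drop)
      then have MZ: "?B = ?M @ ?Z" by (metis append_take_drop_id)
      have M: "?M \<noteq> []" using 2 lm by auto
      have Z: "?Z \<noteq> []" "hd ?Z = xs ! Suc l" using lm by (simp_all add: hd_drop_conv_nth)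
      have hM: "hd ?M = w" using A MZ M by (metis hd_append2)
      have lM: "last ?M = xs ! l"
      proof -
        have len: "length ?M = l - i" using 2 lm by simp
        then have "last ?M = ?M ! (l - i - 1)" using M by (simp add: last_conv_nth)
        also have "\<dots> = xs ! (Suc i + (l - i - 1))" using 2 lm by simp
        also have "Suc i + (l - i - 1) = l" using 2 by simp
        finally show ?thesis .
      qed
      have pM: "pth F ?M" "pth F ?Z" "set ?M \<inter> set ?Z = {}" using parts(2) MZ pth_append by metis+
      have sB: "set ?B = set ?M \<union> set ?Z" using MZ by (metis set_append)
      have "pth F (rev ?M @ ?Z)" using pM M Z hM lm
        by (auto simp: pth_append last_rev insert_commute)
      then have "pth F (?A @ rev ?M @ ?Z)" using parts(1) dj sB M A lM lm
        unfolding pth_append[of F ?A] by (auto simp: hd_rev insert_commute)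
      moreover have "set (?A @ rev ?M @ ?Z) = set xs" using sB
        by (metis append_take_drop_id set_append set_rev)
      moreover have "hd (?A @ rev ?M @ ?Z) = hd xs" using A by simp
      moreover have "last (?A @ rev ?M @ ?Z) = last xs" using Z lm by simp
      ultimately show False using none by blast
    qed
  qed
  have fin: "finite L" "finite L'" unfolding L_def L'_def by (auto intro: finite_subset[of _ "{..<m}"])
  have "card L + card L' = card (L \<union> L')" using cross fin by (intro card_Un_disjoint[symmetric]) auto
  also have "\<dots> \<le> card ({..<m - 1} - {i})"
    using iL by (intro card_mono) (auto simp: L_def L'_def)
  also have "\<dots> = m - 2" using i(1) by (simp add: m_def)
  finally have LL: "card L + card L' \<le> m - 2" .
  have "nbrs F u \<inter> set xs = nbrs F u" "nbrs F w \<inter> set xs = nbrs F w" using nF by auto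
  then have cu: "card (nbrs F u) = card {l. l < m \<and> {u, xs ! l} \<in> F}"
    "card (nbrs F w) = card {l. l < m \<and> {w, xs ! l} \<in> F}"
    using card_nbrs_indices[OF dist] unfolding m_def by metis+
  have "card {l. l < m \<and> {u, xs ! l} \<in> F} \<le> card (insert (m - 1) L)"
    using fin by (intro card_mono) (auto simp: L_def)
  also have "\<dots> \<le> Suc (card L)" by (rule card_insert_le_m1) auto
  finally have 1: "card (nbrs F u) \<le> Suc (card L)" using cu by simp
  have "{l. l < m \<and> {w, xs ! l} \<in> F} \<subseteq> insert 0 (Suc ` L')"
  proof
    fix l assume "l \<in> {l. l < m \<and> {w, xs ! l} \<in> F}"
    then show "l \<in> insert 0 (Suc ` L')" by (cases l) (auto simp: L'_def)
  qed
  then have "card {l. l < m \<and> {w, xs ! l} \<in> F} \<le> card (insert 0 (Suc ` L'))"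
    using fin by (intro card_mono) auto
  also have "\<dots> \<le> Suc (card L')" using fin by (simp add: card_insert_if card_image)
  finally have 2: "card (nbrs F w) \<le> Suc (card L')" using cu by simp
  show ?thesis using 1 2 LL i(1) unfolding m_def by linarith
qed

lemma hamilton_path_degree_sum:
  assumes loop: "\<And>v. {v} \<notin> F" and xs: "pth (insert {u, w} F) xs"
    and nF: "nbrs F u \<subseteq> set xs" "nbrs F w \<subseteq> set xs"
    and none: "\<nexists>ys. pth F ys \<and> set ys = set xs \<and> hd ys = hd xs \<and> last ys = last xs"
  shows "card (nbrs F u) + card (nbrs F w) \<le> length xs"
proof -
  have dist: "distinct xs" using xs by (rule pth_distinct)
  have "\<not> pth F xs" using none by blast
  then obtain i where i: "Suc i < length xs" "{xs ! i, xs ! Suc i} \<notin> F"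
    using dist by (auto simp: pth_def successively_conv_nth)
  have "{xs ! i, xs ! Suc i} \<in> insert {u, w} F" using xs i(1) unfolding pth_def by (auto dest: successively_nth)
  then have e: "{xs ! i, xs ! Suc i} = {u, w}" using i(2) by auto
  let ?A = "take (Suc i) xs" and ?B = "drop (Suc i) xs"
  have p: "pth (insert {u, w} F) ?A" "pth (insert {u, w} F) ?B" "set ?A \<inter> set ?B = {}"
    using xs by (metis append_take_drop_id pth_append)+
  have "xs ! i \<in> set ?A" using i(1) by (simp add: take_Suc_conv_app_nth)
  moreover have "xs ! Suc i \<in> set ?B" using i(1) by (metis hd_drop_conv_nth hd_in_set drop_eq_Nil not_le)
  ultimately have "xs ! Suc i \<notin> set ?A" "xs ! i \<notin> set ?B" using p(3) by auto
  then have "u \<notin> set ?A \<or> w \<notin> set ?A" "u \<notin> set ?B \<or> w \<notin> set ?B"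
    using e by (auto simp: doubleton_eq_iff)
  then have parts: "pth F ?A" "pth F ?B" using pth_avoid_edge p by metis+
  consider "xs ! i = u" "xs ! Suc i = w" | "xs ! i = w" "xs ! Suc i = u" using e by (auto simp: doubleton_eq_iff)
  then show ?thesis
  proof cases
    case 1
    then show ?thesis using hamilton_path_degree_sum_ordered[OF loop dist i(1) 1 parts nF none] by blast
  next
    case 2
    then show ?thesis using hamilton_path_degree_sum_ordered[OF loop dist i(1) 2 parts nF(2,1) none]
      by (simp add: add.commute)
  qed
qed

locale clique_circ = circ +
  fixes H :: "'a set" and k :: nat
  assumes HV: "H \<subseteq> V" and clique: "\<lbrakk>u \<in> H; v \<in> H; u \<noteq> v\<rbrakk> \<Longrightarrow> {u, v} \<in> E"
    and cardH: "card H = c + 1 - k" and k2: "2 \<le> k" and ck: "2 * k + 2 \<le> c"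
    and deg: "v \<in> V \<Longrightarrow> k \<le> card (nbrs E v)" and cV: "c < card V"
begin

definition R :: "'a set" where "R = V - H"

lemma finH: "finite H" and finR: "finite R"
  using HV finV finite_subset unfolding R_def by auto

lemma HR: "H \<inter> R = {}" "V = H \<union> R"
  using HV unfolding R_def by auto

lemma RV: "v \<in> R \<Longrightarrow> v \<in> V"
  unfolding R_def by auto

lemma cardR: "k \<le> card R"
  using card_Diff_subset[OF finH HV] cardH cV ck unfolding R_def by simp

lemma nbrs_split: "nbrs E v = (nbrs E v \<inter> H) \<union> (nbrs E v \<inter> R)"
  using nbrs_V HR(2) by blast

lemma clique_list_pth: "\<lbrakk>distinct xs; set xs \<subseteq> H\<rbrakk> \<Longrightarrow> pth E xs"
  by (rule clique_pth) (auto intro: clique)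

text \<open>\<open>P\<close> closes the spanning path of \<open>H \<union> Y\<close> to a cycle on
  at least \<open>(c + 1 - k) + k\<close> vertices.\<close>

lemma no_hamilton_bypass:
  assumes P: "pth E P" "P \<noteq> []" "set P \<subseteq> R" "{a, hd P} \<in> E" "{a', last P} \<in> E"
    and Y: "Y \<subseteq> R - set P" "k \<le> length P + card Y"
    and ys: "pth E ys" "set ys = H \<union> Y" "hd ys = a" "last ys = a'"
  shows False
proof -
  have fY: "finite Y" using Y(1) finR finite_subset by blast
  have len: "length ys = card H + card Y"
  proof -
    have "length ys = card (H \<union> Y)" using pth_distinct[OF ys(1)] ys(2) distinct_card by metis
    also have "\<dots> = card H + card Y" using Y(1) HR(1) finH fY by (intro card_Un_disjoint) auto
    finally show ?thesis .
  qed
  then have y0: "ys \<noteq> []" using cardH ck by auto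
  have "cyc E (ys @ rev P)"
    unfolding cyc_def using P ys y0 Y(1) HR(1) len cardH ck
    by (auto simp: pth_append hd_rev last_rev insert_commute)
  then have "length ys + length P \<le> c" using no_long by fastforce
  then show False using len cardH Y(2) ck by simp
qed

text \<open>Let \<open>F\<close> be edge-maximal on \<open>U = H \<union> Y\<close> without a
  spanning path from \<open>a\<close> to \<open>a'\<close>, and let \<open>p = length P\<close>. By
  the Ore-type bound, a degree sum above \<open>card U = c + 1 - p\<close> forces adjacency in
  \<open>F\<close>. Vertices of \<open>Y\<close> keep degree at least \<open>k - (p - 1)\<close>,
  and clique vertices with a neighbour in \<open>Y\<close> have degree at least
  \<open>c + 1 - k\<close>. These sum to \<open>c + 2 - p\<close>, so a clique vertex attached to
  one vertex of \<open>Y\<close> is joined in \<open>F\<close> to all of \<open>Y\<close>. Too many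
  such attachments would make \<open>F\<close> complete; hence the degree bounds are tight.\<close>

lemma no_bypass_degrees:
  assumes P: "pth E P" "P \<noteq> []" "set P \<subseteq> R" "{a, hd P} \<in> E" "{a', last P} \<in> E"
    and a: "a \<in> H" "a' \<in> H" "a \<noteq> a'"
    and Y: "Y \<subseteq> R - set P" "length P + card Y = k" "length P < k"
    and lost: "\<And>w. w \<in> Y \<Longrightarrow> card (nbrs E w \<inter> R - Y) < length P"
    and w: "w \<in> Y"
  shows "nbrs E w \<inter> H = (\<Union>y\<in>Y. nbrs E y \<inter> H)"
    and "card (nbrs E w \<inter> H) + card (nbrs E w \<inter> Y) = card Y + 1"
    and "card (nbrs E w \<inter> R - Y) = length P - 1"
proof -
  define p where "p = length P"
  define U where "U = H \<union> Y"
  define NY where "NY = (\<Union>y\<in>Y. nbrs E y \<inter> H)"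
  have p1: "1 \<le> p" using P(2) unfolding p_def by (cases P) auto
  have fY: "finite Y" using Y(1) finR finite_subset by blast
  have YR: "Y \<subseteq> R" and HY: "H \<inter> Y = {}" using Y(1) HR(1) by auto
  have fU: "finite U" unfolding U_def using finH fY by simp
  have cU: "card U = c + 1 - p" unfolding U_def using card_Un_disjoint[OF finH fY HY] cardH Y ck unfolding p_def by simp
  define ham where "ham F \<longleftrightarrow> (\<exists>ys. pth F ys \<and> set ys = U \<and> hd ys = a \<and> last ys = a')" for F
  have ham_mono: "\<not> ham F" if "\<not> ham F'" "F \<subseteq> F'" for F F' using that pth_mono unfolding ham_def by blast
  have "edges_in U \<subseteq> E" unfolding edges_in_def by auto
  moreover have "\<not> ham E"
    using no_hamilton_bypass[OF P Y(1)] Y(2) unfolding ham_def U_def by auto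
  ultimately have nh: "\<not> ham (edges_in U)" using ham_mono by blast
  define \<F> where "\<F> = {F. edges_in U \<subseteq> F \<and> F \<subseteq> all_pairs U \<and> \<not> ham F}"
  have "\<F> \<subseteq> Pow (all_pairs U)" unfolding \<F>_def by auto
  then have fin: "finite \<F>" using finite_all_pairs[OF fU] by (meson finite_Pow_iff finite_subset)
  have EF: "edges_in U \<in> \<F>" unfolding \<F>_def using nh EV by (auto simp: edges_in_def all_pairs_def)
  obtain F where F: "F \<in> \<F>" and max: "\<forall>F'\<in>\<F>. F \<subseteq> F' \<longrightarrow> F = F'"
    using finite_has_maximal2[OF fin EF] by metis
  have F1: "edges_in U \<subseteq> F" "F \<subseteq> all_pairs U" "\<not> ham F" using F unfolding \<F>_def by auto
  have nF: "nbrs F u \<subseteq> U - {u}" for u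
    using F1(2) all_pairs_iff[of u _ U] by (auto simp: nbrs_def)
  have fnF: "finite (nbrs F u)" for u using nF fU by (meson finite_Diff finite_subset)
  have loop: "{v} \<notin> F" for v using F1(2) all_pairs_iff[of v v U] by auto
  have EF: "nbrs E u \<inter> U \<subseteq> nbrs F u" if "u \<in> U" for u
    using F1(1) that by (auto simp: nbrs_def edges_in_def)
  have adjF: "{u, v} \<in> F" if uv: "u \<in> U" "v \<in> U" "u \<noteq> v" "card U < card (nbrs F u) + card (nbrs F v)" for u v
  proof (rule ccontr)
    assume neg: "{u, v} \<notin> F"
    have "insert {u, v} F \<notin> \<F>" using max neg by blast
    moreover have "{u, v} \<in> all_pairs U" using uv by (simp add: all_pairs_iff)
    ultimately have "ham (insert {u, v} F)" unfolding \<F>_def using F1 by blast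
    then obtain xs where xs: "pth (insert {u, v} F) xs" "set xs = U" "hd xs = a" "last xs = a'"
      unfolding ham_def by blast
    have "length xs = card U" using pth_distinct[OF xs(1)] xs(2) distinct_card by metis
    moreover have "card (nbrs F u) + card (nbrs F v) \<le> length xs"
      using nF xs F1(3) unfolding ham_def
      by (intro hamilton_path_degree_sum[OF loop xs(1)]) auto
    ultimately show False using uv(4) by simp
  qed
  have H_low: "card H - 1 \<le> card (nbrs F h)" if "h \<in> H" for h
  proof -
    have "H - {h} \<subseteq> nbrs F h" using EF[of h] clique that unfolding U_def by (auto simp: nbrs_def)
    then have "card (H - {h}) \<le> card (nbrs F h)" using fnF by (intro card_mono)
    then show ?thesis using that by simp
  qed
  have H_high: "card H \<le> card (nbrs F h)" if "h \<in> H" "y \<in> Y" "{h, y} \<in> F" for h y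
  proof -
    have "insert y (H - {h}) \<subseteq> nbrs F h" using EF[of h] clique that unfolding U_def by (auto simp: nbrs_def)
    then have "card (insert y (H - {h})) \<le> card (nbrs F h)" using fnF by (intro card_mono)
    moreover have "card (insert y (H - {h})) = card H" using that HY finH
      by (metis Diff_iff IntI card_Suc_Diff1 card_insert_disjoint empty_iff finite_Diff)
    ultimately show ?thesis by simp
  qed
  have wdeg: "k \<le> card (nbrs E y \<inter> H) + card (nbrs E y \<inter> Y) + card (nbrs E y \<inter> R - Y)" if "y \<in> Y" for y
  proof -
    have "nbrs E y = (nbrs E y \<inter> H) \<union> (nbrs E y \<inter> Y) \<union> (nbrs E y \<inter> R - Y)"
      using nbrs_split[of y] YR by blast
    then have "card (nbrs E y) \<le> card ((nbrs E y \<inter> H) \<union> (nbrs E y \<inter> Y)) + card (nbrs E y \<inter> R - Y)"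
      by (metis card_Un_le)
    also have "card ((nbrs E y \<inter> H) \<union> (nbrs E y \<inter> Y)) \<le> card (nbrs E y \<inter> H) + card (nbrs E y \<inter> Y)"
      by (rule card_Un_le)
    finally show ?thesis using deg[of y] that YR RV by fastforce
  qed
  have Y_low: "k + 1 - p \<le> card (nbrs F y)" if "y \<in> Y" for y
  proof -
    have "card (nbrs E y \<inter> H) + card (nbrs E y \<inter> Y) = card (nbrs E y \<inter> U)"
      unfolding U_def Int_Un_distrib using fin_nbrs HY by (intro card_Un_disjoint[symmetric]) auto
    also have "\<dots> \<le> card (nbrs F y)" using EF[of y] that fnF unfolding U_def by (intro card_mono) auto
    finally show ?thesis using wdeg[OF that] lost[OF that] unfolding p_def by linarith
  qed
  have NYadj: "{h, y} \<in> F" if hy: "h \<in> NY" "y \<in> Y" for h y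
  proof (rule adjF)
    obtain y' where y': "y' \<in> Y" "h \<in> nbrs E y'" and h: "h \<in> H" using hy(1) unfolding NY_def by blast
    have "{h, y'} \<in> F" using EF[of h] h y' unfolding U_def by (auto simp: nbrs_def insert_commute)
    then have "card H \<le> card (nbrs F h)" using H_high h y'(1) by blast
    then show "card U < card (nbrs F h) + card (nbrs F y)"
      using Y_low[OF hy(2)] cU cardH Y ck unfolding p_def by linarith
    show "h \<in> U" "y \<in> U" "h \<noteq> y" using h hy(2) HY unfolding U_def by auto
  qed
  have NYH: "NY \<subseteq> H" unfolding NY_def by auto
  \<comment> \<open>One surplus neighbour starts a cascade: \<open>y\<close> becomes adjacent to all
    of \<open>H\<close>, so every clique vertex has a neighbour in \<open>Y\<close> and becomes
    adjacent to all of \<open>Y\<close>, and finally \<open>Y\<close> becomes a clique. Then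
    \<open>F\<close> is complete and has the forbidden path.\<close>
  have bound: "card NY + card (nbrs E y \<inter> Y) \<le> k + 1 - p" if y: "y \<in> Y" for y
  proof (rule ccontr)
    assume neg: "\<not> ?thesis"
    have "NY \<union> (nbrs E y \<inter> Y) \<subseteq> nbrs F y"
      using NYadj y EF[of y] unfolding U_def by (auto simp: nbrs_def insert_commute)
    then have "card (NY \<union> (nbrs E y \<inter> Y)) \<le> card (nbrs F y)" using fnF by (intro card_mono)
    moreover have "card (NY \<union> (nbrs E y \<inter> Y)) = card NY + card (nbrs E y \<inter> Y)"
      using NYH HY finH fY finite_subset by (intro card_Un_disjoint) auto
    ultimately have yb: "k + 2 - p \<le> card (nbrs F y)" using neg Y(3) unfolding p_def by linarith
    have Hy: "{h, y} \<in> F" if h: "h \<in> H" for h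
    proof (rule adjF)
      show "card U < card (nbrs F h) + card (nbrs F y)"
        using H_low[OF h] yb cU cardH Y ck unfolding p_def by linarith
    qed (use h y HY in \<open>auto simp: U_def\<close>)
    have HYadj: "{h, z} \<in> F" if h: "h \<in> H" "z \<in> Y" for h z
    proof (rule adjF)
      show "card U < card (nbrs F h) + card (nbrs F z)"
        using H_high[OF h(1) y Hy[OF h(1)]] Y_low[OF h(2)] cU cardH Y ck unfolding p_def by linarith
    qed (use h HY in \<open>auto simp: U_def\<close>)
    have YH: "card H \<le> card (nbrs F z)" if "z \<in> Y" for z
    proof -
      have "H \<subseteq> nbrs F z" using HYadj that by (auto simp: nbrs_iff(2))
      then show ?thesis using fnF by (intro card_mono)
    qed
    have YY: "{z, z'} \<in> F" if z: "z \<in> Y" "z' \<in> Y" "z \<noteq> z'" for z z'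
    proof (rule adjF)
      show "card U < card (nbrs F z) + card (nbrs F z')"
        using YH[OF z(1)] YH[OF z(2)] cU cardH ck p1 by linarith
    qed (use z in \<open>auto simp: U_def\<close>)
    have all: "{u, v} \<in> F" if uv: "u \<in> U" "v \<in> U" "u \<noteq> v" for u v
    proof -
      consider "u \<in> H" "v \<in> H" | "u \<in> H" "v \<in> Y" | "u \<in> Y" "v \<in> H" | "u \<in> Y" "v \<in> Y"
        using uv unfolding U_def by blast
      then show ?thesis
      proof cases
        case 1
        then have "v \<in> nbrs E u \<inter> U" using clique[of u v] uv by (auto simp: nbrs_def)
        then show ?thesis using EF[OF uv(1)] by (auto simp: nbrs_def)
      next
        case 3 then show ?thesis using HYadj[of v u] by (simp add: insert_commute)
      qed (use HYadj YY uv(3) in auto)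
    qed
    obtain zs where zs: "set zs = U - {a, a'}" "distinct zs" using fU finite_distinct_list by (metis finite_Diff)
    have aU: "a \<in> U" "a' \<in> U" using a unfolding U_def by auto
    have "pth F (a # zs @ [a'])" using zs a(3) aU by (intro clique_pth) (auto intro!: all)
    moreover have "set (a # zs @ [a']) = U" using zs aU by auto
    ultimately show False using F1(3) unfolding ham_def by (metis last_ConsR last_snoc list.sel(1) snoc_eq_iff_butlast)
  qed
  have sub: "nbrs E w \<inter> H \<subseteq> NY" unfolding NY_def using w by auto
  have le: "card (nbrs E w \<inter> H) \<le> card NY" using sub NYH finH finite_subset by (intro card_mono) auto
  have ww: "k \<le> card (nbrs E w \<inter> H) + card (nbrs E w \<inter> Y) + card (nbrs E w \<inter> R - Y)"
    "card NY + card (nbrs E w \<inter> Y) \<le> k + 1 - p" "card (nbrs E w \<inter> R - Y) < p"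
    using wdeg[OF w] bound[OF w] lost[OF w] unfolding p_def by auto
  have pk: "p < k" "p + card Y = k" using Y unfolding p_def by auto
  \<comment> \<open>Chained together, the inequalities lead from \<open>k\<close> back to
    \<open>k\<close>, so each of them is an equality.\<close>
  have eq: "card (nbrs E w \<inter> H) = card NY" using ww le pk by linarith
  then show "nbrs E w \<inter> H = (\<Union>y\<in>Y. nbrs E y \<inter> H)"
    using card_subset_eq[OF _ sub] NYH finH finite_subset unfolding NY_def[symmetric] by blast
  show "card (nbrs E w \<inter> H) + card (nbrs E w \<inter> Y) = card Y + 1" using ww le pk by linarith
  show "card (nbrs E w \<inter> R - Y) = length P - 1" using ww le pk p1 unfolding p_def by linarith
qed

text \<open>For \<open>Y = {w}\<close> the degree formula leaves \<open>w\<close> exactly two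
  neighbours in \<open>H\<close>. If these are not \<open>a\<close> and \<open>a'\<close>, then
  \<open>w\<close> can be inserted between them into a path through all of \<open>H\<close> from
  \<open>a\<close> to \<open>a'\<close>, which \<open>no_hamilton_bypass\<close> forbids.\<close>

lemma no_bypass_single:
  assumes P: "pth E P" "P \<noteq> []" "set P \<subseteq> R" "{a, hd P} \<in> E" "{a', last P} \<in> E"
    and a: "a \<in> H" "a' \<in> H" "a \<noteq> a'"
    and k: "length P + 1 = k" and w: "w \<in> R" "w \<notin> set P"
    and lost: "card (nbrs E w \<inter> R) < length P"
  shows "nbrs E w \<inter> H = {a, a'}" "card (nbrs E w \<inter> R) = length P - 1"
proof -
  have nw: "nbrs E w \<inter> R - {w} = nbrs E w \<inter> R" "nbrs E w \<inter> {w} = {}" using nbrs_V by auto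
  have Y: "{w} \<subseteq> R - set P" "length P + card {w} = k" "length P < k" using w k by auto
  have l: "card (nbrs E v \<inter> R - {w}) < length P" if "v \<in> {w}" for v using that lost nw by simp
  note d = no_bypass_degrees[OF P a Y l]
  show "card (nbrs E w \<inter> R) = length P - 1" using d(3)[of w] nw by simp
  have "card (nbrs E w \<inter> H) = 2" using d(2)[of w] nw by simp
  then obtain b0 b1 where b01: "nbrs E w \<inter> H = {b0, b1}" "b0 \<noteq> b1" by (meson card_2_iff)
  show "nbrs E w \<inter> H = {a, a'}"
  proof (rule ccontr)
    assume neg: "\<not> ?thesis"
    have "b0 \<notin> {a, a'} \<or> b1 \<notin> {a, a'}" using neg b01 a(3) by auto
    then obtain b b' where b: "nbrs E w \<inter> H = {b, b'}" "b \<noteq> b'" "b \<notin> {a, a'}"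
      using b01 by (metis insert_commute)
    have bH: "b \<in> H" "b' \<in> H" "{w, b} \<in> E" "{w, b'} \<in> E" using b(1) by (auto simp: nbrs_def)
    have wH: "w \<notin> H" using w(1) HR(1) by auto
    have hp: False if "pth E ys" "set ys = H \<union> {w}" "hd ys = a" "last ys = a'" for ys
      using no_hamilton_bypass[OF P Y(1)] Y(2) that by auto
    obtain zs where zs: "set zs = H - {a, a', b, b'}" "distinct zs" using finH finite_distinct_list by (metis finite_Diff)
    consider "b' = a" | "b' = a'" | "b' \<notin> {a, a'}" by blast
    then show False
    proof cases
      case 1
      have "pth E (b # zs @ [a'])" using zs a bH b by (intro clique_list_pth) auto
      then have "pth E (a # w # b # zs @ [a'])" using bH 1 a b wH zs
        unfolding pth_Cons[of E a] pth_Cons[of E w] by (auto simp: insert_commute)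
      then show False using hp[of "a # w # b # zs @ [a']"] zs a bH 1 b(3) by auto
    next
      case 2
      have "pth E (a # zs @ [b])" using zs a bH b by (intro clique_list_pth) auto
      then have "pth E ((a # zs @ [b]) @ [w, a'])" using bH 2 a b wH zs
        unfolding pth_append[of E "a # zs @ [b]"] by (auto simp: pth_Cons insert_commute)
      then show False using hp[of "(a # zs @ [b]) @ [w, a']"] zs a bH 2 b(3) by auto
    next
      case 3
      have "pth E (b' # zs @ [a'])" using zs a bH 3 by (intro clique_list_pth) auto
      moreover have "{a, b} \<in> E" using clique a bH b(3) by auto
      ultimately have "pth E (a # b # w # b' # zs @ [a'])" using bH 3 a b wH zs
        unfolding pth_Cons[of E a] pth_Cons[of E b] pth_Cons[of E w] by (auto simp: insert_commute)
      then show False using hp[of "a # b # w # b' # zs @ [a']"] zs a bH 3 b(3) by auto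
    qed
  qed
qed

text \<open>Let a longest such path \<open>M\<close> have at least \<open>k\<close> vertices. Its
  first vertex \<open>x\<close> has no neighbour in \<open>H\<close> except possibly
  \<open>h\<close>, since otherwise \<open>M\<close> and \<open>H\<close> would form a cycle; its
  other neighbours, at least \<open>k - 1\<close>, lie on \<open>M\<close>. Prolong \<open>M\<close>
  through \<open>h\<close> and the rest of \<open>H\<close> to a last vertex \<open>y\<close>. No
  neighbour of \<open>x\<close> comes after \<open>h\<close>, so \<open>noncrossing_cycle\<close>
  applies and gives a cycle through \<open>x\<close>, its neighbours and all of \<open>H\<close>.
  This is at least \<open>1 + (k - 1) + (c + 1 - k) = c + 1\<close> vertices.\<close>

lemma pendant_path_short:
  assumes "pth E P" "P \<noteq> []" "set P \<subseteq> R" "h \<in> H" "{last P, h} \<in> E"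
  shows "length P < k"
proof -
  define Q where "Q xs \<longleftrightarrow> pth E xs \<and> xs \<noteq> [] \<and> set xs \<subseteq> R \<and> (\<exists>h\<in>H. {last xs, h} \<in> E)" for xs
  have "Q P" using assms unfolding Q_def by auto
  moreover have "distinct xs \<and> set xs \<subseteq> V" if "Q xs" for xs using that RV unfolding Q_def by (auto simp: pth_def)
  ultimately obtain M where M: "Q M" and max: "\<And>xs. Q xs \<Longrightarrow> length xs \<le> length M"
    using longest_list[of Q] by blast
  have "length M < k"
  proof (rule ccontr)
    assume "\<not> ?thesis"
    then have Mk: "k \<le> length M" by simp
    obtain h where MM: "pth E M" "M \<noteq> []" "set M \<subseteq> R" "h \<in> H" "{last M, h} \<in> E" using M unfolding Q_def by auto
    define x where "x = hd M"
    have xR: "x \<in> R" using MM unfolding x_def by auto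
    have xV: "x \<in> V" using RV xR .
    have x_H: "x \<notin> H" using xR HR(1) by auto
    have M_H: "set M \<inter> H = {}" using MM(3) HR(1) by auto
    have xH: "nbrs E x \<inter> H \<subseteq> {h}"
    proof (rule ccontr)
      assume "\<not> ?thesis"
      then obtain h' where h': "h' \<in> H" "h' \<noteq> h" "{x, h'} \<in> E" by (auto simp: nbrs_def)
      obtain zs where zs: "set zs = H - {h, h'}" "distinct zs" using finH finite_distinct_list by (metis finite_Diff)
      have d: "distinct (h # zs @ [h'])" and s: "set (h # zs @ [h']) = H" using zs h' MM(4) by auto
      have "pth E (h # zs @ [h'])" using clique_list_pth[OF d] equalityD1[OF s] .
      then have "pth E (M @ h # zs @ [h'])" using MM M_H s unfolding pth_append[of E M] by auto
      moreover have len: "length (h # zs @ [h']) = card H" using d s distinct_card by metis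
      ultimately have "cyc E (M @ h # zs @ [h'])" using h'(3) MM(2) cardH ck
        unfolding cyc_def x_def by (auto simp: insert_commute)
      then have "length M + card H \<le> c" using no_long len by fastforce
      then show False using Mk cardH ck by simp
    qed
    have xR': "nbrs E x \<inter> R \<subseteq> set M"
    proof
      fix w assume w: "w \<in> nbrs E x \<inter> R"
      show "w \<in> set M"
      proof (rule ccontr)
        assume "w \<notin> set M"
        then have "Q (w # M)" using MM w unfolding Q_def x_def by (auto simp: pth_Cons nbrs_iff(2))
        then show False using max by fastforce
      qed
    qed
    have nx: "nbrs E x \<subseteq> insert h (set M)" using nbrs_split[of x] xH xR' by blast
    obtain hs where hs: "set hs = H - {h}" "distinct hs" using finH finite_distinct_list by (metis finite_Diff)
    have hs_len: "length hs = card H - 1" using hs MM(4) distinct_card by (metis card_Diff_singleton)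
    then have hs0: "hs \<noteq> []" using cardH ck by auto
    have sH: "set (h # hs) = H" "distinct (h # hs)" using hs MM(4) by auto
    define F where "F = M @ h # hs"
    have pF: "pth E F" unfolding F_def using MM M_H clique_list_pth[OF sH(2)] sH
      unfolding pth_append[of E M] by auto
    have F_V: "set F \<subseteq> V" unfolding F_def using MM(3) RV sH HV by auto
    have hdF: "hd F = x" unfolding F_def x_def using MM(2) by simp
    define y where "y = last hs"
    have y: "last F = y" "y \<in> H" "y \<noteq> h" "y \<in> set hs" unfolding F_def y_def using hs0 hs last_in_set[OF hs0] by auto
    \<comment> \<open>The position of \<open>h\<close>: from there on \<open>F\<close> runs exactly
      through \<open>H\<close>, and all of this except \<open>y\<close> itself is adjacent to
      \<open>y\<close>.\<close>
    define \<beta> where "\<beta> = length M"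
    define \<alpha> where "\<alpha> = Max {i. i < length F \<and> {x, F ! i} \<in> E}"
    have F\<beta>: "F ! \<beta> = h" "Suc \<beta> < length F" "drop \<beta> F = h # hs" "take (Suc \<beta>) F = M @ [h]"
      unfolding F_def \<beta>_def using hs0 by auto
    have idx: "i \<le> \<beta>" if "i < length F" "{x, F ! i} \<in> E" for i
    proof (rule ccontr)
      assume "\<not> i \<le> \<beta>"
      then have "F ! i \<in> set hs" using that(1) unfolding F_def \<beta>_def by (auto simp: nth_append nth_Cons split: nat.split)
      moreover have "F ! i \<in> insert h (set M)" using nx that(2) by (auto simp: nbrs_def)
      ultimately show False using hs(1) M_H by auto
    qed
    have "k \<le> card (nbrs E x)" using deg[OF xV] .
    then have "nbrs E x \<noteq> {}" using k2 by auto
    then obtain w where "w \<in> nbrs E x" by blast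
    then have "w \<in> set F" "{x, w} \<in> E" using nx unfolding F_def by (auto simp: nbrs_def)
    then have ne: "{i. i < length F \<and> {x, F ! i} \<in> E} \<noteq> {}" by (auto simp: in_set_conv_nth)
    then have "\<alpha> \<in> {i. i < length F \<and> {x, F ! i} \<in> E}" unfolding \<alpha>_def by (intro Max_in) auto
    then have \<alpha>: "\<alpha> < length F" "{x, F ! \<alpha>} \<in> E" by auto
    have "F ! 0 = x" using hdF MM(2) unfolding F_def by (simp add: hd_conv_nth nth_append)
    then have "0 < \<alpha>" using \<alpha>(2) loopfree[of x] by (cases \<alpha>) auto
    moreover have "\<alpha> \<le> \<beta>" using idx \<alpha> by blast
    ultimately obtain D where D: "cyc E D" "x \<in> set D" "y \<in> set D"
      "nbrs E x \<inter> set (take (Suc \<alpha>) F) \<subseteq> set D" "nbrs E y \<inter> set (drop \<beta> F) \<subseteq> set D"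
      using noncrossing_cycle[OF conn pF F_V, of \<alpha> \<beta>] F\<beta> \<alpha> clique[OF y(2) MM(4) y(3)] unfolding hdF y(1) by blast
    have "nbrs E x \<subseteq> set (take (Suc \<alpha>) F)"
    proof
      fix w assume w: "w \<in> nbrs E x"
      then have "w \<in> set F" using nx unfolding F_def by auto
      then obtain i where i: "i < length F" "F ! i = w" by (auto simp: in_set_conv_nth)
      then have "i \<le> \<alpha>" unfolding \<alpha>_def using w by (intro Max_ge) (auto simp: nbrs_def)
      then show "w \<in> set (take (Suc \<alpha>) F)" using i \<alpha>(1) by (auto simp: in_set_conv_nth intro!: exI[of _ i])
    qed
    then have "nbrs E x \<subseteq> set D" using D(4) by auto
    moreover have "H \<subseteq> set D"
    proof
      fix h' assume h': "h' \<in> H"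
      show "h' \<in> set D"
      proof (cases "h' = y")
        case False
        then have "h' \<in> nbrs E y" using clique[OF y(2) h'] by (auto simp: nbrs_def)
        then show ?thesis using D(5) h' sH(1) F\<beta>(3) by auto
      qed (use D in simp)
    qed
    ultimately have sub: "insert x ((nbrs E x \<inter> R) \<union> H) \<subseteq> set D" using D(2) by auto
    have "card (nbrs E x) \<le> card (nbrs E x \<inter> H) + card (nbrs E x \<inter> R)"
      using nbrs_split[of x] by (metis card_Un_le)
    moreover have "card (nbrs E x \<inter> H) \<le> 1" using xH card_mono[of "{h}"] by fastforce
    ultimately have nR: "k \<le> card (nbrs E x \<inter> R) + 1" using \<open>k \<le> card (nbrs E x)\<close> by linarith
    have "x \<notin> (nbrs E x \<inter> R) \<union> H" using x_H nbrs_V by auto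
    moreover have "card ((nbrs E x \<inter> R) \<union> H) = card (nbrs E x \<inter> R) + card H"
      using finH fin_nbrs HR(1) by (intro card_Un_disjoint) auto
    ultimately have "card (insert x ((nbrs E x \<inter> R) \<union> H)) = Suc (card (nbrs E x \<inter> R) + card H)"
      using finH fin_nbrs by simp
    then have "Suc (card (nbrs E x \<inter> R) + card H) \<le> length D"
      using card_mono[OF _ sub] D(1) by (simp add: length_cyc)
    then show False using no_long[OF D(1)] nR cardH ck by linarith
  qed
  then show ?thesis using max[OF \<open>Q P\<close>] by linarith
qed

text \<open>Suppose a longest path \<open>M\<close> outside \<open>H\<close> has at least
  \<open>k\<close> vertices. By \<open>pendant_path_short\<close> its first vertex \<open>x\<close>
  has no neighbour in \<open>H\<close>, so all neighbours of \<open>x\<close> lie on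
  \<open>M\<close>, and the chord to the last of them, \<open>u\<close>, closes a cycle on more than
  \<open>k\<close> vertices. Some path from \<open>M\<close> to \<open>H\<close> leaves
  \<open>M\<close> at a vertex \<open>v\<close>. Opening the cycle at \<open>v\<close>, or taking
  the initial part of \<open>M\<close> up to \<open>v\<close> when \<open>v\<close> comes after
  \<open>u\<close>, gives at least \<open>k\<close> vertices to be followed by that path, against
  \<open>pendant_path_short\<close>.\<close>

lemma R_path_short:
  assumes "pth E Q" "set Q \<subseteq> R"
  shows "length Q < k"
proof -
  define Z where "Z xs \<longleftrightarrow> pth E xs \<and> set xs \<subseteq> R" for xs
  have "Z Q" using assms unfolding Z_def by auto
  moreover have "distinct xs \<and> set xs \<subseteq> V" if "Z xs" for xs using that RV unfolding Z_def by (auto simp: pth_def)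
  ultimately obtain M where M: "Z M" and max: "\<And>xs. Z xs \<Longrightarrow> length xs \<le> length M"
    using longest_list[of Z] by blast
  have "length M < k"
  proof (rule ccontr)
    assume "\<not> ?thesis"
    then have Mk: "k \<le> length M" by simp
    have MM: "pth E M" "set M \<subseteq> R" "M \<noteq> []" using M Mk k2 unfolding Z_def by auto
    define x where "x = hd M"
    have "x \<in> R" using MM unfolding x_def by auto
    then have xR: "x \<in> R" "x \<in> V" using RV by auto
    have noH: "{x, h} \<notin> E" if "h \<in> H" for h
    proof
      assume "{x, h} \<in> E"
      then have "length (rev M) < k" using MM that unfolding x_def
        by (intro pendant_path_short[of _ h]) (auto simp: last_rev)
      then show False using Mk by simp
    qed
    have nx: "nbrs E x \<subseteq> set M"
    proof
      fix w assume w: "w \<in> nbrs E x"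
      show "w \<in> set M"
      proof (rule ccontr)
        assume wM: "w \<notin> set M"
        have "w \<in> R" using w noH nbrs_V HR(2) by (auto simp: nbrs_def)
        then have "Z (w # M)" using MM w wM unfolding Z_def x_def by (auto simp: pth_Cons nbrs_iff(2))
        then show False using max by fastforce
      qed
    qed
    have dx: "k \<le> card (nbrs E x)" using deg xR by blast
    then have "nbrs E x \<noteq> {}" using k2 by auto
    then have "\<exists>w\<in>set M. {x, w} \<in> E" using nx by (auto simp: nbrs_def)
    then obtain us u bs where u: "M = us @ u # bs" "{x, u} \<in> E" "\<forall>y\<in>set bs. {x, y} \<notin> E"
      using split_list_last_prop[of M "\<lambda>w. {x, w} \<in> E"] by blast
    have "nbrs E x \<subseteq> set (us @ [u]) - {x}" using nx u nbrs_V[of x] by (auto simp: nbrs_def)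
    moreover have us0: "us \<noteq> []" using u loopfree[of x] unfolding x_def by (cases us) auto
    then have xus: "x = hd us" using u(1) unfolding x_def by simp
    ultimately have "nbrs E x \<subset> set (us @ [u])" using us0 by auto
    then have "card (nbrs E x) < card (set (us @ [u]))" by (intro psubset_card_mono) auto
    then have len: "k < length (us @ [u])" using dx card_length[of "us @ [u]"] by linarith
    have "H \<noteq> {}" using cardH ck by auto
    \<comment> \<open>\<open>conn2_jump\<close> works after the deletion of one vertex; it is taken
      from \<open>H\<close>, which has others to serve as targets.\<close>
    then obtain z where z: "z \<in> H" by blast
    have Hz: "H - {z} \<noteq> {}"
    proof
      assume "H - {z} = {}"
      then have "H = {z}" using z by blast
      then have "card H = 1" by simp
      then show False using cardH ck by simp
    qed
    have "set M \<subseteq> V - {z}" "H - {z} \<subseteq> V - {z}" "set M \<noteq> {}" "set M \<inter> (H - {z}) = {}" "z \<in> V"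
      using MM HR z HV RV by auto
    then obtain J where J: "pth E J" "length J \<ge> 2" "set J \<subseteq> V - {z}" "hd J \<in> set M" "last J \<in> H - {z}"
      "set (tl J) \<inter> set M = {}" "set (butlast J) \<inter> (H - {z}) = {}"
      using conn2_jump[OF conn, of z "set M" "H - {z}"] Hz by metis
    have J0: "J \<noteq> []" using J(2) by auto
    define J' where "J' = butlast J"
    have JJ: "J = J' @ [last J]" unfolding J'_def using J0 by simp
    have J'0: "J' \<noteq> []" using J(2) unfolding J'_def by (cases J) auto
    have J': "pth E J'" "set J' \<subseteq> R" "hd J' = hd J" "{last J', last J} \<in> E" "set (tl J') \<inter> set M = {}"
    proof -
      have "pth E (J' @ [last J])" using J(1) JJ by simp
      then show "pth E J'" "{last J', last J} \<in> E" using J'0 by (auto simp: pth_append)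
      show "set J' \<subseteq> R" using J(3,7) JJ unfolding J'_def R_def by (auto dest: in_set_butlastD)
      show "hd J' = hd J" using JJ J'0 by (metis hd_append2)
      have "tl J = tl J' @ [last J]" using JJ J'0 by (metis tl_append2)
      then show "set (tl J') \<inter> set M = {}" using J(6) by auto
    qed
    have short: False if "pth E W" "W \<noteq> []" "set W \<subseteq> set M" "last W = hd J" "k \<le> length W" for W
    proof -
      have tlM: "set W \<inter> set J' \<subseteq> {hd J'}" using that(3) J'(5) set_hd_tl[OF J'0] by auto
      note j = pth_join[OF that(1) J'(1) that(2) J'0 _ tlM]
      have "length (W @ tl J') < k"
        using j that J' J(5) MM(2) by (intro pendant_path_short[of _ "last J"]) auto
      then show False using that(5) by simp
    qed
    define v where "v = hd J"
    show False
    proof (cases "v \<in> set (us @ [u])")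
      case True
      then obtain cs ds where cd: "us @ [u] = cs @ v # ds" by (meson split_list)
      have M': "M = (cs @ [v]) @ ds @ bs" using u(1) cd by (metis append.assoc append_Cons append_Nil)
      have pp: "pth E (cs @ [v])" "pth E ds" "set ds \<inter> set (cs @ [v]) = {}"
        using MM(1) unfolding M' pth_append[of E "cs @ [v]"] pth_append[of E ds] by auto
      have h: "hd (cs @ [v]) = x" unfolding x_def M' by (cases cs) auto
      have "ds \<noteq> [] \<Longrightarrow> last ds = u" using cd by (metis last_ConsR last_appendR last_snoc list.distinct(1))
      then have "pth E (ds @ cs @ [v])" using pp h u(2) by (auto simp: pth_append[of E ds] insert_commute)
      moreover have "length (ds @ cs @ [v]) = length (us @ [u])" using cd by simp
      moreover have "set (ds @ cs @ [v]) \<subseteq> set M" unfolding M' by auto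
      ultimately show False using short[of "ds @ cs @ [v]"] len unfolding v_def by simp
    next
      case False
      then have "v \<in> set bs" using J(4) u(1) unfolding v_def by auto
      then obtain cs ds where cd: "bs = cs @ v # ds" by (meson split_list)
      have M': "M = (us @ [u] @ cs @ [v]) @ ds" using u(1) cd by simp
      have "pth E (us @ [u] @ cs @ [v])" using MM(1) unfolding M' pth_append[of E "us @ [u] @ cs @ [v]"] by blast
      moreover have "set (us @ [u] @ cs @ [v]) \<subseteq> set M" unfolding M' by auto
      ultimately show False using short[of "us @ [u] @ cs @ [v]"] len unfolding v_def by simp
    qed
  qed
  then show ?thesis using max[OF \<open>Z Q\<close>] by linarith
qed

end

section \<open>Structure outside the clique\<close>

lemma hd_subset: "\<lbrakk>xs \<noteq> []; set xs \<subseteq> S\<rbrakk> \<Longrightarrow> hd xs \<in> S"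
  by (meson hd_in_set subsetD)

context clique_circ begin

lemma longest_path_in:
  assumes "S \<subseteq> R" "S \<noteq> {}"
  shows "\<exists>Q. pth E Q \<and> Q \<noteq> [] \<and> set Q \<subseteq> S \<and> (\<forall>Q'. pth E Q' \<and> set Q' \<subseteq> S \<longrightarrow> length Q' \<le> length Q)"
proof -
  define Z where "Z xs \<longleftrightarrow> pth E xs \<and> set xs \<subseteq> S" for xs
  obtain s where "s \<in> S" using assms(2) by blast
  then have s: "Z [s]" unfolding Z_def by auto
  moreover have "distinct xs \<and> set xs \<subseteq> V" if "Z xs" for xs
    using that assms(1) RV unfolding Z_def by (auto simp: pth_def)
  ultimately obtain M where M: "Z M" and max: "\<And>xs. Z xs \<Longrightarrow> length xs \<le> length M"
    using longest_list[of Z] by blast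
  have "M \<noteq> []" using max[OF s] by auto
  then show ?thesis using M max unfolding Z_def by blast
qed

lemma longest_path_saturated:
  assumes "pth E Q" "Q \<noteq> []" "set Q \<subseteq> S" "\<And>Q'. \<lbrakk>pth E Q'; set Q' \<subseteq> S\<rbrakk> \<Longrightarrow> length Q' \<le> length Q"
  shows "nbrs E (hd Q) \<inter> S \<subseteq> set Q - {hd Q}" "card (nbrs E (hd Q) \<inter> S) \<le> length Q - 1"
proof -
  show sub: "nbrs E (hd Q) \<inter> S \<subseteq> set Q - {hd Q}"
  proof
    fix w assume w: "w \<in> nbrs E (hd Q) \<inter> S"
    have "w \<in> set Q"
    proof (rule ccontr)
      assume "w \<notin> set Q"
      then have "pth E (w # Q)" "set (w # Q) \<subseteq> S" using assms w by (auto simp: pth_Cons nbrs_iff(2))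
      then show False using assms(4) by fastforce
    qed
    then show "w \<in> set Q - {hd Q}" using w nbrs_V by auto
  qed
  have "card (set Q - {hd Q}) = length Q - 1"
    using assms(2) pth_distinct[OF assms(1)] by (simp add: distinct_card)
  then show "card (nbrs E (hd Q) \<inter> S) \<le> length Q - 1" using card_mono[OF _ sub] by simp
qed

text \<open>From a neighbour of \<open>hd Q\<close> on \<open>P\<close> the path \<open>Q\<close> can be continued along \<open>P\<close> in either
  direction, so this neighbour has at least \<open>length Q\<close> vertices of \<open>P\<close> on both sides.\<close>

lemma longest_path_end_degree:
  assumes P: "pth E P" "set P \<subseteq> R" and maxP: "\<And>Q. \<lbrakk>pth E Q; set Q \<subseteq> R\<rbrakk> \<Longrightarrow> length Q \<le> length P"
    and S: "S \<subseteq> R - set P"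
    and Q: "pth E Q" "Q \<noteq> []" "set Q \<subseteq> S" "\<And>Q'. \<lbrakk>pth E Q'; set Q' \<subseteq> S\<rbrakk> \<Longrightarrow> length Q' \<le> length Q"
  shows "card (nbrs E (hd Q) \<inter> (S \<union> set P)) < length P"
    and "card (nbrs E (hd Q) \<inter> (S \<union> set P)) = length P - 1 \<Longrightarrow>
      length Q = length P \<and> nbrs E (hd Q) \<inter> set P = {}"
proof -
  define t q p where "t = hd Q" and "q = length Q" and "p = length P"
  have q1: "1 \<le> q" unfolding q_def using Q(2) by (cases Q) auto
  have qp: "q \<le> p" unfolding q_def p_def using maxP Q S by blast
  have sat: "card (nbrs E t \<inter> S) \<le> q - 1" unfolding t_def q_def using longest_path_saturated(2)[OF Q] .
  have "card (nbrs E t \<inter> (S \<union> set P)) < p \<and>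
    (card (nbrs E t \<inter> (S \<union> set P)) = p - 1 \<longrightarrow> q = p \<and> nbrs E t \<inter> set P = {})"
  proof (cases "nbrs E t \<inter> set P = {}")
    case True
    then have "nbrs E t \<inter> (S \<union> set P) = nbrs E t \<inter> S" by blast
    then show ?thesis using sat q1 qp True by auto
  next
    case False
    have dP: "distinct P" using P(1) by (rule pth_distinct)
    have QP: "set Q \<inter> set P = {}" "set Q \<subseteq> R" using Q(3) S by auto
    have idx: "q \<le> l \<and> l + q < p" if l: "l < p" "{t, P ! l} \<in> E" for l
    proof -
      let ?A = "take l P" and ?v = "P ! l" and ?B = "drop (Suc l) P"
      have eq: "P = ?A @ ?v # ?B" using l unfolding p_def by (simp add: id_take_nth_drop)
      have pp: "pth E (?A @ [?v])" "pth E (?v # ?B)"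
      proof -
        show "pth E (?v # ?B)" using P(1) eq pth_append by metis
        have "P = (?A @ [?v]) @ ?B" using eq by simp
        then show "pth E (?A @ [?v])" using P(1) pth_append by metis
      qed
      have sP: "set (?A @ [?v]) \<subseteq> set P" "set (?v # ?B) \<subseteq> set P"
        using l unfolding p_def by (auto dest: in_set_takeD in_set_dropD)
      have "pth E (rev Q @ ?v # ?B)" using Q(1,2) pp(2) sP(2) QP(1) l(2) unfolding t_def
        unfolding pth_append[of E "rev Q"] by (auto simp: last_rev)
      then have "length (rev Q @ ?v # ?B) \<le> p" unfolding p_def using QP P(2) sP(2) by (intro maxP) auto
      moreover have "pth E (rev (?A @ [?v]))" using pp(1) by (simp only: pth_rev)
      then have "pth E (rev Q @ rev (?A @ [?v]))" using Q(1,2) sP(1) QP(1) l(2) unfolding t_def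
        unfolding pth_append[of E "rev Q"] by (auto simp: last_rev)
      then have "length (rev Q @ rev (?A @ [?v])) \<le> p" unfolding p_def using QP P(2) sP(1) by (intro maxP) auto
      ultimately show ?thesis using l(1) unfolding p_def q_def by auto
    qed
    define I where "I = {l. l < p \<and> {t, P ! l} \<in> E}"
    have cI: "card (nbrs E t \<inter> set P) = card I" unfolding I_def p_def using card_nbrs_indices[OF dP] .
    have "card I \<le> card {q..<p - q}" unfolding I_def using idx by (intro card_mono) (auto simp: less_diff_conv)
    then have cI': "card (nbrs E t \<inter> set P) \<le> p - q - q" using cI by simp
    have "card (nbrs E t \<inter> set P) \<noteq> 0" using False by simp
    then have "2 * q < p" using cI' by linarith
    moreover have "card (nbrs E t \<inter> (S \<union> set P)) \<le> card (nbrs E t \<inter> S) + card (nbrs E t \<inter> set P)"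
      unfolding Int_Un_distrib by (rule card_Un_le)
    ultimately have "card (nbrs E t \<inter> (S \<union> set P)) + 1 < p" using sat cI' q1 by linarith
    then show ?thesis by linarith
  qed
  then show "card (nbrs E (hd Q) \<inter> (S \<union> set P)) < length P"
    and "card (nbrs E (hd Q) \<inter> (S \<union> set P)) = length P - 1 \<Longrightarrow>
      length Q = length P \<and> nbrs E (hd Q) \<inter> set P = {}"
    unfolding t_def p_def q_def by auto
qed

text \<open>Provides the hypothesis \<open>lost\<close> of \<open>no_bypass_degrees\<close>. The
  vertex added is an end of a longest path in the rest of \<open>R - set P\<close>, so
  \<open>longest_path_end_degree\<close> bounds its neighbours outside \<open>Y\<close>; enlarging
  \<open>Y\<close> can only lower the numbers for the vertices chosen before.\<close>

lemma extend_low_set: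
  assumes P: "pth E P" "set P \<subseteq> R" and maxP: "\<And>Q. \<lbrakk>pth E Q; set Q \<subseteq> R\<rbrakk> \<Longrightarrow> length Q \<le> length P"
    and U: "U \<subseteq> R - set P" "\<And>w. w \<in> U \<Longrightarrow> card (nbrs E w \<inter> R - U) < length P"
    and m: "card U \<le> m" "m \<le> card (R - set P)"
  shows "\<exists>Y. U \<subseteq> Y \<and> Y \<subseteq> R - set P \<and> card Y = m \<and> (\<forall>w\<in>Y. card (nbrs E w \<inter> R - Y) < length P)"
  using m
proof (induction m rule: dec_induct)
  case base
  then show ?case using U by blast
next
  case (step m)
  then obtain Y where Y: "U \<subseteq> Y" "Y \<subseteq> R - set P" "card Y = m" "\<forall>w\<in>Y. card (nbrs E w \<inter> R - Y) < length P"
    by auto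
  have fY: "finite Y" using Y(2) finR finite_subset by blast
  let ?S = "R - set P - Y"
  have "?S \<noteq> {}" using step.prems Y(2,3) by (metis Diff_eq_empty_iff Suc_n_not_le_n subset_antisym)
  moreover have "?S \<subseteq> R" by blast
  ultimately obtain Q where Q: "pth E Q" "Q \<noteq> []" "set Q \<subseteq> ?S"
    "\<And>Q'. \<lbrakk>pth E Q'; set Q' \<subseteq> ?S\<rbrakk> \<Longrightarrow> length Q' \<le> length Q"
    using longest_path_in[of ?S] by blast
  have t: "hd Q \<in> ?S" using hd_subset[OF Q(2,3)] .
  have "nbrs E (hd Q) \<inter> R - Y = nbrs E (hd Q) \<inter> (?S \<union> set P)" using P(2) Y(2) by auto
  then have lt: "card (nbrs E (hd Q) \<inter> R - Y) < length P"
    using longest_path_end_degree(1)[OF P maxP _ Q] by auto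
  have low: "card (nbrs E w \<inter> R - insert (hd Q) Y) < length P" if "w \<in> insert (hd Q) Y" for w
  proof -
    have "card (nbrs E w \<inter> R - insert (hd Q) Y) \<le> card (nbrs E w \<inter> R - Y)"
      using finR by (intro card_mono) auto
    also have "\<dots> < length P" using that lt Y(4) by auto
    finally show ?thesis .
  qed
  have "card (insert (hd Q) Y) = Suc m" using t Y(3) fY by simp
  then show ?case using Y t low by (intro exI[of _ "insert (hd Q) Y"]) auto
qed

text \<open>At most \<open>length Q - 1\<close> of the at least \<open>k\<close> neighbours lie in
  \<open>R\<close>, and \<open>R_path_short\<close> keeps \<open>length Q\<close> below
  \<open>k\<close>.\<close>

lemma path_end_clique_nbrs:
  assumes "pth E Q" "Q \<noteq> []" "set Q \<subseteq> R" "nbrs E (hd Q) \<inter> R \<subseteq> set Q - {hd Q}"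
  shows "k + 1 \<le> card (nbrs E (hd Q) \<inter> H) + length Q" "2 \<le> card (nbrs E (hd Q) \<inter> H)"
proof -
  have "hd Q \<in> V" using RV[OF hd_subset[OF assms(2,3)]] .
  then have "k \<le> card (nbrs E (hd Q))" by (rule deg)
  moreover have "card (nbrs E (hd Q)) \<le> card (nbrs E (hd Q) \<inter> H) + card (nbrs E (hd Q) \<inter> R)"
    using nbrs_split[of "hd Q"] by (metis card_Un_le)
  moreover have "card (set Q - {hd Q}) = length Q - 1"
    using assms(2) pth_distinct[OF assms(1)] by (simp add: distinct_card)
  then have "card (nbrs E (hd Q) \<inter> R) \<le> length Q - 1" using card_mono[OF _ assms(4)] by simp
  moreover have "1 \<le> length Q" using assms(2) by (cases Q) auto
  ultimately show "k + 1 \<le> card (nbrs E (hd Q) \<inter> H) + length Q" by linarith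
  then show "2 \<le> card (nbrs E (hd Q) \<inter> H)" using R_path_short[OF assms(1,3)] by linarith
qed

lemma longest_path_ends:
  assumes P: "pth E P" "P \<noteq> []" "set P \<subseteq> R" "\<And>Q. \<lbrakk>pth E Q; set Q \<subseteq> R\<rbrakk> \<Longrightarrow> length Q \<le> length P"
  shows "nbrs E (hd P) \<inter> R \<subseteq> set P - {hd P}" "2 \<le> card (nbrs E (hd P) \<inter> H)" "2 \<le> card (nbrs E (last P) \<inter> H)"
proof -
  show 1: "nbrs E (hd P) \<inter> R \<subseteq> set P - {hd P}" using longest_path_saturated(1)[OF P] .
  show "2 \<le> card (nbrs E (hd P) \<inter> H)" using path_end_clique_nbrs(2)[OF P(1-3) 1] .
  have r: "pth E (rev P)" "rev P \<noteq> []" "set (rev P) \<subseteq> R" "\<And>Q. \<lbrakk>pth E Q; set Q \<subseteq> R\<rbrakk> \<Longrightarrow> length Q \<le> length (rev P)"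
    using P by auto
  show "2 \<le> card (nbrs E (last P) \<inter> H)"
    using path_end_clique_nbrs(2)[OF r(1-3) longest_path_saturated(1)[OF r]] P(2) by (simp add: hd_rev)
qed

lemma ex_other: "2 \<le> card A \<Longrightarrow> \<exists>a\<in>A. a \<noteq> b"
proof (rule ccontr)
  assume A: "2 \<le> card A" and "\<not> (\<exists>a\<in>A. a \<noteq> b)"
  then have "card A \<le> card {b}" by (intro card_mono) auto
  then show False using A by simp
qed

text \<open>The path of \<open>no_bypass_degrees\<close> is a single outside vertex here. For
  \<open>k \<ge> 3\<close> two given outside vertices fit into a common \<open>Y\<close>, so they
  have the same neighbours. For \<open>k = 2\<close> the set \<open>Y\<close> is a single vertex,
  which \<open>no_bypass_single\<close> compares with the path vertex itself.\<close>

lemma structure_independent: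
  assumes ind: "\<And>w. w \<in> R \<Longrightarrow> nbrs E w \<inter> R = {}"
  shows "\<exists>N\<subseteq>H. card N = k \<and> (\<forall>w\<in>R. nbrs E w \<inter> H = N)"
proof -
  have dH: "2 \<le> card (nbrs E w \<inter> H)" "k \<le> card (nbrs E w \<inter> H)" if "w \<in> R" for w
    using nbrs_split[of w] ind[OF that] deg[OF RV[OF that]] k2 by auto
  have main: "nbrs E w \<inter> H = (\<Union>y\<in>Y. nbrs E y \<inter> H) \<and> card (nbrs E w \<inter> H) = k"
    if v: "v \<in> R" "Y \<subseteq> R - {v}" "card Y = k - 1" "w \<in> Y" for v Y w
  proof -
    obtain a where a: "a \<in> nbrs E v \<inter> H" using dH(1)[OF v(1)] by (metis card.empty ex_in_conv not_numeral_le_zero)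
    obtain a' where a': "a' \<in> nbrs E v \<inter> H" "a' \<noteq> a" using ex_other[OF dH(1)[OF v(1)]] by blast
    have P: "pth E [v]" "[v] \<noteq> []" "set [v] \<subseteq> R" "{a, hd [v]} \<in> E" "{a', last [v]} \<in> E"
      using v(1) a a' by (auto simp: nbrs_iff(2))
    have aa: "a \<in> H" "a' \<in> H" "a \<noteq> a'" using a a' by auto
    have Y: "Y \<subseteq> R - set [v]" "length [v] + card Y = k" "length [v] < k" using v k2 by auto
    have l: "card (nbrs E y \<inter> R - Y) < length [v]" if "y \<in> Y" for y
    proof -
      have "nbrs E y \<inter> R = {}" using that v(2) by (intro ind) auto
      then show ?thesis by simp
    qed
    note d = no_bypass_degrees[OF P aa Y l v(4)]
    have "nbrs E w \<inter> Y = {}" using ind[of w] v(2,4) by blast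
    then show ?thesis using d(1,2) v(3) k2 by simp
  qed
  have same: "nbrs E w \<inter> H = nbrs E w' \<inter> H \<and> card (nbrs E w \<inter> H) = k" if w: "w \<in> R" "w' \<in> R" "w \<noteq> w'" for w w'
  proof (cases "3 \<le> k")
    case True
    \<comment> \<open>Besides \<open>w\<close> and \<open>w'\<close> there are at least
      \<open>k - 2\<close> outside vertices, and \<open>k - 2\<close> is positive: one of them
      becomes the path \<open>[v]\<close>, the others fill up \<open>Y\<close>.\<close>
    have "k - 2 \<le> card (R - {w, w'})" using cardR w finR by (simp add: card_Diff_subset)
    then obtain X where X: "X \<subseteq> R - {w, w'}" "card X = k - 2" "finite X" by (meson obtain_subset_with_card_n)
    then have "X \<noteq> {}" using True by auto
    then obtain v where v: "v \<in> X" by blast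
    let ?Y = "insert w (insert w' (X - {v}))"
    have "w \<notin> X - {v}" "w' \<notin> X - {v}" "card (X - {v}) = k - 3" using X v by auto
    then have "card ?Y = k - 1" using X(3) w(3) True by simp
    moreover have "?Y \<subseteq> R - {v}" "v \<in> R" using X v w by auto
    ultimately have "nbrs E x \<inter> H = (\<Union>y\<in>?Y. nbrs E y \<inter> H) \<and> card (nbrs E x \<inter> H) = k" if "x \<in> {w, w'}" for x
      using that by (intro main[of v]) auto
    from this[of w] this[of w'] show ?thesis by (metis insertI1 insertI2)
  next
    case False
    then have k: "k = 2" using k2 by simp
    have Y: "{w} \<subseteq> R - {w'}" "card {w} = k - 1" using w k by auto
    have c2: "card (nbrs E w \<inter> H) = 2" using main[OF w(2) Y] k by simp
    have pair: "nbrs E w \<inter> H = {a, a'}" if a: "a \<in> nbrs E w' \<inter> H" "a' \<in> nbrs E w' \<inter> H" "a \<noteq> a'" for a a'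
    proof (rule no_bypass_single(1)[of "[w']"])
      show "card (nbrs E w \<inter> R) < length [w']" using ind[OF w(1)] by simp
    qed (use w a k in \<open>auto simp: nbrs_iff(2)\<close>)
    have "nbrs E w' \<inter> H \<subseteq> nbrs E w \<inter> H"
    proof
      fix a assume a: "a \<in> nbrs E w' \<inter> H"
      obtain a' where "a' \<in> nbrs E w' \<inter> H" "a' \<noteq> a" using ex_other[OF dH(1)[OF w(2)]] by blast
      then show "a \<in> nbrs E w \<inter> H" using pair[OF a] by auto
    qed
    then have "nbrs E w' \<inter> H = nbrs E w \<inter> H"
      using c2 dH(1)[OF w(2)] finH by (intro card_seteq) auto
    then show ?thesis using c2 k by simp
  qed
  have "2 \<le> card R" using cardR k2 by linarith
  then obtain w0 where w0: "w0 \<in> R" by (metis card.empty ex_in_conv not_numeral_le_zero)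
  obtain w1 where w1: "w1 \<in> R" "w1 \<noteq> w0" using ex_other[OF \<open>2 \<le> card R\<close>] by blast
  have "card (nbrs E w0 \<inter> H) = k" using same[OF w0 w1(1)] w1(2) by auto
  moreover have "nbrs E w \<inter> H = nbrs E w0 \<inter> H" if "w \<in> R" for w using same[OF that w0] by blast
  ultimately show ?thesis by (intro exI[of _ "nbrs E w0 \<inter> H"]) auto
qed

text \<open>Equality in \<open>no_bypass_degrees\<close> makes the end \<open>t\<close> of a longest
  path \<open>Q\<close> in \<open>R - set P\<close> adjacent to all the rest of \<open>Q\<close>. If
  \<open>Y\<close> had room for two vertices, the second vertex of \<open>Q\<close> could join
  \<open>t\<close> in \<open>Y\<close>, and \<open>t\<close> would have too few neighbours outside
  \<open>Y\<close>. So \<open>Y\<close> is a single vertex, and \<open>no_bypass_single\<close> can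
  be applied to every longest path outside \<open>H\<close> in place of \<open>P\<close>.\<close>

lemma structure_cliques:
  assumes P0: "pth E P" "P \<noteq> []" "set P \<subseteq> R" "\<And>Q. \<lbrakk>pth E Q; set Q \<subseteq> R\<rbrakk> \<Longrightarrow> length Q \<le> length P"
    and p2: "2 \<le> length P"
  shows "length P + 1 = k" "\<exists>N\<subseteq>H. card N = 2 \<and> (\<forall>w\<in>R. nbrs E w \<inter> H = N)"
    "\<forall>w\<in>R. card (nbrs E w \<inter> R) = length P - 1 \<and>
       (\<forall>w'\<in>nbrs E w \<inter> R. insert w' (nbrs E w' \<inter> R) = insert w (nbrs E w \<inter> R))"
proof -
  define p where "p = length P"
  have pk: "p < k" unfolding p_def using R_path_short[OF P0(1,3)] .
  have maxp: "length Q \<le> p" if "pth E Q" "set Q \<subseteq> R" for Q using P0(4) that unfolding p_def by blast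
  have ne: "R - set L \<noteq> {}" if "length L = p" for L
  proof
    assume "R - set L = {}"
    then have "card R \<le> card (set L)" by (intro card_mono) auto
    then show False using card_length[of L] cardR pk that by linarith
  qed
  have ex_ends: "\<exists>a a'. a \<in> H \<and> a' \<in> H \<and> a \<noteq> a' \<and> {a, hd L} \<in> E \<and> {a', last L} \<in> E"
    if L: "pth E L" "set L \<subseteq> R" "length L = p" for L
  proof -
    have L0: "L \<noteq> []" using L(3) p2 unfolding p_def by auto
    note e = longest_path_ends[OF L(1) L0 L(2)]
    have "2 \<le> card (nbrs E (hd L) \<inter> H)" "2 \<le> card (nbrs E (last L) \<inter> H)" using e maxp L(3) by auto
    then obtain a a' where "a \<in> nbrs E (hd L) \<inter> H" "a' \<in> nbrs E (last L) \<inter> H" "a' \<noteq> a"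
      by (metis card.empty ex_in_conv ex_other not_numeral_le_zero)
    then show ?thesis by (auto simp: nbrs_iff(2))
  qed
  have saturated: "card (nbrs E x \<inter> R - Y) = p - 1"
    if Y: "x \<in> Y" "Y \<subseteq> R - set P" "card Y = k - p" "\<forall>w\<in>Y. card (nbrs E w \<inter> R - Y) < p" for x Y
  proof -
    obtain a a' where a: "a \<in> H" "a' \<in> H" "a \<noteq> a'" "{a, hd P} \<in> E" "{a', last P} \<in> E"
      using ex_ends[OF P0(1,3)] unfolding p_def by blast
    have "length P + card Y = k" "length P < k" "\<And>w. w \<in> Y \<Longrightarrow> card (nbrs E w \<inter> R - Y) < length P"
      using Y pk unfolding p_def by auto
    from no_bypass_degrees(3)[OF P0(1-3) a(4,5,1-3) Y(2) this Y(1)] show ?thesis unfolding p_def .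
  qed
  let ?T = "R - set P"
  have "?T \<noteq> {}" using ne unfolding p_def by blast
  moreover have "?T \<subseteq> R" by blast
  ultimately obtain Q where Q: "pth E Q" "Q \<noteq> []" "set Q \<subseteq> ?T"
    "\<And>Q'. \<lbrakk>pth E Q'; set Q' \<subseteq> ?T\<rbrakk> \<Longrightarrow> length Q' \<le> length Q"
    using longest_path_in[of ?T] by blast
  define t where "t = hd Q"
  have tT: "t \<in> ?T" unfolding t_def using hd_subset[OF Q(2,3)] .
  have TP: "?T \<union> set P = R" using P0(3) by auto
  have kT: "k - p \<le> card ?T" using cardR card_length[of P] diff_card_le_card_Diff[of "set P" R] unfolding p_def by simp
  have lowt: "card (nbrs E t \<inter> R) < p" "card (nbrs E t \<inter> R) = p - 1 \<Longrightarrow> length Q = p \<and> nbrs E t \<inter> set P = {}"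
    using longest_path_end_degree[OF P0(1,3,4) subset_refl Q] unfolding TP t_def p_def by auto
  have cut: "card (nbrs E w \<inter> R - Y) \<le> card (nbrs E w \<inter> R)" for w Y using finR by (intro card_mono) auto
  have low_set: "\<exists>Y. U \<subseteq> Y \<and> (\<forall>x\<in>U. card (nbrs E x \<inter> R - Y) = p - 1)"
    if U: "U \<subseteq> ?T" "card U \<le> k - p" "\<And>w. w \<in> U \<Longrightarrow> card (nbrs E w \<inter> R) < p" for U
  proof -
    have "card (nbrs E w \<inter> R - U) < length P" if "w \<in> U" for w
      using cut[of w U] U(3)[OF that] unfolding p_def by simp
    from extend_low_set[OF P0(1,3,4) U(1) this U(2) kT] obtain Y
      where Y: "U \<subseteq> Y" "Y \<subseteq> ?T" "card Y = k - p" "\<forall>w\<in>Y. card (nbrs E w \<inter> R - Y) < p"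
      unfolding p_def by blast
    then have "card (nbrs E x \<inter> R - Y) = p - 1" if "x \<in> U" for x
      using saturated[OF _ Y(2-4)] that by blast
    then show ?thesis using Y(1) by blast
  qed
  have tp: "card (nbrs E t \<inter> R) = p - 1"
  proof -
    have "\<exists>Y. {t} \<subseteq> Y \<and> (\<forall>x\<in>{t}. card (nbrs E x \<inter> R - Y) = p - 1)"
      using tT pk lowt(1) by (intro low_set) auto
    then obtain Y where "card (nbrs E t \<inter> R - Y) = p - 1" by blast
    then show ?thesis using cut[of t Y] lowt(1) by linarith
  qed
  then have Qp: "length Q = p" and tP: "nbrs E t \<inter> set P = {}" using lowt(2) by auto
  have nt: "nbrs E t \<inter> R = set Q - {t}"
  proof -
    have "nbrs E t \<inter> ?T \<subseteq> set Q - {t}" unfolding t_def by (rule longest_path_saturated(1)[OF Q])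
    then have sub: "nbrs E t \<inter> R \<subseteq> set Q - {t}" using tP by blast
    have "card (set Q - {t}) = p - 1" using Q(2) pth_distinct[OF Q(1)] Qp unfolding t_def by (simp add: distinct_card)
    then show ?thesis using card_seteq[OF _ sub] tp by simp
  qed
  show k1: "length P + 1 = k"
  proof (rule ccontr)
    assume "length P + 1 \<noteq> k"
    then have kp: "2 \<le> k - p" using pk unfolding p_def by simp
    obtain u Q' where Q': "Q = t # u # Q'"
    proof -
      obtain Q1 where "Q = t # Q1" using Q(2) unfolding t_def by (cases Q) auto
      moreover have "Q1 \<noteq> []" using Qp p2 calculation unfolding p_def by auto
      ultimately show ?thesis using that by (cases Q1) auto
    qed
    \<comment> \<open>As \<open>t\<close> is adjacent to all other vertices of \<open>Q\<close>,
      exchanging the first two vertices gives another longest path, which now starts in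
      \<open>u\<close>.\<close>
    have "pth E (u # t # Q')"
    proof -
      have "Q' \<noteq> [] \<Longrightarrow> {t, hd Q'} \<in> E"
      proof -
        assume "Q' \<noteq> []"
        then have "hd Q' \<in> set Q - {t}" using Q(1) unfolding Q' by (auto simp: pth_Cons)
        then show ?thesis using nt by (auto simp: nbrs_def)
      qed
      then show ?thesis using Q(1) unfolding Q' by (auto simp: pth_Cons insert_commute)
    qed
    moreover have "set (u # t # Q') \<subseteq> ?T" using Q(3) unfolding Q' by auto
    moreover have "length Q'' \<le> length (u # t # Q')" if "pth E Q''" "set Q'' \<subseteq> ?T" for Q''
      using Q(4)[OF that] unfolding Q' by simp
    ultimately have "card (nbrs E (hd (u # t # Q')) \<inter> (?T \<union> set P)) < length P"
      by (intro longest_path_end_degree(1)[OF P0(1,3,4) subset_refl]) auto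
    then have lowu: "card (nbrs E u \<inter> R) < p" unfolding TP p_def by simp
    have ut: "u \<in> ?T" "u \<noteq> t" using Q(1,3) unfolding Q' by (auto simp: pth_Cons)
    have "\<exists>Y. {t, u} \<subseteq> Y \<and> (\<forall>x\<in>{t, u}. card (nbrs E x \<inter> R - Y) = p - 1)"
      using tT ut kp lowt(1) lowu by (intro low_set) auto
    then obtain Y where Y: "u \<in> Y" "card (nbrs E t \<inter> R - Y) = p - 1" by blast
    have "nbrs E t \<inter> R - Y \<subset> nbrs E t \<inter> R" using Y(1) nt ut unfolding Q' by auto
    then have "card (nbrs E t \<inter> R - Y) < card (nbrs E t \<inter> R)" using finR by (intro psubset_card_mono) auto
    then show False using Y(2) tp by simp
  qed
  have pk1: "p + 1 = k" using k1 unfolding p_def .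
  have single: "nbrs E w \<inter> H = {a, a'} \<and> card (nbrs E w \<inter> R) = p - 1"
    if L: "pth E L" "set L \<subseteq> R" "length L = p" "w \<in> R" "w \<notin> set L" "card (nbrs E w \<inter> R) < p"
      and a: "a \<in> nbrs E (hd L) \<inter> H" "a' \<in> nbrs E (last L) \<inter> H" "a \<noteq> a'" for L w a a'
  proof -
    have "L \<noteq> []" using L(3) p2 unfolding p_def by auto
    moreover have "{a, hd L} \<in> E" "{a', last L} \<in> E" "a \<in> H" "a' \<in> H" using a by (auto simp: nbrs_iff(2))
    moreover have "length L + 1 = k" "card (nbrs E w \<inter> R) < length L" using L pk1 by auto
    ultimately show ?thesis using no_bypass_single[OF L(1) _ L(2) _ _ _ _ a(3) _ L(4,5)] L(3) by metis
  qed
  \<comment> \<open>An end \<open>w\<close> of a longest path in \<open>R - set L\<close> has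
    neighbourhood \<open>{a, a'}\<close> in \<open>H\<close> for every choice of distinct neighbours
    \<open>a\<close> of \<open>hd L\<close> and \<open>a'\<close> of \<open>last L\<close>. So both
    ends of \<open>L\<close> have this same pair as neighbourhood, and the minimum degree leaves
    \<open>k - 2 = p - 1\<close> neighbours for \<open>hd L\<close> on \<open>L\<close>.\<close>
  have ends: "nbrs E (hd L) \<inter> H = nbrs E (last L) \<inter> H \<and> card (nbrs E (hd L) \<inter> H) = 2 \<and>
      nbrs E (hd L) \<inter> R = set L - {hd L}" if L: "pth E L" "set L \<subseteq> R" "length L = p" for L
  proof -
    have L0: "L \<noteq> []" using L(3) p2 unfolding p_def by auto
    have maxL: "\<And>Q. \<lbrakk>pth E Q; set Q \<subseteq> R\<rbrakk> \<Longrightarrow> length Q \<le> length L" using maxp L(3) by auto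
    note e = longest_path_ends[OF L(1) L0 L(2) maxL]
    let ?A = "nbrs E (hd L) \<inter> H" and ?A' = "nbrs E (last L) \<inter> H"
    have e': "2 \<le> card ?A" "2 \<le> card ?A'" using e by auto
    let ?S = "R - set L"
    have "?S \<noteq> {}" "?S \<subseteq> R" using ne[OF L(3)] by auto
    then obtain M where M: "pth E M" "M \<noteq> []" "set M \<subseteq> ?S"
      "\<And>Q'. \<lbrakk>pth E Q'; set Q' \<subseteq> ?S\<rbrakk> \<Longrightarrow> length Q' \<le> length M"
      using longest_path_in[of ?S] by blast
    define w where "w = hd M"
    have "?S \<union> set L = R" using L(2) by auto
    then have wl: "card (nbrs E w \<inter> R) < p"
      using longest_path_end_degree(1)[OF L(1,2) maxL subset_refl M] L(3) unfolding w_def by simp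
    have wS: "w \<in> R" "w \<notin> set L" using hd_subset[OF M(2,3)] unfolding w_def by auto
    have pair: "nbrs E w \<inter> H = {a, a'}" if "a \<in> ?A" "a' \<in> ?A'" "a \<noteq> a'" for a a'
      using single[OF L wS wl that] by blast
    have "?A \<subseteq> nbrs E w \<inter> H"
    proof
      fix a assume a: "a \<in> ?A"
      obtain a' where "a' \<in> ?A'" "a' \<noteq> a" using ex_other[OF e'(2)] by blast
      then show "a \<in> nbrs E w \<inter> H" using pair[OF a] by auto
    qed
    moreover have "?A' \<subseteq> nbrs E w \<inter> H"
    proof
      fix a' assume a': "a' \<in> ?A'"
      obtain a where "a \<in> ?A" "a \<noteq> a'" using ex_other[OF e'(1)] by blast
      then show "a' \<in> nbrs E w \<inter> H" using pair[OF _ a'] by auto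
    qed
    moreover have "card (nbrs E w \<inter> H) = 2"
    proof -
      obtain a where a: "a \<in> ?A" using e'(1) by (metis card.empty ex_in_conv not_numeral_le_zero)
      obtain a' where "a' \<in> ?A'" "a' \<noteq> a" using ex_other[OF e'(2)] by blast
      then show ?thesis using pair[OF a] by auto
    qed
    ultimately have A: "?A = nbrs E w \<inter> H" "?A' = nbrs E w \<inter> H"
      using e' finH card_seteq[of "nbrs E w \<inter> H" ?A] card_seteq[of "nbrs E w \<inter> H" ?A'] by simp_all
    have c2: "card ?A = 2" using A(1) \<open>card (nbrs E w \<inter> H) = 2\<close> by simp
    have "hd L \<in> V" using RV[OF hd_subset[OF L0 L(2)]] .
    then have "k \<le> card (nbrs E (hd L))" by (rule deg)
    moreover have "card (nbrs E (hd L)) \<le> card ?A + card (nbrs E (hd L) \<inter> R)"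
      using nbrs_split[of "hd L"] by (metis card_Un_le)
    ultimately have "p - 1 \<le> card (nbrs E (hd L) \<inter> R)" using c2 pk1 by linarith
    moreover have "card (set L - {hd L}) = p - 1"
      using L0 pth_distinct[OF L(1)] L(3) by (simp add: distinct_card)
    ultimately have "nbrs E (hd L) \<inter> R = set L - {hd L}" using e(1) by (intro card_seteq) auto
    then show ?thesis using A c2 by auto
  qed
  \<comment> \<open>Every vertex \<open>v\<close> of \<open>L\<close> becomes an end:
    \<open>hd L\<close> is adjacent to the successor of \<open>v\<close>, so the part up to
    \<open>v\<close> can be reversed.\<close>
  have inner: "nbrs E v \<inter> R = set L - {v} \<and> nbrs E v \<inter> H = nbrs E (last L) \<inter> H \<and> card (nbrs E v \<inter> H) = 2"
    if L: "pth E L" "set L \<subseteq> R" "length L = p" and v: "v \<in> set L" for L v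
  proof -
    obtain A B where AB: "L = A @ v # B" using v by (meson split_list)
    show ?thesis
    proof (cases "B = []")
      case True
      then have "v = last L" "L \<noteq> []" using AB by auto
      then have "hd (rev L) = v" by (simp add: hd_rev)
      then show ?thesis using ends[of "rev L"] ends[OF L] L \<open>v = last L\<close> by auto
    next
      case False
      have L': "L = (A @ [v]) @ B" using AB by simp
      have hL: "hd (A @ [v]) = hd L" unfolding AB by (cases A) auto
      have pp: "pth E (A @ [v])" "pth E B" "set (A @ [v]) \<inter> set B = {}"
        using L(1) unfolding L' pth_append[of E "A @ [v]"] by auto
      have "hd L \<in> set (A @ [v])" using hL by (metis hd_in_set snoc_eq_iff_butlast)
      moreover have hB: "hd B \<in> set B" using False by simp
      then have "hd B \<notin> set (A @ [v])" using pp(3) by blast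
      moreover have "hd B \<in> set L" using hB AB by simp
      ultimately have "hd B \<in> set L - {hd L}" by auto
      then have "{hd L, hd B} \<in> E" using ends[OF L] by (auto simp: nbrs_def)
      moreover have "pth E (rev (A @ [v]))" using pp(1) by (simp only: pth_rev)
      moreover have "last (rev (A @ [v])) = hd L" using hL by (metis last_rev)
      ultimately have "pth E (rev (A @ [v]) @ B)" using pp(2,3) unfolding pth_append[of E "rev (A @ [v])"] by auto
      moreover have "set (rev (A @ [v]) @ B) = set L" "length (rev (A @ [v]) @ B) = p" using AB L(3) by auto
      moreover have "hd (rev (A @ [v]) @ B) = v" "last (rev (A @ [v]) @ B) = last L" using False AB by auto
      ultimately show ?thesis using ends[of "rev (A @ [v]) @ B"] L(2) by auto
    qed
  qed
  define N where "N = nbrs E (last P) \<inter> H"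
  have P0': "pth E P" "set P \<subseteq> R" "length P = p" using P0 p_def by auto
  have N: "nbrs E (hd P) \<inter> H = N" "nbrs E (last P) \<inter> H = N" "card N = 2" using ends[OF P0'] unfolding N_def by auto
  \<comment> \<open>By \<open>inner\<close>, vertices on longest paths have no neighbours in
    \<open>R\<close> off their path. So the neighbours in \<open>R\<close> of an end
    \<open>x\<close> of a longest path \<open>M\<close> among the uncovered vertices are themselves
    uncovered and lie on \<open>M\<close>. By \<open>single\<close> there are \<open>p - 1\<close>
    of them, so \<open>M\<close> has \<open>p\<close> vertices and covers \<open>x\<close> after
    all.\<close>
  have cover: "\<exists>L. pth E L \<and> set L \<subseteq> R \<and> length L = p \<and> w \<in> set L" if w: "w \<in> R" for w
  proof (rule ccontr)
    assume neg: "\<not> ?thesis"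
    define D where "D = \<Union> {set L |L. pth E L \<and> set L \<subseteq> R \<and> length L = p}"
    have "w \<in> R - D" using w neg unfolding D_def by blast
    then have "R - D \<noteq> {}" "R - D \<subseteq> R" by auto
    then obtain M where M: "pth E M" "M \<noteq> []" "set M \<subseteq> R - D"
      "\<And>Q'. \<lbrakk>pth E Q'; set Q' \<subseteq> R - D\<rbrakk> \<Longrightarrow> length Q' \<le> length M"
      using longest_path_in[of "R - D"] by blast
    define x where "x = hd M"
    have x: "x \<in> R" "x \<notin> D" using hd_subset[OF M(2,3)] unfolding x_def by auto
    have "nbrs E x \<inter> D = {}"
    proof (rule ccontr)
      assume "nbrs E x \<inter> D \<noteq> {}"
      then obtain y L where y: "y \<in> nbrs E x" "y \<in> set L" "pth E L" "set L \<subseteq> R" "length L = p" unfolding D_def by blast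
      then have "x \<in> nbrs E y \<inter> R" using x(1) by (auto simp: nbrs_def insert_commute)
      then have "x \<in> set L" using inner[OF y(3,4,5,2)] by auto
      then show False using x(2) y unfolding D_def by blast
    qed
    then have "nbrs E x \<inter> R = nbrs E x \<inter> (R - D)" by blast
    then have cx: "card (nbrs E x \<inter> R) \<le> length M - 1"
      using longest_path_saturated(2)[OF M] unfolding x_def by simp
    have Mp: "length M \<le> p" using maxp M(1,3) by blast
    have xP: "x \<notin> set P" using x(2) P0' unfolding D_def by blast
    obtain a a' where "a \<in> N" "a' \<in> N" "a \<noteq> a'" using N(3) by (auto simp: card_2_iff)
    then have "card (nbrs E x \<inter> R) = p - 1"
      using single[OF P0' x(1) xP, of a a'] N(1,2) cx Mp p2 unfolding p_def by auto
    then have "length M = p" using cx Mp p2 unfolding p_def by linarith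
    then have "x \<in> D" unfolding D_def x_def using M(1-3) hd_in_set by blast
    then show False using x(2) by blast
  qed
  show "\<forall>w\<in>R. card (nbrs E w \<inter> R) = length P - 1 \<and>
       (\<forall>w'\<in>nbrs E w \<inter> R. insert w' (nbrs E w' \<inter> R) = insert w (nbrs E w \<inter> R))"
  proof (intro ballI conjI)
    fix w assume "w \<in> R"
    then obtain L where L: "pth E L" "set L \<subseteq> R" "length L = p" "w \<in> set L" using cover by blast
    have nw: "nbrs E w \<inter> R = set L - {w}" using inner[OF L] by blast
    then show "card (nbrs E w \<inter> R) = length P - 1"
      using L(3,4) pth_distinct[OF L(1)] unfolding p_def by (simp add: distinct_card)
    fix w' assume w': "w' \<in> nbrs E w \<inter> R"
    then have "w' \<in> set L" using nw by auto
    then have "nbrs E w' \<inter> R = set L - {w'}" using inner[OF L(1-3)] by blast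
    then show "insert w' (nbrs E w' \<inter> R) = insert w (nbrs E w \<inter> R)" using nw L(4) \<open>w' \<in> set L\<close> by auto
  qed
  then have deg1: "card (nbrs E w \<inter> R) = p - 1" if "w \<in> R" for w using that unfolding p_def by blast
  have "nbrs E w \<inter> H = N" if w: "w \<in> R" for w
  proof (cases "w \<in> set P")
    case True
    then show ?thesis using inner[OF P0'] unfolding N_def by blast
  next
    case False
    obtain a a' where a: "N = {a, a'}" "a \<noteq> a'" using N(3) by (auto simp: card_2_iff)
    then show ?thesis using single[OF P0' w False, of a a'] N(1,2) deg1[OF w] p2 unfolding p_def by auto
  qed
  then show "\<exists>N\<subseteq>H. card N = 2 \<and> (\<forall>w\<in>R. nbrs E w \<inter> H = N)"
    using N(3) unfolding N_def by (intro exI[of _ N]) (auto simp: N_def)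
qed

text \<open>The last clause says that adjacent outside vertices have the same closed neighbourhood
  in \<open>R\<close>, so these neighbourhoods partition \<open>R\<close> into cliques of size
  \<open>p\<close>. For \<open>k = 2\<close> the two alternatives coincide.\<close>

theorem outside_structure:
  "\<exists>N p. N \<subseteq> H \<and> (p = 1 \<and> card N = k \<or> p = k - 1 \<and> card N = 2) \<and> 1 \<le> p \<and> card N + p = k + 1 \<and>
    (\<forall>Q. pth E Q \<and> set Q \<subseteq> R \<longrightarrow> length Q \<le> p) \<and>
    (\<forall>w\<in>R. nbrs E w \<inter> H = N \<and> card (nbrs E w \<inter> R) = p - 1 \<and>
      (\<forall>w'\<in>nbrs E w \<inter> R. insert w' (nbrs E w' \<inter> R) = insert w (nbrs E w \<inter> R)))"
proof -
  have "R \<noteq> {}" using cardR k2 by auto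
  then obtain P where P: "pth E P" "P \<noteq> []" "set P \<subseteq> R" "\<And>Q. \<lbrakk>pth E Q; set Q \<subseteq> R\<rbrakk> \<Longrightarrow> length Q \<le> length P"
    using longest_path_in[of R] by blast
  show ?thesis
  proof (cases "2 \<le> length P")
    case True
    note s = structure_cliques[OF P True]
    obtain N where "N \<subseteq> H" "card N = 2" "\<forall>w\<in>R. nbrs E w \<inter> H = N" using s(2) by blast
    then show ?thesis using s(1,3) P(4) True by (intro exI[of _ N] exI[of _ "length P"]) auto
  next
    case False
    have ind: "nbrs E w \<inter> R = {}" if w: "w \<in> R" for w
    proof (rule ccontr)
      assume "nbrs E w \<inter> R \<noteq> {}"
      then obtain w' where "w' \<in> nbrs E w" "w' \<in> R" by blast
      moreover have "w' \<noteq> w" using calculation nbrs_V by blast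
      ultimately have "length [w, w'] \<le> length P" using w by (intro P(4)) (auto simp: pth_Cons nbrs_def)
      then show False using False by simp
    qed
    obtain N where "N \<subseteq> H" "card N = k" "\<forall>w\<in>R. nbrs E w \<inter> H = N" using structure_independent[OF ind] by blast
    moreover have "length P = 1" using False P(2) by (cases P) (auto simp: not_less_eq_eq)
    ultimately show ?thesis using ind P(4) by (intro exI[of _ N] exI[of _ 1]) auto
  qed
qed

end

section \<open>The cycle and its closure\<close>

lemma cyc_rotate: "cyc E xs \<Longrightarrow> cyc E (rotate m xs)"
proof (induction m)
  case (Suc m)
  let ?ys = "rotate m xs"
  have c: "cyc E ?ys" using Suc by blast
  then obtain a ys where ys: "?ys = a # ys" by (cases ?ys) (auto simp: cyc_def)
  have "ys \<noteq> []" using c ys by (auto simp: cyc_def)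
  then have "cyc E (ys @ [a])" using c unfolding ys cyc_def by (auto simp: pth_append pth_Cons insert_commute)
  then show ?case using ys by simp
qed simp

lemma pth_take: "pth E xs \<Longrightarrow> pth E (take m xs)"
  by (metis append_take_drop_id pth_append)

context clique_circ begin

text \<open>If some \<open>h\<close> in \<open>H\<close> is off the cycle, no two consecutive
  vertices of \<open>C\<close> lie in \<open>H\<close>, because \<open>h\<close> would fit between
  them. So a clique vertex on \<open>C\<close> is followed by an outside vertex and belongs to
  \<open>N\<close>. Among any \<open>p + 1\<close> consecutive vertices there is such a vertex;
  sending a position to it and to its distance ahead is injective, whence
  \<open>c \<le> card N * (p + 1)\<close>.\<close>

lemma clique_subset_cycle:
  assumes C: "cyc E C" "length C = c" and N: "\<And>w. w \<in> R \<Longrightarrow> nbrs E w \<inter> H = N"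
    and p: "\<And>Q. \<lbrakk>pth E Q; set Q \<subseteq> R\<rbrakk> \<Longrightarrow> length Q \<le> p" and Np: "card N * (p + 1) < c" "N \<subseteq> H" "1 \<le> card N"
  shows "H \<subseteq> set C"
proof (rule ccontr)
  assume "\<not> ?thesis"
  then obtain h where h: "h \<in> H" "h \<notin> set C" by blast
  have C0: "C \<noteq> []" and dC: "distinct C" using C(1) by (auto simp: cyc_def pth_def)
  have "1 * (p + 1) \<le> card N * (p + 1)" using Np(3) by (rule mult_right_mono) simp
  from le_less_trans[OF this Np(1)] have pc: "p + 1 < c" by simp
  have CV: "set C \<subseteq> V"
  proof -
    have "{last C, hd C} \<in> E" using C(1) by (simp add: cyc_def)
    then have "hd C \<in> V" using adj_V by blast
    then show ?thesis using pth_subset[OF EV] C(1) by (simp add: cyc_def)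
  qed
  have succ: "C ! (Suc i mod c) \<in> R \<and> {C ! i, C ! (Suc i mod c)} \<in> E" if i: "i < c" "C ! i \<in> H" for i
  proof -
    let ?D = "rotate (Suc i) C"
    have D: "cyc E ?D" using cyc_rotate[OF C(1)] .
    have D0: "?D \<noteq> []" using C0 by simp
    have hd: "hd ?D = C ! (Suc i mod c)"
      using hd_rotate_conv_nth[OF C0, of "Suc i"] unfolding C(2) .
    have "last ?D = ?D ! (c - 1)" using D0 C(2) by (simp add: last_conv_nth)
    also have "\<dots> = C ! ((Suc i + (c - 1)) mod c)" using C(2) c3 nth_rotate[of "c - 1" C "Suc i"] by simp
    also have "Suc i + (c - 1) = i + c" using c3 by simp
    finally have last: "last ?D = C ! i" using i by simp
    have e: "{C ! i, C ! (Suc i mod c)} \<in> E" using D hd last by (simp add: cyc_def)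
    have "C ! (Suc i mod c) \<notin> H"
    proof
      assume s: "C ! (Suc i mod c) \<in> H"
      have "{C ! i, h} \<in> E" "{h, C ! (Suc i mod c)} \<in> E"
        using clique[OF i(2) h(1)] clique[OF h(1) s] h(2) i(1) s C(2) c3 by (metis nth_mem, metis mod_less_divisor nth_mem less_le_trans zero_less_numeral)
      moreover have "h \<notin> set ?D" using h(2) by simp
      ultimately have "cyc E (?D @ [h])" using D D0 hd last unfolding cyc_def by (simp add: pth_append)
      then have "length (?D @ [h]) \<le> c" by (rule no_long)
      then show False using C(2) by simp
    qed
    moreover have "Suc i mod c < c" using c3 by simp
    then have "C ! (Suc i mod c) \<in> V" using CV C(2) nth_mem by blast
    ultimately show ?thesis using e HR(2) by blast
  qed
  have hit: "\<exists>d\<le>p. C ! ((i + d) mod c) \<in> N" if i: "i < c" for i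
  proof -
    let ?D = "take (p + 1) (rotate i C)"
    have "pth E ?D" using cyc_rotate[OF C(1), of i] pth_take unfolding cyc_def by blast
    moreover have len: "length ?D = p + 1" using pc C(2) by simp
    ultimately have "\<not> set ?D \<subseteq> R" using p[of ?D] by auto
    then obtain d where d: "d < p + 1" "?D ! d \<notin> R" using len by (auto simp: in_set_conv_nth subset_iff)
    have "?D ! d = C ! ((i + d) mod c)" using d(1) pc C(2) by (simp add: nth_rotate)
    then have nR: "C ! ((i + d) mod c) \<notin> R" using d(2) by simp
    have lt: "(i + d) mod c < c" using c3 by simp
    then have "C ! ((i + d) mod c) \<in> V" using CV C(2) nth_mem by blast
    then have "C ! ((i + d) mod c) \<in> H" using nR HR(2) by blast
    moreover from succ[OF lt this] have "C ! ((i + d) mod c) \<in> nbrs E (C ! (Suc ((i + d) mod c) mod c))"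
      "C ! (Suc ((i + d) mod c) mod c) \<in> R" by (auto simp: nbrs_iff(2))
    ultimately show ?thesis using N d(1) by (intro exI[of _ d]) auto
  qed
  define d where "d i = (SOME d. d \<le> p \<and> C ! ((i + d) mod c) \<in> N)" for i
  have d: "d i \<le> p" "C ! ((i + d i) mod c) \<in> N" if "i < c" for i
    using someI_ex[OF hit[OF that]] unfolding d_def by auto
  define g where "g i = (C ! ((i + d i) mod c), d i)" for i
  have inj: "inj_on g {..<c}"
  proof
    fix i j assume ij: "i \<in> {..<c}" "j \<in> {..<c}" "g i = g j"
    have lt: "(i + d i) mod c < length C" "(j + d j) mod c < length C" using C(2) c3 by auto
    have "d i = d j" "(i + d i) mod c = (j + d j) mod c"
      using ij(3) dC lt unfolding g_def by (auto simp: nth_eq_iff_index_eq)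
    then have eq: "(i + d i) mod c = (j + d i) mod c" by simp
    show "i = j"
    proof (rule ccontr)
      assume "i \<noteq> j"
      then consider "i < j" | "j < i" by linarith
      then show False
      proof cases
        case 1
        then have "c dvd (j + d i) - (i + d i)" using eq mod_eq_dvd_iff_nat[of "i + d i" "j + d i" c] by simp
        then show False using 1 ij(2) by (auto dest: dvd_imp_le)
      next
        case 2
        then have "c dvd (i + d i) - (j + d i)" using eq mod_eq_dvd_iff_nat[of "j + d i" "i + d i" c] by simp
        then show False using 2 ij(1) by (auto dest: dvd_imp_le)
      qed
    qed
  qed
  have "finite N" using Np(2) finH finite_subset by blast
  then have "card {..<c} \<le> card (N \<times> {..p})"
    using inj d by (intro card_inj_on_le[of g]) (auto simp: g_def)
  then show False using Np(1) by (simp add: card_cartesian_product)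
qed

end

section \<open>From the given definitions to edge sets, and the closure\<close>

lemma degree_eq_card_nbrs:
  assumes "simple_graph G"
  shows "degree G v = card (nbrs (edges G) v)"
proof -
  have "(\<lambda>w. {v, w}) ` nbrs (edges G) v = {e \<in> edges G. v \<in> e}"
  proof (intro equalityI subsetI)
    fix e assume e: "e \<in> {e \<in> edges G. v \<in> e}"
    then have "card e = 2" using assms by (auto simp: simple_graph_def all_pairs_def)
    then obtain w where "e = {v, w}" using e by (auto simp: card_2_iff)
    then show "e \<in> (\<lambda>w. {v, w}) ` nbrs (edges G) v" using e by (auto simp: nbrs_def)
  qed (auto simp: nbrs_def)
  moreover have "inj_on (\<lambda>w. {v, w}) (nbrs (edges G) v)" by (auto simp: inj_on_def doubleton_eq_iff)
  ultimately show ?thesis unfolding degree_def by (metis card_image)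
qed

lemma is_cycle_iff:
  "is_cycle G C \<longleftrightarrow> cyc (edges G) C \<and> set C \<subseteq> verts G"
proof (cases "3 \<le> length C")
  case True
  define m where "m = length C - 1"
  have m: "length C = Suc m" "C \<noteq> []" using True unfolding m_def by auto
  have "(\<forall>i < length C. {C ! i, C ! (Suc i mod length C)} \<in> edges G) \<longleftrightarrow>
    (\<forall>i. Suc i < length C \<longrightarrow> {C ! i, C ! Suc i} \<in> edges G) \<and> {last C, hd C} \<in> edges G" (is "?L \<longleftrightarrow> ?R")
  proof
    assume L: ?L
    have "{C ! i, C ! Suc i} \<in> edges G" if "Suc i < length C" for i
      using L[rule_format, of i] that by simp
    moreover have "{last C, hd C} \<in> edges G"
      using L[rule_format, of m] m by (simp add: last_conv_nth hd_conv_nth)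
    ultimately show ?R by blast
  next
    assume R: ?R
    show ?L
    proof (intro allI impI)
      fix i assume i: "i < length C"
      show "{C ! i, C ! (Suc i mod length C)} \<in> edges G"
      proof (cases "i = m")
        case True
        then show ?thesis using R m by (simp add: last_conv_nth hd_conv_nth)
      next
        case False
        then have "Suc i < length C" using i m by simp
        then show ?thesis using R by simp
      qed
    qed
  qed
  then show ?thesis using True unfolding is_cycle_def cyc_def pth_def successively_conv_nth by auto
qed (simp add: is_cycle_def cyc_def)

text \<open>A walk in the graph without \<open>z\<close> from a vertex of \<open>S\<close> to one
  outside \<open>S\<close> has a step that leaves \<open>S\<close>.\<close>

lemma two_connected_conn2:
  assumes "two_connected G" "finite (verts G)"
  shows "conn2 (verts G) (edges G)"
  unfolding conn2_def
proof (intro conjI ballI allI impI)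
  show "3 \<le> card (verts G)" using assms unfolding two_connected_def by simp
  fix z S assume z: "z \<in> verts G" and S: "S \<subseteq> verts G - {z} \<and> S \<noteq> {} \<and> S \<noteq> verts G - {z}"
  let ?I = "induced G (verts G - {z})"
  have con: "graph_connected ?I" using assms z unfolding two_connected_def by simp
  have vI: "verts ?I = verts G - {z}" unfolding induced_def by auto
  obtain u w where uw: "u \<in> S" "w \<in> verts G - {z} - S" using S by blast
  then have "(u, w) \<in> {(x, y). {x, y} \<in> edges ?I}\<^sup>*"
    using con S vI unfolding graph_connected_def by blast
  then show "\<exists>u\<in>S. \<exists>w\<in>verts G - {z} - S. {u, w} \<in> edges G"
    using uw(2)
  proof (induction rule: rtrancl_induct)
    case base
    then show ?case using uw(1) by blast
  next
    case (step y w)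
    have e: "{y, w} \<in> edges G" "{y, w} \<subseteq> verts G - {z}" using step.hyps unfolding induced_def by auto
    show ?case
    proof (cases "y \<in> S")
      case True then show ?thesis using e step.prems by blast
    next
      case False then show ?thesis using e step.IH by blast
    qed
  qed
qed

text \<open>The part \<open>T\<close> of \<open>F\<close> on the cycle is already closed. A
  nonadjacent pair of \<open>T\<close> contains a vertex outside \<open>H\<close>, of degree at most
  \<open>k\<close>; the other vertex has degree at most \<open>k\<close> as well or, if it lies in
  \<open>H\<close>, at most \<open>card H - 1 = length C - k\<close>. Either sum is below
  \<open>length C + 1\<close>. Conversely, the edges of \<open>F\<close> missing in \<open>G\<close>
  lie inside \<open>H\<close>, and by \<open>dense\<close> each of them has a sufficient degree sum
  already in \<open>G\<close>.\<close>

lemma C_closure_eq: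
  assumes G: "simple_graph G" and F: "edges G \<subseteq> F" "F \<subseteq> all_pairs (verts G)"
    and C: "set C \<subseteq> verts G" and H: "H \<subseteq> set C"
    and clique: "\<And>u v. \<lbrakk>u \<in> H; v \<in> H; u \<noteq> v\<rbrakk> \<Longrightarrow> {u, v} \<in> F"
    and outside: "\<And>w. w \<in> verts G - H \<Longrightarrow> nbrs F w = nbrs (edges G) w"
    and low: "\<And>w. w \<in> verts G - H \<Longrightarrow> card (nbrs F w) = k" "2 * k \<le> length C"
    and high: "\<And>h w. \<lbrakk>h \<in> H; w \<in> verts G - H; {h, w} \<notin> F\<rbrakk> \<Longrightarrow> nbrs F h \<subseteq> H"
    and cH: "card H + k = length C + 1"
    and dense: "\<And>u v. \<lbrakk>u \<in> H; v \<in> H; u \<noteq> v; {u, v} \<notin> edges G\<rbrakk> \<Longrightarrow>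
      length C + 1 \<le> card (nbrs (edges G) u \<inter> H) + card (nbrs (edges G) v \<inter> H)"
  shows "C_closure G C = G\<lparr>edges := F\<rparr>"
proof -
  define m where "m = length C + 1"
  define G0 where "G0 = induced G (set C)"
  define M where "M = m_closure m G0"
  define T where "T = \<lparr>verts = set C, edges = {e \<in> F. e \<subseteq> set C}\<rparr>"
  have finV: "finite (verts G)" using G by (simp add: simple_graph_def)
  have G0: "verts G0 = set C" "edges G0 = {e \<in> edges G. e \<subseteq> set C}" "simple_graph G0"
    using C simple_graph_induced[OF G] unfolding G0_def by (auto simp: induced_def)
  have cl: "is_closure m G0 M" unfolding M_def by (rule is_closure_m_closure[OF G0(3)])
  then have steps: "(closure_step m)\<^sup>*\<^sup>* G0 M" and closed: "\<nexists>K. closure_step m M K" unfolding is_closure_def by auto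
  have M: "simple_graph M" "verts M = set C" "edges G0 \<subseteq> edges M"
    using closure_steps_simple[OF steps G0(3)] closure_steps_mono[OF steps] G0(1) by auto
  have sT: "simple_graph T" unfolding T_def simple_graph_def using F(2) by (auto simp: all_pairs_def)
  have nF: "nbrs F u \<subseteq> verts G - {u}" for u using F(2) all_pairs_iff[of u _ "verts G"] by (auto simp: nbrs_def)
  have fF: "finite (nbrs F u)" for u using nF finV by (meson finite_Diff finite_subset)
  have finH: "finite H" using H finite_subset by blast
  have degT: "degree T u \<le> card (nbrs F u)" for u
    unfolding degree_eq_card_nbrs[OF sT] using fF by (intro card_mono) (auto simp: T_def nbrs_def)
  have lowpair: "degree T u + degree T v < m" if uv: "u \<in> set C - H" "v \<in> set C" "u \<noteq> v" "{u, v} \<notin> F" for u v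
  proof -
    have du: "degree T u \<le> k" using degT[of u] low(1)[of u] uv(1) C by auto
    have "degree T v + k < m"
    proof (cases "v \<in> H")
      case True
      have "nbrs F v \<subseteq> H - {v}" using high[OF True, of u] uv C nF by (auto simp: insert_commute)
      then have "card (nbrs F v) \<le> card (H - {v})" using finH by (intro card_mono) auto
      also have "card (H - {v}) < card H" using True finH by (intro psubset_card_mono) auto
      finally show ?thesis using degT[of v] cH unfolding m_def by linarith
    next
      case False
      then have "degree T v \<le> k" using degT[of v] low(1)[of v] uv(2) C by auto
      then show ?thesis using low(2) unfolding m_def by linarith
    qed
    then show ?thesis using du by linarith
  qed
  have "\<nexists>L. closure_step m T L"
  proof
    assume "\<exists>L. closure_step m T L"
    then obtain u v where uv: "u \<in> set C" "v \<in> set C" "u \<noteq> v" "{u, v} \<notin> edges T" "m \<le> degree T u + degree T v"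
      unfolding closure_step_def by (auto simp: T_def)
    have nF: "{u, v} \<notin> F" using uv unfolding T_def by auto
    then have "u \<notin> H \<or> v \<notin> H" using clique uv(3) by blast
    then show False using lowpair[of u v] lowpair[of v u] uv nF by (auto simp: insert_commute)
  qed
  moreover have "verts T = verts G0" "edges G0 \<subseteq> edges T" using G0 F(1) unfolding T_def by auto
  ultimately have MT: "edges M \<subseteq> edges T" using closure_steps_below[OF steps sT] by blast
  have new: "e \<subseteq> H" if e: "e \<in> F" "e \<notin> edges G" for e
  proof (rule ccontr)
    assume "\<not> e \<subseteq> H"
    then obtain w where w: "w \<in> e" "w \<notin> H" by blast
    have "card e = 2" "e \<subseteq> verts G" using e(1) F(2) by (auto simp: all_pairs_def)
    then obtain x where x: "e = {w, x}" "w \<in> verts G" using w(1) by (auto simp: card_2_iff)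
    then have "x \<in> nbrs F w" using e(1) by (simp add: nbrs_def)
    then have "x \<in> nbrs (edges G) w" using outside[of w] x w(2) by simp
    then show False using e(2) x by (simp add: nbrs_def)
  qed
  have TM: "edges T \<subseteq> edges M"
  proof
    fix e assume "e \<in> edges T"
    then have e: "e \<in> F" "e \<subseteq> set C" unfolding T_def by auto
    show "e \<in> edges M"
    proof (cases "e \<in> edges G")
      case True then show ?thesis using e M(3) G0(2) by auto
    next
      case False
      have "card e = 2" using e(1) F(2) by (auto simp: all_pairs_def)
      then obtain u v where uv: "e = {u, v}" "u \<noteq> v" by (auto simp: card_2_iff)
      have uvH: "u \<in> H" "v \<in> H" using new[OF e(1) False] uv by auto
      have degM: "card (nbrs (edges G) x \<inter> H) \<le> degree M x" if "x \<in> H" for x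
      proof -
        have "nbrs (edges G) x \<inter> H \<subseteq> nbrs (edges M) x" using M(3) G0(2) H that by (auto simp: nbrs_def)
        moreover have "nbrs (edges M) x \<subseteq> verts M"
          using M(1) all_pairs_iff[of x _ "verts M"] by (auto simp: simple_graph_def nbrs_def)
        then have "finite (nbrs (edges M) x)" using M(1) finite_subset by (auto simp: simple_graph_def)
        ultimately show ?thesis unfolding degree_eq_card_nbrs[OF M(1)] by (intro card_mono)
      qed
      have "m \<le> degree M u + degree M v"
        using dense[OF uvH uv(2)] False uv(1) degM[OF uvH(1)] degM[OF uvH(2)] unfolding m_def by auto
      then show ?thesis using closed uvH H M(2) uv unfolding closure_step_def by blast
    qed
  qed
  have "edges M = edges T" using MT TM by blast
  then have eq: "C_closure G C = G\<lparr>edges := (edges G - edges G0) \<union> edges T\<rparr>"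
    unfolding C_closure_def M_def m_def G0_def by simp
  have "(edges G - edges G0) \<union> edges T = F"
  proof
    show "(edges G - edges G0) \<union> edges T \<subseteq> F" using F(1) unfolding T_def by auto
    show "F \<subseteq> (edges G - edges G0) \<union> edges T"
    proof
      fix e assume e: "e \<in> F"
      show "e \<in> (edges G - edges G0) \<union> edges T"
      proof (cases "e \<subseteq> set C")
        case True then show ?thesis using e unfolding T_def by auto
      next
        case False
        then have "e \<in> edges G" using new[OF e] H by blast
        then show ?thesis using False G0(2) by auto
      qed
    qed
  qed
  then show ?thesis using eq by simp
qed

section \<open>Isomorphism with the model graphs\<close>

text \<open>Number the classes, number the elements of each class by \<open>0..<p\<close>, and read
  the two numbers as quotient and remainder modulo \<open>p\<close>. Being in the same class thus
  becomes equality of \<open>div p\<close>, which is the form in \<open>model_adj\<close>.\<close>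

lemma enumerate_classes:
  assumes "finite R" "1 \<le> p"
    and cls: "\<And>w. w \<in> R \<Longrightarrow> w \<in> cls w \<and> cls w \<subseteq> R \<and> card (cls w) = p"
    and eq: "\<And>w w'. \<lbrakk>w \<in> R; w' \<in> cls w\<rbrakk> \<Longrightarrow> cls w' = cls w"
  shows "\<exists>g. bij_betw g R {..<card R} \<and> p dvd card R \<and>
    (\<forall>w\<in>R. \<forall>w'\<in>R. g w div p = g w' div p \<longleftrightarrow> cls w = cls w')"
proof -
  define \<C> where "\<C> = cls ` R"
  define q where "q = card \<C>"
  have "finite \<C>" unfolding \<C>_def using assms(1) by simp
  then obtain f where f: "bij_betw f \<C> {0..<q}" unfolding q_def using ex_bij_betw_finite_nat by blast
  have "\<exists>e. bij_betw e A {0..<p}" if "A \<in> \<C>" for A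
  proof -
    obtain w where "w \<in> R" "A = cls w" using \<open>A \<in> \<C>\<close> unfolding \<C>_def by blast
    then have "finite A" "card A = p" using cls[of w] finite_subset[OF _ assms(1)] by auto
    then show ?thesis using ex_bij_betw_finite_nat by blast
  qed
  then obtain e where e: "\<And>A. A \<in> \<C> \<Longrightarrow> bij_betw (e A) A {0..<p}" by metis
  define g where "g w = f (cls w) * p + e (cls w) w" for w
  have clsC: "cls w \<in> \<C>" if "w \<in> R" for w using that unfolding \<C>_def by blast
  have ep: "e (cls w) w < p" if "w \<in> R" for w
    using bij_betwE[OF e[OF clsC[OF that]]] cls[OF that] by auto
  have dm: "g w div p = f (cls w)" "g w mod p = e (cls w) w" if "w \<in> R" for w
    unfolding g_def using ep[OF that] by auto
  have fin: "f (cls w) = f (cls w') \<longleftrightarrow> cls w = cls w'" if "w \<in> R" "w' \<in> R" for w w'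
    using bij_betw_imp_inj_on[OF f] clsC[OF that(1)] clsC[OF that(2)] by (rule inj_on_eq_iff)
  have inj: "inj_on g R"
  proof
    fix w w' assume w: "w \<in> R" "w' \<in> R" "g w = g w'"
    have c: "cls w = cls w'" using dm(1)[OF w(1)] dm(1)[OF w(2)] fin w by simp
    then have "e (cls w) w = e (cls w) w'" using dm(2)[OF w(1)] dm(2)[OF w(2)] w by simp
    moreover have "w \<in> cls w" "w' \<in> cls w" using cls w c by auto
    ultimately show "w = w'" using e[OF clsC[OF w(1)]] unfolding bij_betw_def inj_on_def by blast
  qed
  have im: "g ` R = {..<q * p}"
  proof
    show "g ` R \<subseteq> {..<q * p}"
    proof
      fix x assume "x \<in> g ` R"
      then obtain w where w: "w \<in> R" "x = g w" by blast
      have "f (cls w) < q" using bij_betwE[OF f] clsC[OF w(1)] by auto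
      then have "x div p < q" using dm(1)[OF w(1)] w(2) by simp
      then show "x \<in> {..<q * p}" using assms(2) by (simp add: div_less_iff_less_mult)
    qed
    show "{..<q * p} \<subseteq> g ` R"
    proof
      fix x assume x: "x \<in> {..<q * p}"
      then have "x div p < q" using assms(2) by (simp add: div_less_iff_less_mult)
      then have "x div p \<in> f ` \<C>" using bij_betw_imp_surj_on[OF f] by simp
      then obtain A where A: "A \<in> \<C>" "f A = x div p" by auto
      have "x mod p < p" using assms(2) by simp
      then have "x mod p \<in> e A ` A" using bij_betw_imp_surj_on[OF e[OF A(1)]] by simp
      then obtain w where w: "w \<in> A" "e A w = x mod p" by auto
      obtain w0 where w0: "w0 \<in> R" "A = cls w0" using A(1) unfolding \<C>_def by blast
      have "w \<in> R" using cls[OF w0(1)] w(1) w0(2) by blast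
      have "cls w = A" using eq[OF w0(1)] w(1) w0(2) by blast
      then have "g w = x" unfolding g_def using A(2) w(2) by simp
      then show "x \<in> g ` R" using \<open>w \<in> R\<close> by blast
    qed
  qed
  have card: "card R = q * p" using card_image[OF inj] im by simp
  then have "bij_betw g R {..<card R}" using inj im unfolding bij_betw_def by simp
  moreover have "\<forall>w\<in>R. \<forall>w'\<in>R. g w div p = g w' div p \<longleftrightarrow> cls w = cls w'" using dm(1) fin by simp
  ultimately show ?thesis using card by (intro exI[of _ g]) simp
qed

lemma bij_clique_special:
  assumes "finite H" "N \<subseteq> H"
  shows "\<exists>f. bij_betw f H {..<card H} \<and> (\<forall>h\<in>H. f h < card N \<longleftrightarrow> h \<in> N)"
proof -
  have fN: "finite N" using assms finite_subset by blast
  obtain f1 where f1: "bij_betw f1 N {0..<card N}" using ex_bij_betw_finite_nat[OF fN] by blast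
  have fD: "finite (H - N)" using assms by simp
  obtain f2 where f2: "bij_betw f2 (H - N) {0..<card (H - N)}" using ex_bij_betw_finite_nat[OF fD] by blast
  have cH: "card H = card N + card (H - N)" using assms fN by (metis card_Diff_subset card_mono le_add_diff_inverse)
  define f where "f h = (if h \<in> N then f1 h else card N + f2 h)" for h
  have b1: "bij_betw f N {..<card N}" using f1 bij_betw_cong[of N f f1] unfolding f_def by (simp add: atLeast0LessThan)
  have "bij_betw ((+) (card N)) {0..<card (H - N)} {card N..<card H}"
    unfolding cH by (rule bij_betw_byWitness[where f' = "\<lambda>x. x - card N"]) auto
  then have "bij_betw ((+) (card N) \<circ> f2) (H - N) {card N..<card H}" using f2 bij_betw_trans by blast
  then have b2: "bij_betw f (H - N) {card N..<card H}"
    using bij_betw_cong[of "H - N" f "(+) (card N) \<circ> f2"] unfolding f_def by simp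
  have "bij_betw f (N \<union> (H - N)) ({..<card N} \<union> {card N..<card H})"
    using b1 b2 by (rule bij_betw_combine) auto
  moreover have "N \<union> (H - N) = H" using assms(2) by blast
  moreover have "{..<card N} \<union> {card N..<card H} = {..<card H}" using cH by auto
  ultimately have "bij_betw f H {..<card H}" by simp
  moreover have "f h < card N \<longleftrightarrow> h \<in> N" if "h \<in> H" for h
  proof (cases "h \<in> N")
    case False
    then have "f h \<in> {card N..<card H}" using bij_betwE[OF b2] that by blast
    then show ?thesis using False by simp
  qed (use bij_betwE[OF b1] in auto)
  ultimately show ?thesis by blast
qed

text \<open>The vertices below \<open>r\<close> form the clique, those below \<open>s\<close> are its attachment vertices, and the
  vertices from \<open>r\<close> on are split into consecutive blocks of size \<open>p\<close>. The graphs \<open>W\<close> and \<open>Z\<close> are the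
  cases \<open>(s, p) = (k, 1)\<close> and \<open>(s, p) = (2, k - 1)\<close>.\<close>

definition model_adj :: "nat \<Rightarrow> nat \<Rightarrow> nat \<Rightarrow> nat \<Rightarrow> nat \<Rightarrow> bool" where
  "model_adj r s p i j \<longleftrightarrow> i \<noteq> j \<and> (i < r \<and> j < r \<or> i < s \<and> r \<le> j \<or> r \<le> i \<and> j < s \<or>
     r \<le> i \<and> r \<le> j \<and> (i - r) div p = (j - r) div p)"

lemma iso_model:
  assumes finV: "finite V" and FV: "F \<subseteq> all_pairs V" and HV: "H \<subseteq> V" and NH: "N \<subseteq> H" and p: "1 \<le> p"
    and clique: "\<And>u v. \<lbrakk>u \<in> H; v \<in> H; u \<noteq> v\<rbrakk> \<Longrightarrow> {u, v} \<in> F"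
    and out: "\<And>w. w \<in> V - H \<Longrightarrow> nbrs F w \<inter> H = N \<and> card (nbrs F w \<inter> (V - H)) = p - 1 \<and>
      (\<forall>w'\<in>nbrs F w \<inter> (V - H). insert w' (nbrs F w' \<inter> (V - H)) = insert w (nbrs F w \<inter> (V - H)))"
  shows "p dvd card V - card H \<and> (\<exists>\<phi>. bij_betw \<phi> V {..<card V} \<and>
    (\<forall>u\<in>V. \<forall>v\<in>V. {u, v} \<in> F \<longleftrightarrow> model_adj (card H) (card N) p (\<phi> u) (\<phi> v)))"
proof -
  define R where "R = V - H"
  define r where "r = card H"
  define cls where "cls w = insert w (nbrs F w \<inter> R)" for w
  have finH: "finite H" and finR: "finite R" using finV HV finite_subset unfolding R_def by auto
  have irr: "{u, v} \<in> F \<Longrightarrow> u \<noteq> v" for u v using FV all_pairs_iff[of u v V] by auto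
  have c1: "w \<in> cls w \<and> cls w \<subseteq> R \<and> card (cls w) = p" if "w \<in> R" for w
  proof -
    have "w \<notin> nbrs F w" using irr[of w w] by (auto simp: nbrs_def)
    then show ?thesis using that out[of w] finR p unfolding cls_def R_def by simp
  qed
  have c2: "cls w' = cls w" if "w \<in> R" "w' \<in> cls w" for w w'
    using that out[of w] unfolding cls_def R_def by blast
  obtain g where g: "bij_betw g R {..<card R}" "p dvd card R"
    "\<forall>w\<in>R. \<forall>w'\<in>R. g w div p = g w' div p \<longleftrightarrow> cls w = cls w'"
    using enumerate_classes[OF finR p c1 c2] by blast
  obtain f where f: "bij_betw f H {..<r}" "\<forall>h\<in>H. f h < card N \<longleftrightarrow> h \<in> N"
    using bij_clique_special[OF finH NH] unfolding r_def by blast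
  have cR: "card R = card V - r" unfolding R_def r_def using HV finH by (simp add: card_Diff_subset)
  have rV: "r \<le> card V" unfolding r_def using HV finV by (rule card_mono[rotated])
  define \<phi> where "\<phi> v = (if v \<in> H then f v else r + g v)" for v
  have b1: "bij_betw \<phi> H {..<r}" using f(1) bij_betw_cong[of H \<phi> f] unfolding \<phi>_def by simp
  have "bij_betw ((+) r) {..<card R} {r..<card V}"
    unfolding cR using rV by (intro bij_betw_byWitness[where f' = "\<lambda>x. x - r"]) auto
  then have "bij_betw ((+) r \<circ> g) R {r..<card V}" using g(1) bij_betw_trans by blast
  then have b2: "bij_betw \<phi> R {r..<card V}"
    using bij_betw_cong[of R \<phi> "(+) r \<circ> g"] unfolding \<phi>_def R_def by simp
  have "bij_betw \<phi> (H \<union> R) ({..<r} \<union> {r..<card V})" using b1 b2 by (rule bij_betw_combine) auto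
  moreover have VHR: "H \<union> R = V" unfolding R_def using HV by blast
  moreover have "{..<r} \<union> {r..<card V} = {..<card V}" using rV by auto
  ultimately have bij: "bij_betw \<phi> V {..<card V}" by simp
  have lo: "\<phi> h < r" if "h \<in> H" for h using bij_betwE[OF b1] that by auto
  have hi: "r \<le> \<phi> w" if "w \<in> R" for w using bij_betwE[OF b2] that by auto
  have Nr: "card N \<le> r" unfolding r_def using NH finH by (rule card_mono[rotated])
  have sp: "\<phi> h < card N \<longleftrightarrow> h \<in> N" if "h \<in> H" for h using f(2) that unfolding \<phi>_def by simp
  have inj: "\<phi> u = \<phi> v \<longleftrightarrow> u = v" if "u \<in> V" "v \<in> V" for u v
    using bij that unfolding bij_betw_def inj_on_def by blast
  have dist: "H \<inter> R = {}" unfolding R_def by blast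
  have HR: "{h, w} \<in> F \<longleftrightarrow> model_adj r (card N) p (\<phi> h) (\<phi> w)" if hw: "h \<in> H" "w \<in> R" for h w
  proof -
    have "{h, w} \<in> F \<longleftrightarrow> h \<in> nbrs F w \<inter> H" using hw by (simp add: nbrs_def insert_commute)
    also have "\<dots> \<longleftrightarrow> h \<in> N" using out[of w] hw unfolding R_def by simp
    finally show ?thesis using lo[OF hw(1)] hi[OF hw(2)] sp[OF hw(1)] unfolding model_adj_def by auto
  qed
  have sym: "model_adj r (card N) p i j \<longleftrightarrow> model_adj r (card N) p j i" for i j unfolding model_adj_def by auto
  have "{u, v} \<in> F \<longleftrightarrow> model_adj r (card N) p (\<phi> u) (\<phi> v)" if uv: "u \<in> V" "v \<in> V" for u v
  proof -
    consider "u \<in> H" "v \<in> H" | "u \<in> H" "v \<in> R" | "u \<in> R" "v \<in> H" | "u \<in> R" "v \<in> R" using uv VHR by blast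
    then show ?thesis
    proof cases
      case 1
      then have "{u, v} \<in> F \<longleftrightarrow> u \<noteq> v" using clique irr by blast
      then show ?thesis using lo 1 inj[OF uv] unfolding model_adj_def by auto
    next
      case 2
      then show ?thesis by (rule HR)
    next
      case 3
      then show ?thesis using HR[of v u] sym[of "\<phi> u" "\<phi> v"] by (simp add: insert_commute)
    next
      case 4
      have "{u, v} \<in> F \<longleftrightarrow> u \<noteq> v \<and> v \<in> cls u" using 4 irr[of u v] unfolding cls_def by (auto simp: nbrs_def)
      also have "v \<in> cls u \<longleftrightarrow> cls u = cls v" using c1[OF 4(2)] c2[OF 4(1), of v] by auto
      also have "\<dots> \<longleftrightarrow> (\<phi> u - r) div p = (\<phi> v - r) div p"
        using g(3) 4 dist unfolding \<phi>_def by auto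
      finally show ?thesis using hi[OF 4(1)] hi[OF 4(2)] inj[OF uv] Nr unfolding model_adj_def by auto
    qed
  qed
  then show ?thesis using bij g(2) cR unfolding r_def by metis
qed

text \<open>With blocks of size 1, distinct vertices from \<open>c + 1 - k\<close> on are
  nonadjacent in the model. The assumption on \<open>k\<close> places the attachment vertices inside
  the clique.\<close>

lemma W_graph_adj:
  assumes "k \<le> c + 1 - k" "i < n" "j < n"
  shows "{i, j} \<in> edges (W_graph n k c) \<longleftrightarrow> model_adj (c + 1 - k) k 1 i j"
proof -
  define r where "r = c + 1 - k"
  have "{i, j} \<in> {{u, v} |u v. u \<in> {..<k} \<and> v \<in> {r..<n}} \<longleftrightarrow> i < k \<and> r \<le> j \<or> j < k \<and> r \<le> i"
    using assms(2,3) by (auto simp: doubleton_eq_iff)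
  then have "{i, j} \<in> edges (W_graph n k c) \<longleftrightarrow> (i < r \<and> j < r \<and> i \<noteq> j) \<or> (i < k \<and> r \<le> j \<or> j < k \<and> r \<le> i)"
    unfolding W_graph_def r_def[symmetric] using all_pairs_iff[of i j "{..<r}"] by simp
  then show ?thesis using assms(1) unfolding model_adj_def r_def[symmetric] by auto
qed

lemma Z_graph_adj:
  assumes k: "2 \<le> k" and r: "2 \<le> c + 1 - k" "c + 1 - k \<le> n" and dvd: "k - 1 dvd n - (c + 1 - k)"
  shows "verts (Z_graph n k c) = {..<n}"
    and "\<lbrakk>i < n; j < n\<rbrakk> \<Longrightarrow> {i, j} \<in> edges (Z_graph n k c) \<longleftrightarrow> model_adj (c + 1 - k) 2 (k - 1) i j"
proof -
  define r p where "r = c + 1 - k" and "p = k - 1"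
  define q where "q = (n - r) div p"
  define B where "B i = {0, 1} \<union> {r + i * p..<r + (i + 1) * p}" for i
  have p1: "1 \<le> p" using k unfolding p_def by simp
  \<comment> \<open>By divisibility the blocks end exactly at \<open>n\<close>.\<close>
  have n: "n = r + q * p" using dvd r(2) unfolding q_def r_def[symmetric] p_def[symmetric] by simp
  have Z: "Z_cliques n k c = insert {..<r} (B ` {..<q})"
    unfolding Z_cliques_def B_def r_def[symmetric] p_def[symmetric] q_def[symmetric] by auto
  have mem: "x \<in> B i \<longleftrightarrow> x < 2 \<or> r \<le> x \<and> (x - r) div p = i" for x i
  proof -
    have "r + i * p \<le> x \<and> x < r + (i + 1) * p \<longleftrightarrow> r \<le> x \<and> (x - r) div p = i"
    proof (cases "r \<le> x")
      case True
      then obtain y where y: "x = r + y" using le_iff_add by blast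
      have "i * p \<le> y \<and> y < (i + 1) * p \<longleftrightarrow> y div p = i"
        using p1 by (metis Suc_eq_plus1 div_nat_eqI less_eq_div_iff_mult_less_eq div_less_iff_less_mult less_Suc_eq_le order_refl lessI mult.commute not_one_le_zero gr0I)
      then show ?thesis using y by auto
    next
      case False
      then show ?thesis using trans_le_add1 by fastforce
    qed
    then show ?thesis unfolding B_def by auto
  qed
  have blk: "x < n \<longleftrightarrow> (x - r) div p < q" if "r \<le> x" for x
    using that p1 n by (simp add: div_less_iff_less_mult less_diff_conv2 add.commute)
  show "verts (Z_graph n k c) = {..<n}"
  proof -
    have "x \<in> \<Union> (Z_cliques n k c) \<longleftrightarrow> x < n" for x
    proof (cases "x < r")
      case True then show ?thesis unfolding Z using n by auto
    next
      case False
      then have "x \<in> \<Union> (Z_cliques n k c) \<longleftrightarrow> (\<exists>i<q. x \<in> B i)" unfolding Z by auto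
      also have "\<dots> \<longleftrightarrow> (x - r) div p < q" using False r(1) unfolding mem r_def[symmetric] by auto
      finally show ?thesis using blk[of x] False by simp
    qed
    then show ?thesis unfolding Z_graph_def by auto
  qed
  assume ij: "i < n" "j < n"
  have "{i, j} \<in> edges (Z_graph n k c) \<longleftrightarrow> i \<noteq> j \<and> (i < r \<and> j < r \<or> (\<exists>l<q. i \<in> B l \<and> j \<in> B l))"
    unfolding Z_graph_def Z using all_pairs_iff[of i j] by auto
  also have "\<dots> \<longleftrightarrow> model_adj r 2 p i j"
  proof (cases "i < r \<and> j < r")
    case True
    then show ?thesis unfolding model_adj_def by auto
  next
    case False
    have "(\<exists>l<q. i \<in> B l \<and> j \<in> B l) \<longleftrightarrow> (i < 2 \<and> r \<le> j \<or> r \<le> i \<and> j < 2 \<or>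
      r \<le> i \<and> r \<le> j \<and> (i - r) div p = (j - r) div p)"
      using False r(1) blk[of i] blk[of j] ij unfolding mem r_def[symmetric] by auto
    then show ?thesis using False unfolding model_adj_def by auto
  qed
  finally show "{i, j} \<in> edges (Z_graph n k c) \<longleftrightarrow> model_adj (c + 1 - k) 2 (k - 1) i j"
    unfolding r_def p_def .
qed

text \<open>The difference of \<open>f_edges n k c\<close> and \<open>f_edges n (k + 1) c\<close> is
  \<open>2 * c - n - 3 * k\<close>, which is at most \<open>c - 3 * k - 1\<close> as
  \<open>n \<ge> c + 1\<close>; the strict inequality for \<open>e\<close> takes off one
  more.\<close>

lemma few_missing_edges:
  assumes "c < n" "k + 1 \<le> c" "f_edges n (k + 1) c < e" "e + d \<le> f_edges n k c"
  shows "d + 3 * k + 2 \<le> c"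
proof -
  have "2 * int (f_edges n (k + 1) c) = (int c - int k) * (int c - int k - 1) + 2 * (int k + 1) * (int n + int k - int c)"
    using f_edges_int[of "k + 1" c n] assms(1,2) by (simp add: algebra_simps)
  moreover have "2 * int (f_edges n k c) = (int c + 1 - int k) * (int c - int k) + 2 * int k * (int n + int k - int c - 1)"
    using f_edges_int[of k c n] assms(1,2) by simp
  ultimately have "2 * int (f_edges n k c) = 2 * int (f_edges n (k + 1) c) + 4 * int c - 2 * int n - 6 * int k"
    by (simp add: algebra_simps)
  then show ?thesis using assms by linarith
qed

text \<open>Each of \<open>u\<close> and \<open>v\<close> has \<open>card H - 1\<close> possible
  neighbours in \<open>H\<close>. The missing ones correspond to edges of \<open>F - E\<close>, and
  only \<open>{u, v}\<close> can be counted from both sides. This gives the constant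
  \<open>3 = 2 + 1\<close>.\<close>

lemma nearly_clique_degree_sum:
  assumes finH: "finite H" and finF: "finite F" and EF: "E \<subseteq> F" and loop: "\<And>v. {v} \<notin> F"
    and clique: "\<And>u v. \<lbrakk>u \<in> H; v \<in> H; u \<noteq> v\<rbrakk> \<Longrightarrow> {u, v} \<in> F"
    and uv: "u \<in> H" "v \<in> H" "u \<noteq> v"
  shows "2 * card H \<le> card (nbrs E u \<inter> H) + card (nbrs E v \<inter> H) + card (F - E) + 3"
proof -
  define M where "M x = {y \<in> H - {x}. {x, y} \<notin> E}" for x
  define A where "A x = (\<lambda>y. {x, y}) ` M x" for x
  have fM: "finite (M x)" for x unfolding M_def using finH by simp
  have deg: "card H = card (nbrs E x \<inter> H) + card (M x) + 1" if "x \<in> H" for x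
  proof -
    have "H - {x} = (nbrs E x \<inter> H) \<union> M x" unfolding M_def using loop[of x] EF by (auto simp: nbrs_def)
    moreover have "(nbrs E x \<inter> H) \<inter> M x = {}" unfolding M_def by (auto simp: nbrs_def)
    ultimately have "card (H - {x}) = card (nbrs E x \<inter> H) + card (M x)"
      using finH fM by (metis card_Un_disjoint finite_Int)
    moreover have "card H = Suc (card (H - {x}))" using that finH by (metis card_Suc_Diff1)
    ultimately show ?thesis by simp
  qed
  have cA: "card (A x) = card (M x)" for x
    unfolding A_def by (rule card_image) (auto simp: inj_on_def doubleton_eq_iff)
  have AF: "A x \<subseteq> F - E" if "x \<in> H" for x unfolding A_def M_def using clique[OF that] by auto
  have fA: "finite (A x)" for x unfolding A_def using fM by simp
  have "card (A u) + card (A v) = card (A u \<union> A v) + card (A u \<inter> A v)" using fA by (intro card_Un_Int)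
  moreover have "card (A u \<union> A v) \<le> card (F - E)" using AF uv finF by (intro card_mono) auto
  moreover have "A u \<inter> A v \<subseteq> {{u, v}}" unfolding A_def using uv(3) by (auto simp: doubleton_eq_iff)
  then have "card (A u \<inter> A v) \<le> 1" using card_mono[of "{{u, v}}"] by fastforce
  ultimately show ?thesis using deg[OF uv(1)] deg[OF uv(2)] cA by simp
qed

lemma graph_iso_model:
  assumes "bij_betw \<phi> (verts G) {..<n}" "verts J = {..<n}"
    and "\<And>u v. \<lbrakk>u \<in> verts G; v \<in> verts G\<rbrakk> \<Longrightarrow> {u, v} \<in> edges G \<longleftrightarrow> model_adj r s p (\<phi> u) (\<phi> v)"
    and "\<And>i j. \<lbrakk>i < n; j < n\<rbrakk> \<Longrightarrow> {i, j} \<in> edges J \<longleftrightarrow> model_adj r s p i j"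
  shows "graph_iso G J"
  unfolding graph_iso_def
proof (intro exI[of _ \<phi>] conjI ballI)
  show "bij_betw \<phi> (verts G) (verts J)" using assms(1,2) by simp
  fix u v assume uv: "u \<in> verts G" "v \<in> verts G"
  then have "\<phi> u < n" "\<phi> v < n" using bij_betwE[OF assms(1)] by auto
  then show "{u, v} \<in> edges G \<longleftrightarrow> {\<phi> u, \<phi> v} \<in> edges J" using assms(3)[OF uv] assms(4) by blast
qed

theorem theorem1p9:
  fixes G :: "'a ugraph" and C :: "'a list" and n k c :: nat
  assumes "simple_graph G" and "card (verts G) = n"
    and "two_connected G"
    and "min_degree G \<ge> k"
    and "longest_cycle G C" and "length C = c"
    and "c \<in> {10..n - 1}"
    and "card (edges G) > max (f_edges n (k + 1) c) (f_edges n (c div 2) c)"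
  shows "graph_iso (C_closure G C) (W_graph n k c) \<or> graph_iso (C_closure G C) (Z_graph n k c)"
proof -
  define V where "V = verts G"
  define E where "E = edges G"
  have finV: "finite V" and EV: "E \<subseteq> all_pairs V" using assms(1) unfolding V_def E_def simple_graph_def by auto
  have c: "3 \<le> c" "c < n" using assms(7) by auto
  have cycC: "cyc E C" "set C \<subseteq> V"
    using assms(5) unfolding longest_cycle_def is_cycle_iff E_def V_def by auto
  have long: "length D \<le> c" if D: "cyc E D" for D
  proof -
    have "{last D, hd D} \<in> E" using D by (simp add: cyc_def)
    then have "{last D, hd D} \<in> all_pairs V" using EV by (rule rev_subsetD)
    then have "hd D \<in> V" by (simp add: all_pairs_iff)
    then have "set D \<subseteq> V" using pth_subset[OF EV] D by (simp add: cyc_def)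
    then show ?thesis using assms(5,6) D unfolding longest_cycle_def is_cycle_iff E_def V_def by blast
  qed
  interpret g: circ V E c
    using finV EV two_connected_conn2[OF assms(3)] c long by unfold_locales (auto simp: V_def E_def)
  obtain F where EF: "E \<subseteq> F" and "max_circ V F c" using g.ex_maximal by blast
  then interpret f: max_circ V F c by simp
  have degE: "k \<le> card (nbrs E v)" if "v \<in> V" for v
  proof -
    have "Min (degree G ` V) \<le> degree G v" using finV that by (intro Min_le) auto
    then show ?thesis using assms(4) degree_eq_card_nbrs[OF assms(1)] unfolding min_degree_def V_def E_def by simp
  qed
  have sub: "nbrs E v \<subseteq> nbrs F v" for v using EF by (auto simp: nbrs_def)
  have degF: "k \<le> card (nbrs F v)" if "v \<in> V" for v
    using degE[OF that] card_mono[OF f.fin_nbrs sub] by (rule le_trans)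
  have finF: "finite F" using f.EV finite_all_pairs[OF finV] by (rule finite_subset)
  have "card E \<le> card F" using EF finF by (rule card_mono[rotated])
  then have eF: "max (f_edges n (k + 1) c) (f_edges n (c div 2) c) < card F"
    using assms(8) unfolding E_def by linarith
  obtain H where H: "H \<subseteq> V" "card H = c + 1 - k" "\<forall>u\<in>H. \<forall>v\<in>H. u \<noteq> v \<longrightarrow> {u, v} \<in> F"
    "2 \<le> k" "k < c div 2" "card F \<le> f_edges n k c"
    using f.clique_of_many_edges[of n k, OF _ c(2) degF eF] assms(2) unfolding V_def by blast
  have ck: "2 * k + 2 \<le> c" using H(5) by linarith
  interpret s: clique_circ V F c H k
    using H ck degF c(2) assms(2) by unfold_locales (auto simp: V_def)
  from s.outside_structure obtain N p where Np: "N \<subseteq> H"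
    "p = 1 \<and> card N = k \<or> p = k - 1 \<and> card N = 2" "1 \<le> p" "card N + p = k + 1"
    and paths': "\<forall>Q. pth F Q \<and> set Q \<subseteq> s.R \<longrightarrow> length Q \<le> p"
    and out': "\<forall>w\<in>s.R. nbrs F w \<inter> H = N \<and> card (nbrs F w \<inter> s.R) = p - 1 \<and>
      (\<forall>w'\<in>nbrs F w \<inter> s.R. insert w' (nbrs F w' \<inter> s.R) = insert w (nbrs F w \<inter> s.R))"
    by (elim exE conjE)
  note out = bspec[OF out']
  have paths: "length Q \<le> p" if "pth F Q" "set Q \<subseteq> s.R" for Q using paths' that by simp
  have R: "s.R = verts G - H" using s.R_def by (simp only: V_def)
  \<comment> \<open>The degree is \<open>card N + (p - 1)\<close>, so
    \<open>card N + p = k + 1\<close> makes it exactly \<open>k\<close>. As \<open>G\<close> has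
    minimum degree at least \<open>k\<close>, no edge of \<open>F\<close> at an outside vertex can
    be new.\<close>
  have degR: "card (nbrs F w) = k" if "w \<in> s.R" for w
  proof -
    have "card (nbrs F w) = card (nbrs F w \<inter> H) + card (nbrs F w \<inter> s.R)"
    proof -
      have "card ((nbrs F w \<inter> H) \<union> (nbrs F w \<inter> s.R)) = card (nbrs F w \<inter> H) + card (nbrs F w \<inter> s.R)"
        using f.fin_nbrs s.HR(1) by (intro card_Un_disjoint) auto
      then show ?thesis using s.nbrs_split[of w] by simp
    qed
    then show ?thesis using out[OF that] Np(3,4) by simp
  qed
  have sameR: "nbrs F w = nbrs E w" if "w \<in> s.R" for w
    using card_seteq[OF f.fin_nbrs sub, of w] degE[of w] degR[OF that] s.RV[OF that] by simp
  have HC: "H \<subseteq> set C"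
  proof (rule s.clique_subset_cycle[OF cyc_mono[OF cycC(1) EF] assms(6) _ paths])
    \<comment> \<open>Both alternatives for \<open>N\<close> and \<open>p\<close> give
      \<open>card N * (p + 1) = 2 * k\<close>.\<close>
    show "card N * (p + 1) < c" using Np(2) ck H(4) by auto
    show "1 \<le> card N" using Np(2) H(4) by auto
  qed (use out Np(1) in auto)
  have "card E + card (F - E) = card F"
    using card_Diff_subset[OF _ EF] finite_subset[OF EF finF] card_mono[OF finF EF] by simp
  then have few: "card (F - E) + 3 * k + 2 \<le> c"
    using few_missing_edges[of c n k "card E" "card (F - E)"] c(2) ck assms(8) H(6) unfolding E_def by simp
  have closure: "C_closure G C = G\<lparr>edges := F\<rparr>"
  proof (rule C_closure_eq[OF assms(1) _ _ _ HC])
    show "edges G \<subseteq> F" "F \<subseteq> all_pairs (verts G)" "set C \<subseteq> verts G"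
      using EF f.EV cycC(2) unfolding E_def V_def by auto
    show "nbrs F w = nbrs (edges G) w" "card (nbrs F w) = k" if "w \<in> verts G - H" for w
      using sameR degR that unfolding R E_def by auto
    show "2 * k \<le> length C" "card H + k = length C + 1" using ck assms(6) H(2) by auto
    show "{u, v} \<in> F" if "u \<in> H" "v \<in> H" "u \<noteq> v" for u v using s.clique[OF that] .
    \<comment> \<open>Attachment is all or nothing: a clique vertex with one outside neighbour lies
      in \<open>N\<close> and is adjacent to every outside vertex.\<close>
    show "nbrs F h \<subseteq> H" if h: "h \<in> H" "w \<in> verts G - H" "{h, w} \<notin> F" for h w
    proof
      fix x assume x: "x \<in> nbrs F h"
      show "x \<in> H"
      proof (rule ccontr)
        assume "x \<notin> H"
        then have "x \<in> s.R" using x f.nbrs_V s.HR(2) by blast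
        then have "h \<in> N" using out[of x] x h(1) by (auto simp: nbrs_def insert_commute)
        then have "h \<in> nbrs F w" using out[of w] h(2) unfolding R by blast
        then show False using h(3) by (simp add: nbrs_def insert_commute)
      qed
    qed
    \<comment> \<open>By \<open>few\<close> the sum is at least
      \<open>2 * (c + 1 - k) - (c - 3 * k - 2) - 3 = c + k + 1\<close>.\<close>
    show "length C + 1 \<le> card (nbrs (edges G) u \<inter> H) + card (nbrs (edges G) v \<inter> H)"
      if uv: "u \<in> H" "v \<in> H" "u \<noteq> v" "{u, v} \<notin> edges G" for u v
      using nearly_clique_degree_sum[OF s.finH finF EF f.loopfree s.clique uv(1-3)] few H(2) assms(6) ck
      unfolding E_def by linarith
  qed
  have model: "p dvd card V - card H \<and> (\<exists>\<phi>. bij_betw \<phi> V {..<card V} \<and>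
    (\<forall>u\<in>V. \<forall>v\<in>V. {u, v} \<in> F \<longleftrightarrow> model_adj (card H) (card N) p (\<phi> u) (\<phi> v)))"
    using iso_model[OF finV f.EV H(1) Np(1,3) s.clique] out unfolding s.R_def by blast
  then obtain \<phi> where \<phi>: "bij_betw \<phi> (verts (C_closure G C)) {..<n}"
    "\<And>u v. \<lbrakk>u \<in> verts (C_closure G C); v \<in> verts (C_closure G C)\<rbrakk> \<Longrightarrow>
      {u, v} \<in> edges (C_closure G C) \<longleftrightarrow> model_adj (c + 1 - k) (card N) p (\<phi> u) (\<phi> v)"
    using assms(2) H(2) unfolding closure V_def by auto
  from Np(2) show ?thesis
  proof (elim disjE conjE)
    assume p: "p = 1" "card N = k"
    have "graph_iso (C_closure G C) (W_graph n k c)"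
    proof (rule graph_iso_model[OF \<phi>(1) _ \<phi>(2)])
      show "verts (W_graph n k c) = {..<n}" by (simp add: W_graph_def)
      show "{i, j} \<in> edges (W_graph n k c) \<longleftrightarrow> model_adj (c + 1 - k) (card N) p i j" if "i < n" "j < n" for i j
        using W_graph_adj[OF _ that] ck p by simp
    qed
    then show ?thesis ..
  next
    assume p: "p = k - 1" "card N = 2"
    \<comment> \<open>The divisibility required by \<open>Z_graph_adj\<close> comes from the
      partition of the outside vertices into cliques of size \<open>p = k - 1\<close>.\<close>
    have r: "2 \<le> c + 1 - k" "c + 1 - k \<le> n" "k - 1 dvd n - (c + 1 - k)"
      using ck H(4) c(2) model p(1) H(2) assms(2) unfolding V_def by auto
    have "graph_iso (C_closure G C) (Z_graph n k c)"
      using Z_graph_adj[OF H(4) r] p by (intro graph_iso_model[OF \<phi>(1) _ \<phi>(2)]) auto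
    then show ?thesis ..
  qed
qed

end
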